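(* Let $G$ be a locally finite, infinite, connected graph. (i) If almost surely each component of $\mathfrak{F}_{\mathrm w}(G)$ is one-ended, then $\mathsf{WSF}\bigl(\overline{\mathfrak{F}_{\mathrm w}(G)}\bigr)=\mathsf{WSF}(G)$. (ii) If almost surely each component of $\mathfrak{F}_{\mathrm f}(G)$ is one-ended, then $\mathsf{FSF}\bigl(\overline{\mathfrak{F}_{\mathrm w}(G)}\bigr)=\mathsf{FSF}(G)$.
   Context: For a finite connected graph $K$, $\mathsf{UST}(K)$ is the uniform measure on spanning trees of $K$. Let $G$ be a locally finite, infinite, connected graph. An exhaustion of $G$ is a sequence $\langle G_n\rangle$ of finite connected subgraphs with $G_n\subset G_{n+1}$ and $\bigcup_n G_n=G$. Free spanning forest: given an exhaustion and a fixed finite subgraph $H$ of $G$, the weak limit of $\mathsf{UST}(G_n)\cap H$ exists; varying $H$ gives a probability measure $\mathsf{FSF}(G)$ on subgraphs of $G$. Wired spanning forest: for a finite connected subgraph $H$ of $G$, let $\widehat H$ be the finite graph obtained from $G$ by identifying all vertices not in $H$ to a single vertex, and $\mathsf{WSF}(H):=\mathsf{UST}(\widehat H)$. Given an exhaustion by induced subgraphs and a fixed finite subgraph $H$, the weak limit of $\mathsf{WSF}(G_n)\cap H$ exists; varying $H$ gives a probability measure $\mathsf{WSF}(G)$ on subgraphs of $G$. $\mathfrak{F}_{\mathrm w}(G)$ and $\mathfrak{F}_{\mathrm f}(G)$ denote random samples with laws $\mathsf{WSF}(G)$ and $\mathsf{FSF}(G)$ respectively; their components are a.s. infinite trees. An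 end of a tree is an equivalence class of infinite simple paths in the tree, two paths being equivalent if their symmetric difference is finite; a tree is one-ended if it has a single end. Induced-component graph: for a subgraph $H$ of $G$, $\overline H$ is the subgraph of $G$ with the same vertex set as $H$ in which an edge of $G$ is present iff both its endpoints lie in the same connected component of $H$. For a random subgraph $H$ of $G$ all of whose components are infinite, $\mathsf{WSF}(H)$ (resp. $\mathsf{FSF}(H)$) denotes the unconditional law of the random subgraph of $G$ obtained by first sampling $H$ and then, given $H$, sampling a wired (resp. free) spanning forest independently on each component of $H$. *)

theory Defs
  imports "HOL-Probability.Probability"
begin

text \<open>
  Undirected multigraphs. Multiple edges and loops are allowed, since identifying vertices
  creates them even from a simple graph; an edge keeps its name under such an identification,
  so that random subgraphs of different graphs can be compared. A simple graph is the case
  where the endpoint map is injective with two-element values.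
\<close>

record ('v, 'e) multigraph =
  verts :: "'v set"
  edges :: "'e set"
  endpoints :: "'e \<Rightarrow> 'v set"

definition wf_graph :: "('v, 'e) multigraph \<Rightarrow> bool" where
  "wf_graph G \<longleftrightarrow>
    (\<forall>e\<in>edges G. endpoints G e \<subseteq> verts G \<and> card (endpoints G e) \<in> {1, 2})"

definition locally_finite_graph :: "('v, 'e) multigraph \<Rightarrow> bool" where
  "locally_finite_graph G \<longleftrightarrow> (\<forall>v\<in>verts G. finite {e \<in> edges G. v \<in> endpoints G e})"

definition finite_graph :: "('v, 'e) multigraph \<Rightarrow> bool" where
  "finite_graph G \<longleftrightarrow> finite (verts G) \<and> finite (edges G)"

definition adjacency :: "('v, 'e) multigraph \<Rightarrow> ('v \<times> 'v) set" where
  "adjacency G = {(u, v). \<exists>e\<in>edges G. endpoints G e = {u, v}}"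

definition connected_graph :: "('v, 'e) multigraph \<Rightarrow> bool" where
  "connected_graph G \<longleftrightarrow>
    verts G \<noteq> {} \<and> (\<forall>u\<in>verts G. \<forall>v\<in>verts G. (u, v) \<in> (adjacency G)\<^sup>*)"

text \<open>Components are given by their vertex sets.\<close>

definition graph_components :: "('v, 'e) multigraph \<Rightarrow> 'v set set" where
  "graph_components G = (\<lambda>v. {u \<in> verts G. (v, u) \<in> (adjacency G)\<^sup>*}) ` verts G"

definition subgraph :: "('v, 'e) multigraph \<Rightarrow> ('v, 'e) multigraph \<Rightarrow> bool" where
  "subgraph H G \<longleftrightarrow> wf_graph H \<and> verts H \<subseteq> verts G \<and> edges H \<subseteq> edges G \<and>
    endpoints H = endpoints G"

definition induced_subgraph :: "('v, 'e) multigraph \<Rightarrow> 'v set \<Rightarrow> ('v, 'e) multigraph" where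
  "induced_subgraph G C = G\<lparr>verts := C, edges := {e \<in> edges G. endpoints G e \<subseteq> C}\<rparr>"

text \<open>
  The random subgraphs below all have the vertex set of the ambient graph, so they are encoded
  as sets of edges.
\<close>

definition spanning_subgraph :: "('v, 'e) multigraph \<Rightarrow> 'e set \<Rightarrow> ('v, 'e) multigraph" where
  "spanning_subgraph G F = G\<lparr>edges := F\<rparr>"

text \<open>Cycles of length one are loops, cycles of length two are pairs of parallel edges.\<close>

definition is_cycle :: "('v, 'e) multigraph \<Rightarrow> 'v list \<Rightarrow> 'e list \<Rightarrow> bool" where
  "is_cycle G vs es \<longleftrightarrow>
    es \<noteq> [] \<and> length vs = length es \<and> distinct vs \<and> distinct es \<and> set es \<subseteq> edges G \<and>
    (\<forall>i<length es. endpoints G (es ! i) = {vs ! i, vs ! (Suc i mod length es)})"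

definition is_tree :: "('v, 'e) multigraph \<Rightarrow> bool" where
  "is_tree G \<longleftrightarrow> connected_graph G \<and> (\<nexists>vs es. is_cycle G vs es)"

definition spanning_trees :: "('v, 'e) multigraph \<Rightarrow> 'e set set" where
  "spanning_trees G = {T. T \<subseteq> edges G \<and> is_tree (spanning_subgraph G T)}"

definition UST :: "('v, 'e) multigraph \<Rightarrow> 'e set pmf" where
  "UST G = pmf_of_set (spanning_trees G)"

text \<open>The product sigma-algebra on the subsets of the edge set.\<close>

definition subgraph_space :: "('v, 'e) multigraph \<Rightarrow> 'e set measure" where
  "subgraph_space G = sigma (Pow (edges G)) ((\<lambda>e. {F \<in> Pow (edges G). e \<in> F}) ` edges G)"

text \<open>
  The restriction to a finite edge set takes only finitely many values, so weak
  convergence of its law is convergence of the probability of every value.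
\<close>

definition weak_limit_on_finite ::
  "('v, 'e) multigraph \<Rightarrow> (nat \<Rightarrow> 'e set pmf) \<Rightarrow> 'e set measure \<Rightarrow> bool" where
  "weak_limit_on_finite G P M \<longleftrightarrow>
    (\<forall>K A. finite K \<longrightarrow> K \<subseteq> edges G \<longrightarrow> A \<subseteq> K \<longrightarrow>
      (\<lambda>n. measure_pmf.prob (P n) {T. T \<inter> K = A})
        \<longlonglongrightarrow> measure M {F \<in> space M. F \<inter> K = A})"

definition exhaustion :: "('v, 'e) multigraph \<Rightarrow> (nat \<Rightarrow> ('v, 'e) multigraph) \<Rightarrow> bool" where
  "exhaustion G Gs \<longleftrightarrow>
    (\<forall>n. finite_graph (Gs n) \<and> connected_graph (Gs n) \<and> subgraph (Gs n) G \<and>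
         subgraph (Gs n) (Gs (Suc n))) \<and>
    (\<Union>n. verts (Gs n)) = verts G \<and> (\<Union>n. edges (Gs n)) = edges G"

definition induced_exhaustion ::
  "('v, 'e) multigraph \<Rightarrow> (nat \<Rightarrow> ('v, 'e) multigraph) \<Rightarrow> bool" where
  "induced_exhaustion G Gs \<longleftrightarrow>
    exhaustion G Gs \<and> (\<forall>n. Gs n = induced_subgraph G (verts (Gs n)))"

text \<open>
  The graph obtained from G by identifying all vertices outside H to the single vertex
  None. Edges of G with no endpoint in H would become loops at None; they are dropped, which
  makes the graph finite and does not change its spanning trees. If H contains all vertices
  of G, then no vertex None is added.
\<close>

definition wired_graph ::
  "('v, 'e) multigraph \<Rightarrow> ('v, 'e) multigraph \<Rightarrow> ('v option, 'e) multigraph" where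
  "wired_graph G H =
    (let \<phi> = (\<lambda>v. if v \<in> verts H then Some v else None) in
     \<lparr>verts = \<phi> ` verts G,
      edges = {e \<in> edges G. endpoints G e \<inter> verts H \<noteq> {}},
      endpoints = (\<lambda>e. \<phi> ` endpoints G e)\<rparr>)"

text \<open>
  The free and wired spanning forests of a locally finite connected graph. The limits exist and
  do not depend on the exhaustion, and a law on the product sigma-algebra is determined by its
  finite-dimensional restrictions, so the descriptions below are definite. For a finite graph
  both laws are that of the uniform spanning tree.
\<close>

definition FSF :: "('v, 'e) multigraph \<Rightarrow> 'e set measure" where
  "FSF G = (THE M. prob_space M \<and> sets M = sets (subgraph_space G) \<and>
    (\<forall>Gs. exhaustion G Gs \<longrightarrow> weak_limit_on_finite G (\<lambda>n. UST (Gs n)) M))"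

definition WSF :: "('v, 'e) multigraph \<Rightarrow> 'e set measure" where
  "WSF G = (THE M. prob_space M \<and> sets M = sets (subgraph_space G) \<and>
    (\<forall>Gs. induced_exhaustion G Gs \<longrightarrow>
      weak_limit_on_finite G (\<lambda>n. UST (wired_graph G (Gs n))) M))"

text \<open>
  Infinite simple paths are one-way infinite; as subgraphs they are represented by their sets
  of edges.
\<close>

definition infinite_paths :: "('v, 'e) multigraph \<Rightarrow> 'e set set" where
  "infinite_paths T =
    {range es | es :: nat \<Rightarrow> 'e. \<exists>x :: nat \<Rightarrow> 'v.
      inj x \<and> (\<forall>i. es i \<in> edges T \<and> endpoints T (es i) = {x i, x (Suc i)})}"

definition tree_ends :: "('v, 'e) multigraph \<Rightarrow> 'e set set set" where
  "tree_ends T = infinite_paths T //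
    {(P, Q). P \<in> infinite_paths T \<and> Q \<in> infinite_paths T \<and> finite ((P - Q) \<union> (Q - P))}"

definition one_ended :: "('v, 'e) multigraph \<Rightarrow> bool" where
  "one_ended T \<longleftrightarrow> is_singleton (tree_ends T)"

definition all_components_one_ended :: "('v, 'e) multigraph \<Rightarrow> bool" where
  "all_components_one_ended H \<longleftrightarrow>
    (\<forall>C\<in>graph_components H. one_ended (induced_subgraph H C))"

text \<open>The edge set of the induced-component graph of the spanning subgraph with edge set F.\<close>

definition induced_component_graph :: "('v, 'e) multigraph \<Rightarrow> 'e set \<Rightarrow> 'e set" where
  "induced_component_graph G F =
    {e \<in> edges G. \<exists>C\<in>graph_components (spanning_subgraph G F). endpoints G e \<subseteq> C}"

text \<open>
  Sample from the law \<Phi> (WSF or FSF) independently on every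
  component of a fixed spanning subgraph of G and take the union of the samples.
\<close>

definition sample_on_components ::
  "(('v, 'e) multigraph \<Rightarrow> 'e set measure) \<Rightarrow> ('v, 'e) multigraph \<Rightarrow> 'e set \<Rightarrow> 'e set measure"
where
  "sample_on_components \<Phi> G F =
    (let H = spanning_subgraph G F in
     distr (\<Pi>\<^sub>M C\<in>graph_components H. \<Phi> (induced_subgraph H C)) (subgraph_space G)
       (\<lambda>\<omega>. \<Union>C\<in>graph_components H. \<omega> C))"

text \<open>
  The unconditional laws WSF(H) and FSF(H) of a random spanning subgraph H of G, where N is the
  law of the edge set of H.
\<close>

definition WSF_random :: "('v, 'e) multigraph \<Rightarrow> 'e set measure \<Rightarrow> 'e set measure" where
  "WSF_random G N = N \<bind> sample_on_components WSF G"

definition FSF_random :: "('v, 'e) multigraph \<Rightarrow> 'e set measure \<Rightarrow> 'e set measure" where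
  "FSF_random G N = N \<bind> sample_on_components FSF G"

end

theory Submission
  imports Defs
begin

text \<open>
  Orient every edge and regard a spanning tree of a graph in which some vertices are identified
  as a basis of its edges: a minimal set of edges making the same connections. The wired and free
  forests are limits of uniform bases, increasing respectively decreasing in the sense of
  stochastic domination (Feder and Mihail), because identifying vertices or adding edges
  decreases a uniform basis.

  Let T be a uniform basis and L a finite set of edges containing all edges K that touch a finite
  vertex set. Given T outside K and the connections made by T within L, the set of edges of T
  in K is a uniform basis inside the classes of these connections. It dominates the wired basis on
  each class, so in the limit the wired forest dominates its own resampling on the
  components. One-endedness turns this domination into equality: an edge of a one-ended forest
  leaves exactly one of its ends in an infinite component when removed, whereas in
  any forest with infinite components it leaves at least one. This bounds the marginals of the two
  forests by probabilities of increasing events, in opposite directions.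

  If the free forest is one-ended, the same argument identifies it with the wired forest. As the
  resampling is stationary, the resampled wired forest connects every component, and hence
  coincides with the resampled free forest, which dominates it and has no cycles.
\<close>

section \<open>Connections and maximal forests\<close>

text \<open>Connections are not local, so every comparison is made at finite stages and then passed
  to the limit. The resampling step nests three windows: a vertex set W whose edges are resampled,
  an edge set L in which connections are read off, and a wired graph approximating the wired forest.
  The outermost window grows first. The comparison has the right direction because a retained edge
  of T in L - K joins two vertices outside W that are connected within L, and wiring each class
  outside W identifies these two as well.

  Stochastic domination enters only through means of increasing functions of finitely many edges, so
  no coupling is built. Together with equality of one-edge marginals it forces equality of laws,
  because the number of edges of a finite set D that are present, minus the indicator that all of
  them are, is again increasing.

  Vertices are never merged. Identifications form a relation R on a fixed vertex set, so
  contraction, wiring and splitting into components all happen on the same vertices and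
  edges.\<close>

locale edge_ends =
  fixes en :: "'e \<Rightarrow> 'v \<times> 'v"
begin

text \<open>\<open>R\<close> lists pairs of vertices to be treated as one. Contracting an edge or
  wiring a region only enlarges \<open>R\<close>, so inductions never change the vertex
  type.\<close>

definition conn :: "('v \<times> 'v) set \<Rightarrow> 'e set \<Rightarrow> ('v \<times> 'v) set" where
  "conn R F = ((R \<union> en ` F) \<union> (R \<union> en ` F)\<inverse>)\<^sup>*"

lemma conn_refl [simp]: "(u, u) \<in> conn R F"
  by (simp add: conn_def)

lemma conn_sym: "(u, v) \<in> conn R F \<Longrightarrow> (v, u) \<in> conn R F"
  unfolding conn_def
  by (rule symD[OF sym_rtrancl]) (auto simp: sym_def)

lemma conn_commute: "(u, v) \<in> conn R F \<longleftrightarrow> (v, u) \<in> conn R F"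
  using conn_sym by blast

lemma conn_trans: "(u, v) \<in> conn R F \<Longrightarrow> (v, w) \<in> conn R F \<Longrightarrow> (u, w) \<in> conn R F"
  unfolding conn_def by (rule rtrancl_trans)

lemma conn_mono: "R \<subseteq> R' \<Longrightarrow> F \<subseteq> F' \<Longrightarrow> conn R F \<subseteq> conn R' F'"
  unfolding conn_def by (rule rtrancl_mono) auto

lemma conn_monoD: "(u, v) \<in> conn R F \<Longrightarrow> R \<subseteq> R' \<Longrightarrow> F \<subseteq> F' \<Longrightarrow> (u, v) \<in> conn R' F'"
  using conn_mono by blast

lemma conn_rel: "(u, v) \<in> R \<Longrightarrow> (u, v) \<in> conn R F"
  unfolding conn_def by auto

lemma conn_edge: "e \<in> F \<Longrightarrow> en e \<in> conn R F"
  unfolding conn_def by auto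

text \<open>The premises are equivalences because the closure is symmetric: each pair and each edge
  may be traversed in either direction.\<close>

lemma conn_induct [consumes 1, case_names refl rel edge]:
  assumes "(u, v) \<in> conn R F" and "Q u"
    and "\<And>a b. (a, b) \<in> R \<Longrightarrow> Q a \<longleftrightarrow> Q b"
    and "\<And>e a b. e \<in> F \<Longrightarrow> en e = (a, b) \<Longrightarrow> Q a \<longleftrightarrow> Q b"
  shows "Q v"
  using assms(1) unfolding conn_def
proof (induction rule: rtrancl_induct)
  case base
  then show ?case using assms(2) .
next
  case (step y z)
  from step.hyps(2) consider "(y, z) \<in> R" | "(z, y) \<in> R"
    | e where "e \<in> F" "en e = (y, z)" | e where "e \<in> F" "en e = (z, y)"
    by auto
  then show ?case using step.IH assms(3,4) by cases blast+
qed

lemma conn_least: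
  assumes "R \<subseteq> conn R' F'" "\<forall>e\<in>F. en e \<in> conn R' F'"
  shows "conn R F \<subseteq> conn R' F'"
proof (rule subrelI)
  fix u v assume "(u, v) \<in> conn R F"
  then show "(u, v) \<in> conn R' F'"
  proof (induction rule: conn_induct)
    case (rel a b)
    then have "(a, b) \<in> conn R' F'" using assms by blast
    then show ?case using conn_trans conn_sym by blast
  next
    case (edge e a b)
    then have "(a, b) \<in> conn R' F'" using assms(2) by metis
    then show ?case using conn_trans conn_sym by blast
  qed simp
qed

lemma conn_contract: "conn (R \<union> en ` X) F = conn R (X \<union> F)"
  unfolding conn_def by (simp add: image_Un Un_assoc)

lemma conn_contract_edge: "conn (insert (en f) R) F = conn R (insert f F)"
  using conn_contract[of R "{f}" F] by simp

lemma conn_insert: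
  assumes "en e = (a, b)"
  shows "(u, v) \<in> conn R (insert e F) \<longleftrightarrow> (u, v) \<in> conn R F \<or>
    (u, a) \<in> conn R F \<and> (b, v) \<in> conn R F \<or> (u, b) \<in> conn R F \<and> (a, v) \<in> conn R F"
    (is "_ \<longleftrightarrow> ?Q v")
proof
  assume "(u, v) \<in> conn R (insert e F)"
  then show "?Q v"
  proof (induction rule: conn_induct)
    case (rel x y)
    then have "(x, y) \<in> conn R F" by (rule conn_rel)
    then show ?case using conn_trans conn_sym by blast
  next
    case (edge g x y)
    show ?case
    proof (cases "g = e")
      case True
      then have "x = a" "y = b" using edge assms by auto
      then show ?thesis using conn_trans conn_sym conn_refl by metis
    next
      case False
      then have "(x, y) \<in> conn R F" using edge conn_edge[of g F R] by auto
      then show ?thesis using conn_trans conn_sym by blast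
    qed
  qed simp
next
  have *: "conn R F \<subseteq> conn R (insert e F)" by (rule conn_mono) auto
  have "(a, b) \<in> conn R (insert e F)" using conn_edge[of e "insert e F" R] assms by simp
  note ab = this conn_sym[OF this]
  assume "?Q v"
  then show "(u, v) \<in> conn R (insert e F)"
    by (elim disjE conjE) (use * ab in \<open>meson conn_trans subsetD\<close>)+
qed

text \<open>A path between the ends of \<open>e\<close> that exists only with \<open>f\<close> must
  cross \<open>f\<close>; replacing \<open>f\<close> by \<open>e\<close> goes round the same cycle.
  This is the Steinitz exchange property of the graphic matroid.\<close>

lemma conn_exchange:
  assumes "en e \<notin> conn R F" "en e \<in> conn R (insert f F)"
  shows "en f \<in> conn R (insert e F)"
proof -
  obtain a b c d where ab: "en e = (a, b)" and cd: "en f = (c, d)" by fastforce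
  have "(a, c) \<in> conn R F \<and> (d, b) \<in> conn R F \<or> (a, d) \<in> conn R F \<and> (c, b) \<in> conn R F"
    using assms unfolding ab conn_insert[OF cd] by simp
  then show ?thesis
    unfolding cd conn_insert[OF ab] by (metis conn_commute)
qed

lemma conn_absorb: "en f \<in> conn R F \<Longrightarrow> conn R (insert f F) = conn R F"
  by (intro equalityI conn_least conn_mono subsetI) (auto intro: conn_rel conn_edge)

text \<open>Paths are finite. Measurability of connection events and their approximation in finite
  windows rest on this.\<close>

lemma conn_finite_support:
  assumes "(u, v) \<in> conn R F"
  shows "\<exists>F0\<subseteq>F. finite F0 \<and> (u, v) \<in> conn R F0"
  using assms
proof (induction rule: conn_induct)
  case refl
  then show ?case by (intro exI[of _ "{}"]) auto
next
  case (rel a b)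
  then have "(a, b) \<in> conn R F0" for F0 by (rule conn_rel)
  then show ?case using conn_trans conn_sym by meson
next
  case (edge e a b)
  have *: "(u, x) \<in> conn R (insert e F0)"
    if "(u, y) \<in> conn R F0" "(x, y) = (a, b) \<or> (x, y) = (b, a)" for F0 x y
  proof -
    have "(a, b) \<in> conn R (insert e F0)" using conn_edge[of e "insert e F0" R] edge by simp
    moreover have "(u, y) \<in> conn R (insert e F0)" using that(1) by (rule conn_monoD) auto
    ultimately show ?thesis using that(2) conn_trans conn_sym by blast
  qed
  show ?case
    using *[where x = b and y = a] *[where x = a and y = b] edge(1) by (meson finite_insert insert_subset)
qed

definition indep :: "('v \<times> 'v) set \<Rightarrow> 'e set \<Rightarrow> bool" where
  "indep R T \<longleftrightarrow> (\<forall>e\<in>T. en e \<notin> conn R (T - {e}))"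

text \<open>The bases of the graphic matroid after identification along \<open>R\<close>: spanning
  trees if the resulting graph is connected, maximal forests otherwise. Including the second case
  keeps the notion closed under deletion of bridges and division into components.\<close>

definition basis :: "('v \<times> 'v) set \<Rightarrow> 'e set \<Rightarrow> 'e set \<Rightarrow> bool" where
  "basis R E T \<longleftrightarrow> T \<subseteq> E \<and> indep R T \<and> (\<forall>e\<in>E. en e \<in> conn R T)"

definition bases :: "('v \<times> 'v) set \<Rightarrow> 'e set \<Rightarrow> 'e set set" where
  "bases R E = {T. basis R E T}"

lemma indepD: "indep R T \<Longrightarrow> e \<in> T \<Longrightarrow> en e \<notin> conn R (T - {e})"
  by (auto simp: indep_def)

lemma bases_subset: "T \<in> bases R E \<Longrightarrow> T \<subseteq> E"
  by (auto simp: bases_def basis_def)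

lemma finite_bases [simp]: "finite E \<Longrightarrow> finite (bases R E)"
  by (rule finite_subset[of _ "Pow E"]) (auto dest: bases_subset)

lemma basis_spans: "basis R E T \<Longrightarrow> e \<in> E \<Longrightarrow> en e \<in> conn R T"
  unfolding basis_def by blast

lemma basis_indep: "basis R E T \<Longrightarrow> e \<in> T \<Longrightarrow> en e \<notin> conn R (T - {e})"
  unfolding basis_def indep_def by blast

lemma basis_subset: "basis R E T \<Longrightarrow> T \<subseteq> E"
  unfolding basis_def by blast

lemma basis_conn: "basis R E T \<Longrightarrow> conn R T = conn R E"
  unfolding basis_def by (intro equalityI conn_least conn_mono) (auto intro: conn_rel)

section \<open>Exchange and equal cardinality of bases\<close>

lemma basis_in_spanning:
  assumes "finite F" "F \<subseteq> E" "(\<forall>e\<in>E. en e \<in> conn R F)"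
  shows "\<exists>T\<subseteq>F. basis R E T"
  using assms
proof (induction F rule: finite_psubset_induct)
  case (psubset F)
  show ?case
  proof (cases "indep R F")
    case True
    then show ?thesis using psubset.prems by (auto simp: basis_def)
  next
    case False
    then obtain e where e: "e \<in> F" "en e \<in> conn R (F - {e})" by (auto simp: indep_def)
    then have "conn R (F - {e}) = conn R F"
      using conn_absorb[of e R "F - {e}"] by (simp add: insert_absorb)
    then show ?thesis using psubset.IH[of "F - {e}"] psubset.prems e(1) by blast
  qed
qed

lemma bases_nonempty: "finite E \<Longrightarrow> bases R E \<noteq> {}"
  using basis_in_spanning[of E E R] conn_edge by (auto simp: bases_def)

text \<open>Removing \<open>f\<close> cuts one tree of \<open>T\<close> in two, and \<open>e\<close>
  joins the two pieces again.\<close>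

lemma basis_swap:
  assumes "basis R E T" "f \<in> T" "e \<in> E" "en e \<notin> conn R (T - {f})"
  shows "basis R E (insert e (T - {f}))" "e \<notin> T - {f}"
proof -
  let ?T' = "insert e (T - {f})"
  show e: "e \<notin> T - {f}" using assms(4) conn_edge[of e "T - {f}" R] by blast
  have insf: "insert f (T - {f}) = T" using assms(2) by auto
  have "en e \<in> conn R T" using assms(1,3) by (rule basis_spans)
  then have "en f \<in> conn R ?T'"
    using conn_exchange[OF assms(4), of f] insf by simp
  then have "conn R T \<subseteq> conn R ?T'"
    by (intro conn_least) (auto intro: conn_rel conn_edge)
  moreover have "indep R ?T'"
    unfolding indep_def
  proof
    fix g assume g: "g \<in> ?T'"
    show "en g \<notin> conn R (?T' - {g})"
    proof (cases "g = e")
      case True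
      then have "?T' - {g} = T - {f}" using e by blast
      then show ?thesis using assms(4) True by simp
    next
      case False
      then have gT: "g \<in> T" "g \<noteq> f" using g by auto
      let ?G = "T - {f} - {g}"
      have "en g \<notin> conn R (T - {g})" using assms(1) gT(1) by (rule basis_indep)
      then have 1: "en g \<notin> conn R ?G" using conn_mono[of R R ?G "T - {g}"] by blast
      show ?thesis
      proof
        \<comment> \<open>If \<open>g\<close> became redundant, its cycle would pass through
          \<open>e\<close>; exchange would then put \<open>e\<close> into the span of
          \<open>T - {f}\<close>.\<close>
        assume "en g \<in> conn R (?T' - {g})"
        also have "?T' - {g} = insert e ?G" using False by auto
        finally have "en e \<in> conn R (insert g ?G)" using conn_exchange[OF 1] by simp
        also have "insert g ?G = T - {f}" using gT by auto
        finally show False using assms(4) by simp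
      qed
    qed
  qed
  ultimately show "basis R E ?T'" using assms(1,3) unfolding basis_def by blast
qed

lemma basis_subset_eq:
  assumes "basis R E T" "basis R E T'" "T \<subseteq> T'"
  shows "T = T'"
proof (rule ccontr)
  assume "T \<noteq> T'"
  then obtain e where e: "e \<in> T'" "e \<notin> T" using assms(3) by blast
  then have "en e \<in> conn R T" using assms basis_subset basis_spans by (metis subsetD)
  then have "en e \<in> conn R (T' - {e})"
    using conn_mono[of R R T "T' - {e}"] e assms(3) by blast
  then show False using basis_indep[OF assms(2) e(1)] by simp
qed

text \<open>Elements of \<open>T1\<close> outside \<open>T2\<close> are traded one by one for
  elements of \<open>T2\<close>. The common size serves twice: as the constant rank in the
  domination argument, and to recognise a resampled set as a basis.\<close>

lemma basis_card:
  assumes "finite E" "basis R E T1" "basis R E T2"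
  shows "card T1 = card T2"
  using assms(2)
proof (induction "card (T1 - T2)" arbitrary: T1)
  case 0
  have "finite T1" using basis_subset[OF 0(2)] assms(1) by (rule finite_subset)
  then have "T1 \<subseteq> T2" using 0 by simp
  then show ?case using basis_subset_eq 0 assms by blast
next
  case (Suc n)
  have fin: "finite T1" using basis_subset[OF Suc.prems] assms(1) by (rule finite_subset)
  obtain e where e: "e \<in> T1" "e \<notin> T2" using Suc(2) by (metis DiffE card_gt_0_iff ex_in_conv zero_less_Suc)
  have "en e \<notin> conn R (T1 - {e})" using Suc.prems e(1) by (rule basis_indep)
  moreover have "en e \<in> conn R T2"
    using basis_spans[OF assms(3)] basis_subset[OF Suc.prems] e(1) by blast
  moreover have "R \<subseteq> conn R (T1 - {e})" by (auto intro: conn_rel)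
  ultimately have "\<not> (\<forall>f\<in>T2. en f \<in> conn R (T1 - {e}))"
    using conn_least[of R R "T1 - {e}" T2] by blast
  then obtain f where f: "f \<in> T2" "en f \<notin> conn R (T1 - {e})" by auto
  have fE: "f \<in> E" using f basis_subset[OF assms(3)] by blast
  note sw = basis_swap[OF Suc.prems e(1) fE f(2)]
  have "insert f (T1 - {e}) - T2 = (T1 - T2) - {e}" using f by auto
  then have "card (insert f (T1 - {e}) - T2) = n" using Suc(2) e fin by simp
  then have "card (insert f (T1 - {e})) = card T2" using Suc.hyps(1) sw(1) by blast
  then show ?case using sw(2) fin e(1) by (metis card.remove card_insert_disjoint finite_Diff)
qed

lemma spanning_card_basis:
  assumes "finite E" "basis R E T" "F \<subseteq> E" "(\<forall>e\<in>E. en e \<in> conn R F)" "card F = card T"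
  shows "basis R E F"
proof -
  have fin: "finite F" using assms finite_subset by blast
  obtain T' where T': "T' \<subseteq> F" "basis R E T'" using basis_in_spanning[OF fin assms(3,4)] by blast
  have "card T' = card F" using basis_card assms T' by metis
  then show ?thesis using T' fin card_subset_eq by metis
qed

section \<open>Deletion and contraction of an edge\<close>

lemma bases_without:
  assumes "f \<in> E" "en f \<in> conn R (E - {f})"
  shows "{T\<in>bases R E. f \<notin> T} = bases R (E - {f})"
proof (intro equalityI subsetI)
  fix T assume "T \<in> {T\<in>bases R E. f \<notin> T}"
  then show "T \<in> bases R (E - {f})" by (auto simp: bases_def basis_def)
next
  fix T assume "T \<in> bases R (E - {f})"
  then have T: "basis R (E - {f}) T" by (simp add: bases_def)
  then have "en f \<in> conn R T" using basis_conn assms(2) by metis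
  then show "T \<in> {T\<in>bases R E. f \<notin> T}" using T by (auto simp: bases_def basis_def)
qed

lemma bases_bridge:
  assumes "en f \<notin> conn R (E - {f})" "f \<in> E" "T \<in> bases R E"
  shows "f \<in> T"
proof (rule ccontr)
  assume "f \<notin> T"
  then have "T \<subseteq> E - {f}" using assms bases_subset by blast
  then show False using assms conn_mono[of R R T "E - {f}"] by (auto simp: bases_def basis_def)
qed

lemma bases_loop: "en f \<in> conn R {} \<Longrightarrow> T \<in> bases R E \<Longrightarrow> f \<notin> T"
  using conn_mono[of R R "{}" "T - {f}"] by (auto simp: bases_def basis_def indep_def)

text \<open>Contraction: once \<open>f\<close> is chosen, the rest is a basis with the ends of
  \<open>f\<close> identified. A loop \<open>f\<close> lies in no basis and is excluded.\<close>

lemma bases_with: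
  assumes "f \<in> E" "en f \<notin> conn R {}"
  shows "{T\<in>bases R E. f \<in> T} = insert f ` bases (insert (en f) R) (E - {f})"
proof (intro equalityI subsetI)
  fix T assume "T \<in> {T\<in>bases R E. f \<in> T}"
  then have T: "basis R E T" "f \<in> T" by (auto simp: bases_def)
  have ins: "insert f (T - {f}) = T" using T by auto
  have "basis (insert (en f) R) (E - {f}) (T - {f})"
    unfolding basis_def indep_def conn_contract_edge
  proof (intro conjI ballI)
    fix e assume e: "e \<in> T - {f}"
    have "insert f (T - {f} - {e}) = T - {e}" using e T by auto
    then show "en e \<notin> conn R (insert f (T - {f} - {e}))"
      using T e by (auto simp: basis_def indep_def)
  qed (use T ins in \<open>auto simp: basis_def\<close>)
  then show "T \<in> insert f ` bases (insert (en f) R) (E - {f})"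
    using ins by (auto simp: bases_def intro!: image_eqI[of _ _ "T - {f}"])
next
  fix T assume "T \<in> insert f ` bases (insert (en f) R) (E - {f})"
  then obtain S where S: "basis (insert (en f) R) (E - {f}) S" "T = insert f S"
    by (auto simp: bases_def)
  have fS: "f \<notin> S" using S by (auto simp: basis_def)
  have ind: "en e \<notin> conn R (insert f (S - {e}))" if "e \<in> S" for e
    using S(1) that unfolding basis_def indep_def conn_contract_edge by blast
  \<comment> \<open>This prepares that \<open>S\<close> does not span \<open>f\<close>. Add edges of
    \<open>S\<close> one at a time: the first \<open>g\<close> that joins the ends of
    \<open>f\<close> would, by exchange, be spanned by \<open>f\<close> and other edges of
    \<open>S\<close>, against independence after contraction.\<close>
  have "finite F0 \<Longrightarrow> F0 \<subseteq> S \<Longrightarrow> en f \<notin> conn R F0" for F0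
  proof (induction F0 rule: finite_induct)
    case empty
    then show ?case using assms by simp
  next
    case (insert g F)
    then have nf: "en f \<notin> conn R F" by simp
    have "conn R (insert f F) \<subseteq> conn R (insert f (S - {g}))"
      using insert by (intro conn_mono) auto
    then show ?case using conn_exchange[OF nf] ind[of g] insert by blast
  qed
  then have "en f \<notin> conn R S" using conn_finite_support by (metis surj_pair)
  moreover have "insert f S - {e} = insert f (S - {e})" if "e \<in> S" for e using that fS by auto
  ultimately have "indep R T" unfolding indep_def S(2) using ind fS by auto
  moreover have "(\<forall>e\<in>E. en e \<in> conn R T)"
  proof -
    have "(\<forall>e\<in>E - {f}. en e \<in> conn R T)"
      using S unfolding basis_def conn_contract_edge by blast
    then show ?thesis using conn_edge[of f T R] S(2) by auto
  qed
  ultimately have "basis R E T" using S assms by (auto simp: basis_def)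
  then show "T \<in> {T\<in>bases R E. f \<in> T}" using S by (auto simp: bases_def)
qed

definition Ex :: "('v \<times> 'v) set \<Rightarrow> 'e set \<Rightarrow> ('e set \<Rightarrow> real) \<Rightarrow> real" where
  "Ex R E \<phi> = (\<Sum>T\<in>bases R E. \<phi> T) / card (bases R E)"

section \<open>Transfer currents and stochastic domination\<close>

lemma card_bases_pos: "finite E \<Longrightarrow> card (bases R E) > 0"
  using bases_nonempty by (simp add: card_gt_0_iff)

lemma Ex_add: "Ex R E (\<lambda>T. \<phi> T + \<psi> T) = Ex R E \<phi> + Ex R E \<psi>"
  by (simp add: Ex_def sum.distrib add_divide_distrib)

lemma Ex_cmult: "Ex R E (\<lambda>T. c * \<phi> T) = c * Ex R E \<phi>"
  by (simp add: Ex_def sum_distrib_left)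

lemma Ex_multc: "Ex R E (\<lambda>T. \<phi> T * c) = Ex R E \<phi> * c"
  using Ex_cmult[of R E c \<phi>] by (simp add: mult.commute)

lemma Ex_sum: "Ex R E (\<lambda>T. \<Sum>i\<in>I. \<phi> i T) = (\<Sum>i\<in>I. Ex R E (\<phi> i))"
  unfolding Ex_def by (subst sum.swap) (simp add: sum_divide_distrib)

lemma Ex_const: "finite E \<Longrightarrow> Ex R E (\<lambda>T. c) = c"
  using card_bases_pos[of E R] by (auto simp: Ex_def)

lemma Ex_cong: "(\<And>T. T \<in> bases R E \<Longrightarrow> \<phi> T = \<psi> T) \<Longrightarrow> Ex R E \<phi> = Ex R E \<psi>"
  by (simp add: Ex_def)

lemma Ex_mono: "(\<And>T. T \<in> bases R E \<Longrightarrow> \<phi> T \<le> \<psi> T) \<Longrightarrow> Ex R E \<phi> \<le> Ex R E \<psi>"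
  unfolding Ex_def by (intro divide_right_mono sum_mono) auto

lemma Ex_bounds:
  assumes "finite E" "\<And>T. T \<in> bases R E \<Longrightarrow> a \<le> \<phi> T \<and> \<phi> T \<le> b"
  shows "a \<le> Ex R E \<phi>" "Ex R E \<phi> \<le> b"
  using Ex_mono[of R E "\<lambda>_. a" \<phi>] Ex_mono[of R E \<phi> "\<lambda>_. b"] assms by (simp_all add: Ex_const)

lemma Ex_indicator_bounds:
  assumes "finite E"
  shows "0 \<le> Ex R E (\<lambda>T. of_bool (A T))" "Ex R E (\<lambda>T. of_bool (A T)) \<le> 1"
  using assms by (rule Ex_bounds[where a = 0 and b = 1]; simp)+

text \<open>Conditioning on whether \<open>f\<close> is in the basis. The formula covers loops and
  bridges too: the conditional mean that has no meaning there carries a weight \<open>p\<close> or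
  \<open>1 - p\<close> equal to zero.\<close>

lemma Ex_split:
  fixes R :: "('v \<times> 'v) set"
  assumes "finite E" "f \<in> E"
  defines "p \<equiv> Ex R E (\<lambda>T. of_bool (f \<in> T))"
  shows "Ex R E \<phi> = p * Ex (insert (en f) R) (E - {f}) (\<lambda>T. \<phi> (insert f T))
    + (1 - p) * Ex R (E - {f}) \<phi>"
    and "en f \<in> conn R {} \<Longrightarrow> p = 0"
    and "en f \<in> conn R {} \<Longrightarrow> Ex R E \<phi> = Ex R (E - {f}) \<phi>"
proof -
  let ?B = "bases R E" and ?Bc = "bases (insert (en f) R) (E - {f})" and ?Bd = "bases R (E - {f})"
  have fin: "finite ?B" using assms by simp
  let ?W = "{T\<in>?B. f \<in> T}" and ?O = "{T\<in>?B. f \<notin> T}"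
  have un: "?B = ?W \<union> ?O" by auto
  have sum_split: "sum g ?B = sum g ?W + sum g ?O" for g :: "'e set \<Rightarrow> real"
    by (subst un, subst sum.union_disjoint) (use fin in auto)
  have p: "p = card ?W / card ?B"
    unfolding p_def Ex_def sum_split by simp
  have cB: "card ?B = card ?W + card ?O"
    by (subst un, subst card_Un_disjoint) (use fin in auto)
  have pos: "card ?B > 0" "card ?Bc > 0" "card ?Bd > 0"
    using assms by (auto intro!: card_bases_pos)
  have inj: "inj_on (insert f) ?Bc"
    by (rule inj_onI) (use bases_subset in blast)
  have loop: "?W = {}" if "en f \<in> conn R {}" using bases_loop[OF that] by auto
  have mono0: "conn R {} \<subseteq> conn R (E - {f})" by (rule conn_mono) auto
  show p0: "p = 0" if "en f \<in> conn R {}" using p loop[OF that] by simp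
  have "card ?W / card ?B + card ?O / card ?B = 1"
    unfolding add_divide_distrib[symmetric] of_nat_add[symmetric] cB[symmetric] using pos by simp
  then have q: "1 - p = card ?O / card ?B" using p by simp
  have W: "sum \<phi> ?W / card ?B = p * Ex (insert (en f) R) (E - {f}) (\<lambda>T. \<phi> (insert f T))"
  proof (cases "en f \<in> conn R {}")
    case True
    then have "?W = {}" "p = 0" using loop p0 by blast+
    then show ?thesis by (metis (no_types, lifting) div_0 mult_zero_left sum.empty)
  next
    case False
    have W: "?W = insert f ` ?Bc" using bases_with[OF assms(2) False] .
    have "sum \<phi> ?W = (\<Sum>T\<in>?Bc. \<phi> (insert f T))"
      unfolding W by (simp add: sum.reindex[OF inj])
    moreover have "card ?W = card ?Bc" unfolding W by (rule card_image[OF inj])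
    ultimately show ?thesis using pos unfolding p Ex_def by simp
  qed
  have O: "sum \<phi> ?O / card ?B = (1 - p) * Ex R (E - {f}) \<phi>"
  proof (cases "en f \<in> conn R (E - {f})")
    case True
    then have "?O = ?Bd" by (rule bases_without[OF assms(2)])
    then show ?thesis using pos unfolding q Ex_def by simp
  next
    case False
    then have "?O = {}" using bases_bridge[OF _ assms(2)] by blast
    then have "sum \<phi> ?O = 0" "card ?O = 0" by (simp_all only: sum.empty card.empty)
    then show ?thesis unfolding q by simp
  qed
  have "Ex R E \<phi> = sum \<phi> ?W / card ?B + sum \<phi> ?O / card ?B"
    unfolding Ex_def sum_split by (rule add_divide_distrib)
  then show split: "Ex R E \<phi> = p * Ex (insert (en f) R) (E - {f}) (\<lambda>T. \<phi> (insert f T))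
    + (1 - p) * Ex R (E - {f}) \<phi>" using W O by simp
  show "Ex R E \<phi> = Ex R (E - {f}) \<phi>" if "en f \<in> conn R {}" using split p0[OF that] by simp
qed

text \<open>A potential on the vertices: the indicator of the piece of \<open>T - {f}\<close> that
  contains the head of \<open>f\<close>. Along \<open>T\<close> it changes only across
  \<open>f\<close>.\<close>

definition side :: "('v \<times> 'v) set \<Rightarrow> 'e set \<Rightarrow> 'e \<Rightarrow> 'v \<Rightarrow> real" where
  "side R T f v = of_bool ((snd (en f), v) \<in> conn R (T - {f}))"

text \<open>For f in the tree T, the sign with which the path in T between the ends of e uses f.\<close>

definition crossing :: "('v \<times> 'v) set \<Rightarrow> 'e set \<Rightarrow> 'e \<Rightarrow> 'e \<Rightarrow> real" where
  "crossing R T e f = (if f \<in> T then side R T f (snd (en e)) - side R T f (fst (en e)) else 0)"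

lemma side_eq: "(a, b) \<in> conn R (T - {f}) \<Longrightarrow> side R T f a = side R T f b"
proof -
  assume "(a, b) \<in> conn R (T - {f})"
  then have "(c, a) \<in> conn R (T - {f}) \<longleftrightarrow> (c, b) \<in> conn R (T - {f})" for c
    by (meson conn_trans conn_sym)
  then show ?thesis by (simp add: side_def)
qed

lemma crossing_self:
  assumes "basis R E T" "f \<in> T"
  shows "crossing R T f f = 1"
  using basis_indep[OF assms] assms(2) conn_sym[of "snd (en f)" "fst (en f)"]
  by (auto simp: crossing_def side_def)

lemma crossing_other:
  assumes "e \<in> T" "e \<noteq> f"
  shows "crossing R T e f = 0"
  using side_eq[of "fst (en e)" "snd (en e)" R T f] conn_edge[of e "T - {f}" R] assms
  by (auto simp: crossing_def)

text \<open>The increments of \<open>h\<close> are summed along the path in \<open>T\<close> from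
  \<open>u\<close> to \<open>v\<close>; differences of \<open>side\<close> record which edges this
  path crosses and in which direction. One more step over \<open>e\<close> changes the coefficient
  of \<open>e\<close> alone.\<close>

lemma potential_decomposition:
  assumes "basis R E T" "finite E" "\<And>a b. (a, b) \<in> R \<Longrightarrow> h a = h b" "(u, v) \<in> conn R T"
  shows "h v - h u =
    (\<Sum>g\<in>T. (side R T g v - side R T g u) * (h (snd (en g)) - h (fst (en g)) :: real))"
  using assms(4)
proof (induction rule: conn_induct)
  case (rel a b)
  then have "h a = h b" "side R T g a = side R T g b" for g
    using assms(3) conn_rel by (blast intro: side_eq)+
  then show ?case by simp
next
  case (edge e a b)
  have fin: "finite T" using assms(1,2) basis_subset finite_subset by metis
  let ?d = "\<lambda>g. h (snd (en g)) - h (fst (en g))"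
  have "side R T g b = side R T g a + of_bool (g = e)" if "g \<in> T" for g
    using crossing_other[OF edge(1), of g R] crossing_self[OF assms(1) edge(1)] that edge
    by (cases "g = e") (auto simp: crossing_def)
  then have "(\<Sum>g\<in>T. (side R T g b - side R T g u) * ?d g)
    = (\<Sum>g\<in>T. (side R T g a - side R T g u) * ?d g + (if g = e then ?d e else 0))"
    by (intro sum.cong) (auto simp: algebra_simps)
  also have "\<dots> = (\<Sum>g\<in>T. (side R T g a - side R T g u) * ?d g) + (h b - h a)"
    using fin edge by (simp add: sum.distrib sum.delta)
  finally show ?case by auto
qed simp

lemma crossing_decomposition:
  assumes "basis R E T" "finite E" "\<And>a b. (a, b) \<in> R \<Longrightarrow> h a = h b" "e \<in> E"
  shows "(\<Sum>g\<in>E. crossing R T e g * (h (snd (en g)) - h (fst (en g)) :: real))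
    = h (snd (en e)) - h (fst (en e))"
proof -
  have "(fst (en e), snd (en e)) \<in> conn R T" using basis_spans[OF assms(1,4)] by simp
  from potential_decomposition[of R E T h, OF assms(1,2) _ this] assms(3)
  have "h (snd (en e)) - h (fst (en e)) =
    (\<Sum>g\<in>T. crossing R T e g * (h (snd (en g)) - h (fst (en g))))"
    by (simp add: crossing_def)
  also have "\<dots> = (\<Sum>g\<in>E. crossing R T e g * (h (snd (en g)) - h (fst (en g))))"
    using assms(2) basis_subset[OF assms(1)]
    by (intro sum.mono_neutral_left) (auto simp: crossing_def)
  finally show ?thesis by simp
qed

text \<open>Deleting \<open>e\<close> from the new basis leaves the same two pieces as deleting
  \<open>f\<close> from the old one. The sign records whether \<open>e\<close> and \<open>f\<close>
  cross between the pieces in the same direction, which is symmetric in the two edges.\<close>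

lemma crossing_swap:
  assumes "basis R E T" "e \<in> E" "crossing R T e f \<noteq> 0"
  shows "basis R E (insert e (T - {f}))" "e \<notin> T - {f}" "f \<in> T"
    "crossing R (insert e (T - {f})) f e = crossing R T e f"
proof -
  obtain a b c d where ab: "en e = (a, b)" and cd: "en f = (c, d)" by fastforce
  show fT: "f \<in> T" using assms(3) by (auto simp: crossing_def split: if_splits)
  have ne: "en e \<notin> conn R (T - {f})"
    using assms(3) side_eq[of a b R T f] ab by (auto simp: crossing_def split: if_splits)
  show sw: "basis R E (insert e (T - {f}))" "e \<notin> T - {f}"
    using basis_swap[OF assms(1) fT assms(2) ne] by auto
  have del: "insert e (T - {f}) - {e} = T - {f}" using sw(2) by auto
  let ?C = "conn R (T - {f})"
  have "en e \<in> conn R (insert f (T - {f}))"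
    using basis_spans[OF assms(1,2)] fT by (simp add: insert_absorb)
  then have "(a, c) \<in> ?C \<and> (d, b) \<in> ?C \<or> (a, d) \<in> ?C \<and> (c, b) \<in> ?C"
    using ne unfolding ab conn_insert[OF cd] by blast
  moreover have "(c, d) \<notin> ?C" using basis_indep[OF assms(1) fT] cd by simp
  ultimately show "crossing R (insert e (T - {f})) f e = crossing R T e f"
    using fT ne ab cd unfolding crossing_def side_def del
    by (auto simp: conn_commute) (meson conn_trans conn_sym)+
qed

text \<open>Reciprocity: \<open>crossing_swap\<close> matches, sign included, the bases in which the
  path for \<open>e\<close> uses \<open>f\<close> with those in which the path for \<open>f\<close>
  uses \<open>e\<close>.\<close>

lemma sum_crossing_sym:
  assumes "e \<in> E" "f \<in> E"
  shows "(\<Sum>T\<in>bases R E. crossing R T e f) = (\<Sum>T\<in>bases R E. crossing R T f e)"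
proof (cases "finite (bases R E)")
  case True
  let ?S = "\<lambda>e f. {T\<in>bases R E. crossing R T e f \<noteq> 0}"
  have restrict: "(\<Sum>T\<in>bases R E. crossing R T e f) = (\<Sum>T\<in>?S e f. crossing R T e f)" for e f
    using True by (intro sum.mono_neutral_right) auto
  have *: "insert e (T - {f}) \<in> ?S f e \<and> insert f (insert e (T - {f}) - {e}) = T
    \<and> crossing R (insert e (T - {f})) f e = crossing R T e f"
    if "T \<in> ?S e f" "e \<in> E" for T e f
    using that crossing_swap[of R E T e f] unfolding bases_def by auto
  have "(\<Sum>T\<in>?S e f. crossing R T e f) = (\<Sum>T\<in>?S f e. crossing R T f e)"
    using *[OF _ assms(1)] *[OF _ assms(2)]
    by (intro sum.reindex_bij_witness[where i = "\<lambda>T. insert f (T - {e})"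
          and j = "\<lambda>T. insert e (T - {f})"]) blast+
  then show ?thesis using restrict by metis
qed simp

text \<open>The transfer current matrix: by Kirchhoff, the current through \<open>f\<close> when a
  unit current is sent between the ends of \<open>e\<close>. Averaging over trees yields its
  symmetry and composition law by combinatorics alone.\<close>

definition transfer :: "('v \<times> 'v) set \<Rightarrow> 'e set \<Rightarrow> 'e \<Rightarrow> 'e \<Rightarrow> real" where
  "transfer R E e f = Ex R E (\<lambda>T. crossing R T e f)"

lemma transfer_sym: "e \<in> E \<Longrightarrow> f \<in> E \<Longrightarrow> transfer R E e f = transfer R E f e"
  unfolding transfer_def Ex_def using sum_crossing_sym[of e E f R] by simp

lemma transfer_diag: "transfer R E e e = Ex R E (\<lambda>T. of_bool (e \<in> T))"
  unfolding transfer_def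
proof (rule Ex_cong)
  fix T assume "T \<in> bases R E"
  then show "crossing R T e e = of_bool (e \<in> T)"
    using crossing_self[of R E T e] by (cases "e \<in> T") (auto simp: bases_def crossing_def)
qed

text \<open>The matrix for \<open>R\<close> acts as the identity on increments of functions that
  respect \<open>R\<close>, and the columns of the matrix for the larger relation \<open>S\<close>
  are such increments. For \<open>S = R\<close> this is idempotence.\<close>

lemma transfer_compose:
  assumes "finite E" "R \<subseteq> S" "e \<in> E"
  shows "(\<Sum>g\<in>E. transfer R E e g * transfer S E g f) = transfer S E e f"
proof -
  have "(\<Sum>g\<in>E. crossing R T e g * crossing S T' g f) = crossing S T' e f"
    if "T \<in> bases R E" "T' \<in> bases S E" for T T'
  proof (cases "f \<in> T'")
    case True
    have h: "side S T' f a = side S T' f b" if "(a, b) \<in> R" for a b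
      using that assms(2) by (intro side_eq conn_rel) auto
    show ?thesis
      using crossing_decomposition[of R E T "side S T' f" e] that(1) assms h True
      by (simp add: crossing_def[of S] bases_def)
  qed (simp add: crossing_def)
  then have "Ex S E (\<lambda>T'. Ex R E (\<lambda>T. \<Sum>g\<in>E. crossing R T e g * crossing S T' g f))
    = Ex S E (\<lambda>T'. Ex R E (\<lambda>T. crossing S T' e f))"
    by (intro Ex_cong) simp
  also have "\<dots> = transfer S E e f"
    using assms(1) by (simp add: Ex_const transfer_def)
  finally show ?thesis
    by (simp add: Ex_sum transfer_def Ex_cmult Ex_multc)
qed

text \<open>Rayleigh monotonicity. By symmetry and idempotence the diagonal entries are the squared
  norms of the two rows, and by composition the inner product of the rows equals the entry for
  \<open>S\<close>; then \<open>2 * a * b\<close> is at most the sum of the squares.\<close>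

lemma transfer_diag_antimono:
  assumes "finite E" "R \<subseteq> S" "e \<in> E"
  shows "transfer S E e e \<le> transfer R E e e"
proof -
  let ?a = "\<lambda>g. transfer R E e g" and ?b = "\<lambda>g. transfer S E e g"
  have sym: "transfer R E g e = ?a g" "transfer S E g e = ?b g" if "g \<in> E" for g
    using transfer_sym that assms(3) by blast+
  have "transfer S E e e = (\<Sum>g\<in>E. ?a g * ?b g)"
    using transfer_compose[OF assms, of e] sym by simp
  moreover have "transfer R E e e = (\<Sum>g\<in>E. ?a g * ?a g)"
    using transfer_compose[OF assms(1) order_refl assms(3), of R e] sym by simp
  moreover have "transfer S E e e = (\<Sum>g\<in>E. ?b g * ?b g)"
    using transfer_compose[OF assms(1) order_refl assms(3), of S e] sym by simp
  moreover have "(\<Sum>g\<in>E. 2 * (?a g * ?b g)) \<le> (\<Sum>g\<in>E. ?a g * ?a g + ?b g * ?b g)"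
  proof (rule sum_mono)
    fix g show "2 * (?a g * ?b g) \<le> ?a g * ?a g + ?b g * ?b g"
      using sum_squares_bound[of "?a g" "?b g"] by (simp add: power2_eq_square)
  qed
  ultimately show ?thesis by (simp add: sum.distrib flip: sum_distrib_left)
qed

section \<open>Domination under identification of vertices and addition of edges\<close>

definition increasing :: "('e set \<Rightarrow> real) \<Rightarrow> bool" where
  "increasing \<phi> \<longleftrightarrow> (\<forall>X Y. X \<subseteq> Y \<longrightarrow> \<phi> X \<le> \<phi> Y)"

lemma Ex_rank:
  assumes "finite E"
  obtains r where "\<And>T. T \<in> bases R E \<Longrightarrow> real (card T) = r"
  using basis_card[OF assms] unfolding bases_def by (metis mem_Collect_eq)

text \<open>Feder and Mihail: some edge f is nonnegatively correlated with \<phi>, because the number of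
  edges of a basis is constant; conditioning on f reduces to smaller graphs.\<close>

theorem Ex_identify_le:
  assumes "finite E" "R \<subseteq> S" "increasing \<phi>"
  shows "Ex S E \<phi> \<le> Ex R E \<phi>"
  using assms
proof (induction "card E" arbitrary: E R S \<phi>)
  case 0
  have "bases Q {} = {{}}" for Q
    using bases_nonempty[of "{}" Q] bases_subset[of _ Q "{}"] by fastforce
  then show ?case using 0 by (simp add: Ex_def)
next
  case (Suc n)
  let ?p = "\<lambda>Q f. Ex Q E (\<lambda>T. of_bool (f \<in> T))"
  obtain r where r: "\<And>T. T \<in> bases S E \<Longrightarrow> real (card T) = r"
    using Ex_rank[OF Suc.prems(1)] by blast
  have cardT: "(\<Sum>f\<in>E. of_bool (f \<in> T)) = r" if "T \<in> bases S E" for T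
    using r[OF that] bases_subset[OF that] Suc.prems(1)
    by (simp add: Int_absorb1 Int_def[symmetric] flip: sum.inter_filter of_bool_def)
  \<comment> \<open>The covariances of \<open>\<phi>\<close> with the indicators of the edges sum to
    its covariance with the constant size \<open>r\<close>, which vanishes. So some edge has a
    nonnegative one.\<close>
  have "(\<Sum>f\<in>E. Ex S E (\<lambda>T. \<phi> T * of_bool (f \<in> T)) - ?p S f * Ex S E \<phi>) = 0"
  proof -
    have "(\<Sum>f\<in>E. Ex S E (\<lambda>T. \<phi> T * of_bool (f \<in> T))) = Ex S E (\<lambda>T. r * \<phi> T)"
      unfolding Ex_sum[symmetric] sum_distrib_left[symmetric] by (intro Ex_cong) (simp add: cardT)
    moreover have "(\<Sum>f\<in>E. ?p S f) = Ex S E (\<lambda>T. r)"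
      unfolding Ex_sum[symmetric] by (intro Ex_cong) (simp add: cardT)
    ultimately show ?thesis
      using Suc.prems(1) by (simp add: sum_subtractf Ex_cmult Ex_const flip: sum_distrib_right)
  qed
  moreover have "E \<noteq> {}" using Suc by auto
  moreover have "(\<Sum>f\<in>E. Ex S E (\<lambda>T. \<phi> T * of_bool (f \<in> T)) - ?p S f * Ex S E \<phi>) < 0"
    if "\<forall>f\<in>E. Ex S E (\<lambda>T. \<phi> T * of_bool (f \<in> T)) - ?p S f * Ex S E \<phi> < 0" "E \<noteq> {}"
    using sum_strict_mono[of E "\<lambda>f. Ex S E (\<lambda>T. \<phi> T * of_bool (f \<in> T)) - ?p S f * Ex S E \<phi>" "\<lambda>_. 0"]
      Suc.prems(1) that by simp
  ultimately obtain f where f: "f \<in> E"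
    "Ex S E (\<lambda>T. \<phi> T * of_bool (f \<in> T)) \<ge> ?p S f * Ex S E \<phi>"
    by fastforce
  define \<psi> where "\<psi> T = \<phi> (insert f T)" for T
  have \<psi>: "increasing \<psi>"
    unfolding increasing_def[of \<psi>] \<psi>_def
    by (intro allI impI Suc.prems(3)[unfolded increasing_def, rule_format]) blast
  have \<psi>_ge: "\<phi> T \<le> \<psi> T" for T
    unfolding \<psi>_def by (rule Suc.prems(3)[unfolded increasing_def, rule_format]) blast
  let ?E = "E - {f}"
  define p where "p = ?p R f"
  define p' where "p' = ?p S f"
  define a where "a = Ex (insert (en f) R) ?E \<psi>"
  define a' where "a' = Ex (insert (en f) S) ?E \<psi>"
  define b where "b = Ex R ?E \<phi>"
  define b' where "b' = Ex S ?E \<phi>"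
  have cE: "n = card ?E" "finite ?E" using Suc f by auto
  have aa: "a' \<le> a" unfolding a_def a'_def
    by (rule Suc.hyps(1)) (use cE Suc.prems \<psi> in auto)
  have bb: "b' \<le> b" unfolding b_def b'_def
    by (rule Suc.hyps(1)) (use cE Suc.prems in auto)
  have pp: "p' \<le> p"
    using transfer_diag_antimono[OF Suc.prems(1,2) f(1)] by (simp add: p_def p'_def transfer_diag)
  have p01: "0 \<le> p'" "p \<le> 1" "0 \<le> p"
    unfolding p_def p'_def using Suc.prems(1) by (rule Ex_indicator_bounds)+
  have R: "Ex R E \<phi> = p * a + (1 - p) * b"
    unfolding p_def a_def b_def \<psi>_def by (rule Ex_split(1)[OF Suc.prems(1) f(1)])
  have S: "Ex S E \<phi> = p' * a' + (1 - p') * b'"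
    unfolding p'_def a'_def b'_def \<psi>_def by (rule Ex_split(1)[OF Suc.prems(1) f(1)])
  have "Ex S E (\<lambda>T. \<phi> T * of_bool (f \<in> T)) = p' * a'"
  proof -
    have "Ex S ?E (\<lambda>T. \<phi> T * of_bool (f \<in> T)) = Ex S ?E (\<lambda>T. 0)"
      by (intro Ex_cong) (use bases_subset in fastforce)
    then have "Ex S ?E (\<lambda>T. \<phi> T * of_bool (f \<in> T)) = 0" using cE(2) by (simp add: Ex_const)
    then show ?thesis
      unfolding p'_def a'_def \<psi>_def by (subst Ex_split(1)[OF Suc.prems(1) f(1)]) simp
  qed
  \<comment> \<open>The product is the covariance of \<open>\<phi>\<close> with the indicator of
    \<open>f\<close>. Unless \<open>p'\<close> is 0 or 1, it orders the two conditional
    means.\<close>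
  then have "p' * (1 - p') * (a' - b') \<ge> 0"
    using f(2) unfolding S p'_def[symmetric] by (simp add: algebra_simps)
  then consider "p' = 0" | "p' = 1" | "a' \<ge> b'" using p01 pp
    by (smt (verit) mult_pos_pos zero_le_mult_iff)
  then show ?case
  proof cases
    case 1
    \<comment> \<open>The covariance says nothing here. Since \<open>p' = 0\<close>, the edge
      \<open>f\<close> must be a loop modulo \<open>S\<close>, as otherwise some basis contains it.
      Contracting a loop changes nothing, and inserting \<open>f\<close> only raises
      \<open>\<phi>\<close>.\<close>
    have "b' \<le> a'"
    proof (cases "en f \<in> conn S {}")
      case True
      have "conn (insert (en f) S) F = conn S F" for F
        unfolding conn_contract_edge using True conn_mono[of S S "{}" F] by (intro conn_absorb) auto
      then have "bases (insert (en f) S) ?E = bases S ?E"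
        by (simp add: bases_def basis_def indep_def)
      then have "a' = Ex S ?E \<psi>" unfolding a'_def Ex_def by simp
      then show ?thesis unfolding b'_def using \<psi>_ge by (simp add: Ex_mono)
    next
      case False
      have "finite (bases S E)" "bases (insert (en f) S) ?E \<noteq> {}" using Suc.prems(1) cE(2) bases_nonempty by auto
      moreover have "{T\<in>bases S E. f \<in> T} = {}"
      proof -
        have "(\<Sum>T\<in>bases S E. of_bool (f \<in> T)) = (0::real)"
          using 1 card_bases_pos[OF Suc.prems(1), of S] unfolding p'_def Ex_def by simp
        then show ?thesis using Suc.prems(1) by (subst (asm) sum_nonneg_eq_0_iff) auto
      qed
      ultimately show ?thesis using bases_with[OF f(1) False] by auto
    qed
    have "Ex S E \<phi> = b'" using S 1 by simp
    also have "\<dots> = p * b' + (1 - p) * b'" by (simp add: algebra_simps)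
    also have "\<dots> \<le> p * a + (1 - p) * b"
      using \<open>b' \<le> a'\<close> aa bb p01 by (intro add_mono mult_left_mono) auto
    finally show ?thesis using R by simp
  next
    case 2
    then have "p = 1" using pp p01 by simp
    then show ?thesis using R S 2 aa by simp
  next
    case 3
    \<comment> \<open>As \<open>b' \<le> a'\<close>, the mean increases with the weight of
      \<open>f\<close>. Replacing \<open>p'\<close> by \<open>p\<close> is Rayleigh monotonicity;
      the conditional means are compared by induction.\<close>
    have "Ex S E \<phi> = b' + p' * (a' - b')" using S by (simp add: algebra_simps)
    also have "\<dots> \<le> b' + p * (a' - b')" using pp 3 by (intro add_left_mono mult_right_mono) auto
    also have "\<dots> = p * a' + (1 - p) * b'" by (simp add: algebra_simps)
    also have "\<dots> \<le> p * a + (1 - p) * b" using aa bb p01 by (intro add_mono mult_left_mono) auto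
    finally show ?thesis using R by simp
  qed
qed

definition local_on :: "'e set \<Rightarrow> ('e set \<Rightarrow> real) \<Rightarrow> bool" where
  "local_on D \<phi> \<longleftrightarrow> (\<forall>X. \<phi> X = \<phi> (X \<inter> D))"

lemma local_onD: "local_on D \<phi> \<Longrightarrow> \<phi> X = \<phi> (X \<inter> D)"
  unfolding local_on_def by blast

text \<open>Given that a new edge is absent, the old law is recovered; given that it is present, its
  ends are identified, which lowers the mean. New edges lie outside \<open>D\<close>, so
  \<open>\<phi>\<close> does not see them.\<close>

lemma Ex_add_edges_le:
  assumes "finite E'" "E \<subseteq> E'" "increasing \<phi>" "local_on D \<phi>" "E' \<inter> D \<subseteq> E"
  shows "Ex R E' \<phi> \<le> Ex R E \<phi>"
proof -
  have "finite F \<Longrightarrow> F \<inter> (E \<union> D) = {} \<Longrightarrow> Ex R (E \<union> F) \<phi> \<le> Ex R E \<phi>" for F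
  proof (induction F rule: finite_induct)
    case (insert f F)
    let ?E = "E \<union> insert f F"
    have fin: "finite ?E" "f \<in> ?E" using insert assms(1,2) finite_subset by auto
    have E: "?E - {f} = E \<union> F" using insert by auto
    let ?p = "Ex R ?E (\<lambda>T. of_bool (f \<in> T))"
    have "\<phi> (insert f T) = \<phi> T" for T
      using local_onD[OF assms(4)] insert.prems by (metis Int_insert_left Int_Un_distrib UnCI disjoint_iff insertI1)
    then have "Ex R ?E \<phi> = ?p * Ex (insert (en f) R) (E \<union> F) \<phi> + (1 - ?p) * Ex R (E \<union> F) \<phi>"
      using Ex_split(1)[OF fin, of R \<phi>] unfolding E by simp
    also have "\<dots> \<le> ?p * Ex R (E \<union> F) \<phi> + (1 - ?p) * Ex R (E \<union> F) \<phi>"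
    proof (intro add_right_mono mult_left_mono)
      show "Ex (insert (en f) R) (E \<union> F) \<phi> \<le> Ex R (E \<union> F) \<phi>"
        using fin assms(3) by (intro Ex_identify_le) auto
      show "0 \<le> ?p" using fin(1) by (rule Ex_indicator_bounds)
    qed
    also have "\<dots> = Ex R (E \<union> F) \<phi>" by (simp add: algebra_simps)
    also have "\<dots> \<le> Ex R E \<phi>" using insert by auto
    finally show ?case .
  qed simp
  from this[of "E' - E"] show ?thesis using assms by (auto simp: Un_absorb1)
qed

section \<open>Limits of laws of random subgraphs\<close>

lemma bases_add_loops:
  assumes "E \<subseteq> E'" "\<And>e. e \<in> E' - E \<Longrightarrow> en e \<in> conn R {}"
  shows "bases R E' = bases R E"
proof (intro equalityI subsetI)
  fix T assume T: "T \<in> bases R E'"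
  have "T \<subseteq> E" using bases_loop[OF assms(2) T] bases_subset[OF T] by blast
  then show "T \<in> bases R E" using T assms(1) by (auto simp: bases_def basis_def)
next
  fix T assume T: "T \<in> bases R E"
  have "en e \<in> conn R T" if "e \<in> E'" for e
    using that T assms(2)[of e] conn_mono[of R R "{}" T]
    by (cases "e \<in> E") (auto simp: bases_def basis_def)
  then show "T \<in> bases R E'" using T assms(1) by (auto simp: bases_def basis_def)
qed

text \<open>In the applications \<open>P\<close> is an equivalence relation, and what lies outside
  \<open>W\<close> is merged separately within each class. A single class gives the usual wired
  graph; the components of a forest give the wired graphs of all components at once.\<close>

definition wired_rel :: "('v \<times> 'v) set \<Rightarrow> 'v set \<Rightarrow> ('v \<times> 'v) set" where
  "wired_rel P W = {(x, y) \<in> P. x \<notin> W \<and> y \<notin> W}"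

definition edges_in :: "('v \<times> 'v) set \<Rightarrow> 'e set \<Rightarrow> 'e set" where
  "edges_in P A = {e\<in>A. en e \<in> P}"

definition touching :: "'v set \<Rightarrow> 'e set \<Rightarrow> 'e set" where
  "touching W A = {e\<in>A. fst (en e) \<in> W \<or> snd (en e) \<in> W}"

definition Ex_wired :: "'e set \<Rightarrow> ('v \<times> 'v) set \<Rightarrow> 'v set \<Rightarrow> ('e set \<Rightarrow> real) \<Rightarrow> real" where
  "Ex_wired A P W = Ex (wired_rel P W) (touching W (edges_in P A))"

lemma touching_mono: "W \<subseteq> W' \<Longrightarrow> A \<subseteq> A' \<Longrightarrow> touching W A \<subseteq> touching W' A'"
  by (auto simp: touching_def)

lemma edges_in_subset: "edges_in P A \<subseteq> A"
  by (auto simp: edges_in_def)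

lemma touching_subset: "touching W A \<subseteq> A"
  by (auto simp: touching_def)

text \<open>Enlarging \<open>W\<close> undoes identifications, which raises means. The additional
  edges have both ends outside \<open>W\<close> and in one class, so for the smaller window they are
  loops, and both laws can be compared on the same edge set.\<close>

lemma Ex_wired_mono:
  assumes "finite (touching W' A)" "W \<subseteq> W'" "increasing \<phi>"
  shows "Ex_wired A P W \<phi> \<le> Ex_wired A P W' \<phi>"
proof -
  let ?E = "touching W (edges_in P A)" and ?E' = "touching W' (edges_in P A)"
  have fin: "finite ?E'"
    by (rule finite_subset[OF touching_mono[OF order_refl edges_in_subset] assms(1)])
  have "bases (wired_rel P W) ?E' = bases (wired_rel P W) ?E"
  proof (rule bases_add_loops)
    show "?E \<subseteq> ?E'" using assms(2) by (rule touching_mono) simp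
    fix e assume "e \<in> ?E' - ?E"
    then have "en e \<in> wired_rel P W"
      by (cases "en e") (auto simp: touching_def edges_in_def wired_rel_def)
    then show "en e \<in> conn (wired_rel P W) {}" by (cases "en e") (auto intro: conn_rel)
  qed
  then have "Ex_wired A P W \<phi> = Ex (wired_rel P W) ?E' \<phi>"
    by (simp add: Ex_wired_def Ex_def)
  also have "\<dots> \<le> Ex_wired A P W' \<phi>"
    unfolding Ex_wired_def using fin assms(2,3)
    by (intro Ex_identify_le) (auto simp: wired_rel_def)
  finally show ?thesis .
qed

lemma increasing_superset: "increasing (\<lambda>X. of_bool (D \<subseteq> X))"
  by (auto simp: increasing_def)

lemma local_on_superset: "local_on D (\<lambda>X. of_bool (D \<subseteq> X))"
  by (auto simp: local_on_def)

lemma local_on_mono: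
  assumes "local_on D \<phi>" "D \<subseteq> D'"
  shows "local_on D' \<phi>"
proof -
  have "\<phi> X = \<phi> (X \<inter> D')" for X
  proof -
    have "\<phi> X = \<phi> (X \<inter> D)" "\<phi> (X \<inter> D') = \<phi> (X \<inter> D' \<inter> D)"
      using assms(1) by (auto simp: local_on_def)
    moreover have "X \<inter> D' \<inter> D = X \<inter> D" using assms(2) by auto
    ultimately show ?thesis by simp
  qed
  then show ?thesis by (simp add: local_on_def)
qed

text \<open>Inclusion-exclusion: the indicators of \<open>D' \<subseteq> X\<close> span the
  functions of \<open>X \<inter> D\<close>. Hence inclusion probabilities control every local
  function.\<close>

lemma local_on_induct [consumes 2, case_names superset lin]:
  assumes "finite D" "local_on D \<phi>"
    and sup: "\<And>D'. D' \<subseteq> D \<Longrightarrow> Q (\<lambda>X. of_bool (D' \<subseteq> X))"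
    and lin: "\<And>c f g. Q f \<Longrightarrow> Q g \<Longrightarrow> Q (\<lambda>X. f X + c * g X)"
  shows "Q \<phi>"
proof -
  \<comment> \<open>\<open>D1\<close> collects the edges already expanded, \<open>D0\<close> those
    on which the remaining factor still depends.\<close>
  have "Q (\<lambda>X. of_bool (D1 \<subseteq> X) * \<psi> X)" if "finite D0" "D0 \<subseteq> D" "local_on D0 \<psi>" "D1 \<subseteq> D" for D0 D1 \<psi>
    using that
  proof (induction D0 arbitrary: \<psi> D1 rule: finite_induct)
    case empty
    have *: "\<psi> X = \<psi> {}" for X using empty.prems(2) unfolding local_on_def by (metis Int_empty_right)
    \<comment> \<open>The closure rule offers only sums f + c g, so the multiple c g is written as g
      + (c - 1) g.\<close>
    have "(\<lambda>X. of_bool (D1 \<subseteq> X) * \<psi> X) =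
      (\<lambda>X. of_bool (D1 \<subseteq> X) + (\<psi> {} - 1) * of_bool (D1 \<subseteq> X))"
      by (rule ext, subst *) simp
    then show ?case using lin[OF sup[OF empty.prems(3)] sup[OF empty.prems(3)]] by simp
  next
    case (insert d D0)
    let ?f0 = "\<lambda>X. \<psi> (X \<inter> D0)" and ?f1 = "\<lambda>X. \<psi> (insert d (X \<inter> D0)) - \<psi> (X \<inter> D0)"
    have "local_on D0 ?f0" "local_on D0 ?f1" by (simp_all add: local_on_def Int_assoc)
    then have "Q (\<lambda>X. of_bool (D1 \<subseteq> X) * ?f0 X)" "Q (\<lambda>X. of_bool (insert d D1 \<subseteq> X) * ?f1 X)"
      using insert.prems by (intro insert.IH; simp)+
    from lin[OF this, of 1]
    have "Q (\<lambda>X. of_bool (D1 \<subseteq> X) * ?f0 X + 1 * (of_bool (insert d D1 \<subseteq> X) * ?f1 X))" .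
    moreover have "of_bool (D1 \<subseteq> X) * ?f0 X + 1 * (of_bool (insert d D1 \<subseteq> X) * ?f1 X)
      = of_bool (D1 \<subseteq> X) * \<psi> X" for X
    proof -
      have "\<psi> X = \<psi> (X \<inter> insert d D0)" using insert.prems(2) by (rule local_onD)
      then show ?thesis by (cases "d \<in> X") (auto simp: Int_insert_right)
    qed
    ultimately show ?case by simp
  qed
  from this[OF assms(1) order_refl assms(2), of "{}"] show ?thesis by simp
qed

end

text \<open>Limits run over all finite subsets instead of a sequence. Monotonicity gives existence
  at once, and since every exhaustion converges to this filter, independence of the exhaustion
  follows.\<close>

lemma finite_subsets_monotone_limit:
  fixes f :: "'a set \<Rightarrow> real"
  assumes mono: "\<And>X Y. finite Y \<Longrightarrow> X \<subseteq> Y \<Longrightarrow> Y \<subseteq> A \<Longrightarrow> f X \<le> f Y"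
    and bound: "\<And>X. finite X \<Longrightarrow> X \<subseteq> A \<Longrightarrow> f X \<le> B"
  obtains l where "(f \<longlongrightarrow> l) (finite_subsets_at_top A)"
proof
  let ?F = "{X. finite X \<and> X \<subseteq> A}"
  have bdd: "bdd_above (f ` ?F)" using bound by (auto intro!: bdd_aboveI2)
  show "(f \<longlongrightarrow> Sup (f ` ?F)) (finite_subsets_at_top A)"
  proof (rule order_tendstoI)
    fix a assume "a < Sup (f ` ?F)"
    then obtain X where X: "finite X" "X \<subseteq> A" "a < f X"
      using less_cSUP_iff[OF _ bdd] by (metis (mono_tags, lifting) empty_iff empty_subsetI finite.emptyI mem_Collect_eq)
    then show "eventually (\<lambda>X. a < f X) (finite_subsets_at_top A)"
      unfolding eventually_finite_subsets_at_top using mono by (meson order_less_le_trans)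
  next
    fix a assume a: "Sup (f ` ?F) < a"
    have "f X < a" if "finite X" "X \<subseteq> A" for X
      using cSUP_upper[OF _ bdd, of X] that a by auto
    then show "eventually (\<lambda>X. f X < a) (finite_subsets_at_top A)"
      by (intro eventually_finite_subsets_at_top_weakI)
  qed
qed

section \<open>Laws on sets of edges\<close>

lemma space_subgraph_space [simp]: "space (subgraph_space G) = Pow (edges G)"
  unfolding subgraph_space_def by (rule space_measure_of) auto

lemma sets_subgraph_space:
  "sets (subgraph_space G) =
    sigma_sets (Pow (edges G)) ((\<lambda>e. {F \<in> Pow (edges G). e \<in> F}) ` edges G)"
  unfolding subgraph_space_def by (rule sets_measure_of) auto

abbreviation superset_event :: "('v, 'e) multigraph \<Rightarrow> 'e set \<Rightarrow> 'e set set" where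
  "superset_event G D \<equiv> {F \<in> Pow (edges G). D \<subseteq> F}"

lemma superset_event_sets:
  assumes "finite D" "D \<subseteq> edges G"
  shows "superset_event G D \<in> sets (subgraph_space G)"
proof -
  have 1: "{F \<in> Pow (edges G). e \<in> F} \<in> sets (subgraph_space G)" if "e \<in> edges G" for e
    using that unfolding sets_subgraph_space by auto
  have "superset_event G D = (\<Inter>e\<in>D. {F \<in> Pow (edges G). e \<in> F}) \<inter> space (subgraph_space G)"
    by auto
  moreover have "(\<Inter>e\<in>D. {F \<in> Pow (edges G). e \<in> F}) \<inter> space (subgraph_space G) \<in> sets (subgraph_space G)"
  proof (cases "D = {}")
    case False
    then have "(\<Inter>e\<in>D. {F \<in> Pow (edges G). e \<in> F}) \<in> sets (subgraph_space G)"
      using 1 assms by (intro sets.finite_INT) auto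
    then show ?thesis by blast
  qed (use sets.top[of "subgraph_space G"] in simp)
  ultimately show ?thesis by (simp only:)
qed

lemma subgraph_space_generator:
  "sets (subgraph_space G) = sigma_sets (Pow (edges G)) (superset_event G ` {D. finite D \<and> D \<subseteq> edges G})"
proof (rule antisym)
  show "sets (subgraph_space G) \<subseteq> sigma_sets (Pow (edges G)) (superset_event G ` {D. finite D \<and> D \<subseteq> edges G})"
    unfolding sets_subgraph_space
  proof (rule sigma_sets_mono, safe)
    fix e assume "e \<in> edges G"
    then have "superset_event G {e} \<in> superset_event G ` {D. finite D \<and> D \<subseteq> edges G}" by blast
    then show "{F \<in> Pow (edges G). e \<in> F} \<in> sigma_sets (Pow (edges G)) (superset_event G ` {D. finite D \<and> D \<subseteq> edges G})"
      by (simp add: sigma_sets.Basic)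
  qed
  show "sigma_sets (Pow (edges G)) (superset_event G ` {D. finite D \<and> D \<subseteq> edges G}) \<subseteq> sets (subgraph_space G)"
    using sets.sigma_sets_subset[of "superset_event G ` {D. finite D \<and> D \<subseteq> edges G}" "subgraph_space G"]
      superset_event_sets[of _ G] by auto
qed

lemma superset_events_Int_stable:
  "Int_stable (superset_event G ` {D. finite D \<and> D \<subseteq> edges G})"
proof (rule Int_stableI_image, safe)
  fix D D' assume "finite D" "D \<subseteq> edges G" "finite D'" "D' \<subseteq> edges G"
  then show "\<exists>k\<in>{D. finite D \<and> D \<subseteq> edges G}. superset_event G D \<inter> superset_event G D' = superset_event G k"
    by (intro bexI[of _ "D \<union> D'"]) auto
qed

text \<open>Events of containing a given finite set are closed under intersection and generate the
  sigma-algebra.\<close>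

lemma measure_eqI_superset_events:
  assumes M: "prob_space M" "sets M = sets (subgraph_space G)"
    and N: "prob_space N" "sets N = sets (subgraph_space G)"
    and eq: "\<And>D. finite D \<Longrightarrow> D \<subseteq> edges G \<Longrightarrow>
      measure M (superset_event G D) = measure N (superset_event G D)"
  shows "M = N"
proof -
  interpret M: prob_space M by fact
  interpret N: prob_space N by fact
  let ?A = "superset_event G ` {D. finite D \<and> D \<subseteq> edges G}"
  have top: "Pow (edges G) = superset_event G {}" by auto
  show ?thesis
  proof (rule measure_eqI_generator_eq[where \<Omega> = "Pow (edges G)" and E = ?A and A = "\<lambda>_. Pow (edges G)"])
    show "Int_stable ?A" by (rule superset_events_Int_stable)
    show "emeasure M X = emeasure N X" if "X \<in> ?A" for X
      using that eq by (auto simp: M.emeasure_eq_measure N.emeasure_eq_measure)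
    show "sets M = sigma_sets (Pow (edges G)) ?A" "sets N = sigma_sets (Pow (edges G)) ?A"
      using M(2) N(2) subgraph_space_generator by auto
    show "range (\<lambda>_. Pow (edges G)) \<subseteq> ?A" using top by blast
  qed auto
qed

text \<open>Kolmogorov extension of the limiting finite-dimensional laws. Sets of edges are coded as
  0/1 functions with real values, because the extension takes place in a product of Polish
  spaces.\<close>

lemma limit_measure_exists:
  fixes p :: "'i \<Rightarrow> 'e set pmf" and G :: "('v, 'e) multigraph"
  assumes "F \<noteq> bot"
    and lim: "\<And>D A. finite D \<Longrightarrow> D \<subseteq> edges G \<Longrightarrow> A \<subseteq> D \<Longrightarrow>
      \<exists>l. ((\<lambda>i. measure_pmf.prob (p i) {T. T \<inter> D = A}) \<longlongrightarrow> l) F"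
  obtains M where "prob_space M" "sets M = sets (subgraph_space G)"
    "\<And>D A. finite D \<Longrightarrow> D \<subseteq> edges G \<Longrightarrow> A \<subseteq> D \<Longrightarrow>
      ((\<lambda>i. measure_pmf.prob (p i) {T. T \<inter> D = A}) \<longlongrightarrow> measure M {T\<in>space M. T \<inter> D = A}) F"
proof -
  \<comment> \<open>The value 0 for \<open>A\<close> not contained in \<open>D\<close> makes
    \<open>l D\<close> a mass function on all sets of edges.\<close>
  define l where "l D A = (if A \<subseteq> D then Lim F (\<lambda>i. measure_pmf.prob (p i) {T. T \<inter> D = A}) else 0)" for D A
  have l: "((\<lambda>i. measure_pmf.prob (p i) {T. T \<inter> D = A}) \<longlongrightarrow> l D A) F"
    if D: "finite D" "D \<subseteq> edges G" "A \<subseteq> D" for D A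
  proof -
    obtain c where c: "((\<lambda>i. measure_pmf.prob (p i) {T. T \<inter> D = A}) \<longlongrightarrow> c) F"
      using lim[OF D] by blast
    then have "Lim F (\<lambda>i. measure_pmf.prob (p i) {T. T \<inter> D = A}) = c"
      by (rule tendsto_Lim[OF assms(1)])
    then show ?thesis using c D unfolding l_def by simp
  qed
  have l_nonneg: "l D A \<ge> 0" if "finite D" "D \<subseteq> edges G" for D A
  proof (cases "A \<subseteq> D")
    case True
    then show ?thesis using l[OF that True] assms(1)
      by (rule_tac tendsto_lowerbound[OF l[OF that True]]) auto
  qed (simp add: l_def)
  have split: "(\<Sum>A | A \<subseteq> H \<and> A \<inter> D = B. measure_pmf.prob q {T. T \<inter> H = A}) = measure_pmf.prob q {T. T \<inter> D = B}"
    if "finite H" "D \<subseteq> H" "B \<subseteq> D" for D H B and q :: "'e set pmf"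
  proof -
    have "measure_pmf.prob q (\<Union>A\<in>{A. A \<subseteq> H \<and> A \<inter> D = B}. {T. T \<inter> H = A})
      = (\<Sum>A\<in>{A. A \<subseteq> H \<and> A \<inter> D = B}. measure_pmf.prob q {T. T \<inter> H = A})"
      using that by (intro measure_pmf.finite_measure_finite_Union) (auto simp: disjoint_family_on_def)
    moreover have "(\<Union>A\<in>{A. A \<subseteq> H \<and> A \<inter> D = B}. {T. T \<inter> H = A}) = {T. T \<inter> D = B}"
      using that by auto
    ultimately show ?thesis by simp
  qed
  \<comment> \<open>Consistency of marginals holds for each \<open>p i\<close> and involves finite
    sums only, so it survives the limit.\<close>
  have l_marg: "(\<Sum>A | A \<subseteq> H \<and> A \<inter> D = B. l H A) = l D B"
    if "finite H" "H \<subseteq> edges G" "D \<subseteq> H" "B \<subseteq> D" for D H B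
  proof (rule tendsto_unique[OF assms(1)])
    have "((\<lambda>i. \<Sum>A | A \<subseteq> H \<and> A \<inter> D = B. measure_pmf.prob (p i) {T. T \<inter> H = A}) \<longlongrightarrow>
      (\<Sum>A | A \<subseteq> H \<and> A \<inter> D = B. l H A)) F"
      by (rule tendsto_sum) (use l that in auto)
    then show "((\<lambda>i. measure_pmf.prob (p i) {T. T \<inter> D = B}) \<longlongrightarrow> (\<Sum>A | A \<subseteq> H \<and> A \<inter> D = B. l H A)) F"
      using split[OF that(1,3,4)] by simp
    show "((\<lambda>i. measure_pmf.prob (p i) {T. T \<inter> D = B}) \<longlongrightarrow> l D B) F"
      using that finite_subset by (intro l) auto
  qed
  define q where "q D = embed_pmf (l D)" for D
  have pmf_q: "pmf (q D) A = l D A" if "finite D" "D \<subseteq> edges G" for D A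
    unfolding q_def
  proof (rule pmf_embed_pmf)
    show "0 \<le> l D x" for x using l_nonneg[OF that] .
    have "(\<integral>\<^sup>+ x. ennreal (l D x) \<partial>count_space UNIV) = (\<integral>\<^sup>+ x. ennreal (l D x) \<partial>count_space (Pow D))"
      by (rule nn_integral_count_space_eq) (auto simp: l_def)
    also have "\<dots> = ennreal (\<Sum>x\<in>Pow D. l D x)"
      using that l_nonneg[OF that] by (subst nn_integral_count_space_finite) (auto simp: sum_ennreal)
    also have "(\<Sum>x\<in>Pow D. l D x) = l {} {}"
      using l_marg[of D "{}" "{}"] that by (simp add: Pow_def)
    also have "l {} {} = 1"
    proof -
      have "((\<lambda>i. 1::real) \<longlongrightarrow> l {} {}) F" using l[of "{}" "{}"] by simp
      then show ?thesis using tendsto_unique[OF assms(1) _ tendsto_const] by blast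
    qed
    finally show "(\<integral>\<^sup>+ x. ennreal (l D x) \<partial>count_space UNIV) = 1" by simp
  qed
  have set_q: "set_pmf (q D) \<subseteq> Pow D" if "finite D" "D \<subseteq> edges G" for D
    using pmf_q[OF that] by (auto simp: set_pmf_eq l_def split: if_splits)
  have q_marg: "map_pmf (\<lambda>A. A \<inter> D) (q H) = q D" if "finite H" "H \<subseteq> edges G" "D \<subseteq> H" for D H
  proof (rule pmf_eqI)
    fix B
    have D: "finite D" "D \<subseteq> edges G" using that finite_subset by auto
    show "pmf (map_pmf (\<lambda>A. A \<inter> D) (q H)) B = pmf (q D) B"
    proof (cases "B \<subseteq> D")
      case True
      have "pmf (map_pmf (\<lambda>A. A \<inter> D) (q H)) B = measure_pmf.prob (q H) ((\<lambda>A. A \<inter> D) -` {B})"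
        by (simp add: pmf_map)
      also have "\<dots> = measure_pmf.prob (q H) {A. A \<subseteq> H \<and> A \<inter> D = B}"
        using set_q[OF that(1,2)] by (intro measure_pmf.finite_measure_eq_AE) (auto simp: AE_measure_pmf_iff)
      also have "\<dots> = (\<Sum>A | A \<subseteq> H \<and> A \<inter> D = B. l H A)"
        using that pmf_q[OF that(1,2)] by (subst measure_measure_pmf_finite) auto
      also have "\<dots> = pmf (q D) B" using l_marg[OF that True] pmf_q[OF D] by simp
      finally show ?thesis .
    next
      case False
      then have "B \<notin> set_pmf (map_pmf (\<lambda>A. A \<inter> D) (q H))" "B \<notin> set_pmf (q D)"
        using set_q[OF D] by auto
      then show ?thesis by (metis pmf_eq_0_set_pmf)
    qed
  qed
  define code :: "'e set \<Rightarrow> 'e set \<Rightarrow> 'e \<Rightarrow> real" where "code J A = restrict (\<lambda>e. of_bool (e \<in> A)) J" for J A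
  define P where "P J = distr (measure_pmf (q J)) (PiM J (\<lambda>_. borel)) (code J)" for J
  have code_meas: "code J \<in> measurable (measure_pmf r) (PiM J (\<lambda>_. borel))" for J r
    by (simp add: measurable_def space_PiM code_def PiE_def)
  interpret pp: polish_projective "edges G" P
  proof (intro polish_projective.intro projective_family.intro)
    fix J H :: "'e set" assume JH: "J \<subseteq> H" "finite H" "H \<subseteq> edges G"
    have "distr (P H) (PiM J (\<lambda>_. borel)) (\<lambda>f. restrict f J)
      = distr (measure_pmf (q H)) (PiM J (\<lambda>_. borel)) (\<lambda>A. code J (A \<inter> J))"
      unfolding P_def
    proof (subst distr_distr)
      show "(\<lambda>f. restrict f J) \<in> measurable (PiM H (\<lambda>_. borel)) (PiM J (\<lambda>_. borel))"
        by (rule measurable_restrict_subset[OF JH(1)])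
      have "(\<lambda>f. restrict f J) \<circ> code H = (\<lambda>A. code J (A \<inter> J))"
        using JH(1) by (auto simp: code_def fun_eq_iff restrict_def)
      then show "distr (measure_pmf (q H)) (PiM J (\<lambda>_. borel)) ((\<lambda>f. restrict f J) \<circ> code H)
        = distr (measure_pmf (q H)) (PiM J (\<lambda>_. borel)) (\<lambda>A. code J (A \<inter> J))" by simp
    qed (rule code_meas)
    also have "\<dots> = distr (distr (measure_pmf (q H)) (count_space UNIV) (\<lambda>A. A \<inter> J)) (PiM J (\<lambda>_. borel)) (code J)"
      by (subst distr_distr) (auto simp: o_def measurable_def space_PiM code_def PiE_def)
    also have "\<dots> = P J"
      unfolding P_def q_marg[OF JH(2,3,1), symmetric] map_pmf_rep_eq ..
    finally show "P J = distr (P H) (PiM J (\<lambda>_. borel)) (\<lambda>f. restrict f J)" ..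
  next
    fix J :: "'e set" assume "finite J" "J \<subseteq> edges G"
    show "prob_space (P J)" unfolding P_def
      by (rule measure_pmf.prob_space_distr) (rule code_meas)
  qed
  \<comment> \<open>Decoding: every value other than 1 is read as absence of the edge.\<close>
  define dec :: "('e \<Rightarrow> real) \<Rightarrow> 'e set" where "dec \<omega> = {e\<in>edges G. \<omega> e = 1}" for \<omega>
  have dec: "dec \<in> measurable pp.lim (subgraph_space G)"
    unfolding subgraph_space_def
  proof (rule measurable_measure_of)
    fix Y assume "Y \<in> (\<lambda>e. {F \<in> Pow (edges G). e \<in> F}) ` edges G"
    then obtain e where e: "e \<in> edges G" "Y = {F \<in> Pow (edges G). e \<in> F}" by auto
    have "dec -` Y \<inter> space pp.lim = {\<omega>\<in>space (PiM (edges G) (\<lambda>_. borel)). \<omega> e = 1}"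
      using e by (auto simp: dec_def)
    also have "\<dots> \<in> sets (PiM (edges G) (\<lambda>_. borel))"
      using e(1) by measurable
    finally show "dec -` Y \<inter> space pp.lim \<in> sets pp.lim" by simp
  qed (auto simp: dec_def)
  define M where "M = distr pp.lim (subgraph_space G) dec"
  show ?thesis
  proof
    show M: "prob_space M" "sets M = sets (subgraph_space G)"
      unfolding M_def using dec by (auto intro: pp.P.prob_space_distr)
    have spM: "space M = Pow (edges G)" unfolding M_def by simp
    fix D A assume D: "finite D" "D \<subseteq> edges G" "A \<subseteq> D"
    have *: "{T\<in>space M. T \<inter> D = A} = superset_event G A - (\<Union>e\<in>D - A. superset_event G {e})"
      using D unfolding spM by auto
    have ev: "{T\<in>space M. T \<inter> D = A} \<in> sets (subgraph_space G)"
      unfolding * using D finite_subset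
      by (intro sets.Diff sets.finite_UN superset_event_sets) auto
    let ?X = "{f \<in> space (PiM D (\<lambda>_. borel::real measure)). \<forall>e\<in>D. f e = 1 \<longleftrightarrow> e \<in> A}"
    have X: "?X \<in> sets (PiM D (\<lambda>_. borel))"
      using D(1) by measurable
    have "measure M {T\<in>space M. T \<inter> D = A} = measure pp.lim (dec -` {T\<in>space M. T \<inter> D = A} \<inter> space pp.lim)"
      unfolding M_def by (rule measure_distr[OF dec]) (use ev spM in \<open>simp add: M_def\<close>)
    also have "dec -` {T\<in>space M. T \<inter> D = A} \<inter> space pp.lim = prod_emb (edges G) (\<lambda>_. borel) D ?X"
      using D unfolding spM by (auto simp: dec_def prod_emb_def space_PiM PiE_def)
    also have "measure pp.lim \<dots> = measure (P D) ?X"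
      using D X by (intro pp.measure_lim_emb) auto
    also have "\<dots> = measure (measure_pmf (q D)) (code D -` ?X)"
      unfolding P_def using X code_meas by (subst measure_distr) auto
    also have "\<dots> = measure (measure_pmf (q D)) {A}"
      using set_q[OF D(1,2)] D(3)
      by (intro measure_pmf.finite_measure_eq_AE)
        (auto simp: AE_measure_pmf_iff code_def space_PiM PiE_def)
    also have "\<dots> = l D A" using pmf_q[OF D(1,2)] by (simp add: measure_pmf_single)
    finally show "((\<lambda>i. measure_pmf.prob (p i) {T. T \<inter> D = A}) \<longlongrightarrow> measure M {T\<in>space M. T \<inter> D = A}) F"
      using l[OF D] by simp
  qed
qed

text \<open>A walk of least length repeats no vertex, since the piece between two visits could be
  cut out.\<close>

lemma rtrancl_simple_path:
  assumes "(a, b) \<in> r\<^sup>*"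
  obtains n f where "f 0 = a" "f n = b" "\<And>i. i < n \<Longrightarrow> (f i, f (Suc i)) \<in> r" "inj_on f {..n::nat}"
proof -
  have ex: "\<exists>n. (a, b) \<in> r ^^ n" using assms rtrancl_imp_relpow by auto
  define n where "n = (LEAST n. (a, b) \<in> r ^^ n)"
  have n: "(a, b) \<in> r ^^ n" unfolding n_def by (rule LeastI_ex[OF ex])
  have least: "n \<le> m" if "(a, b) \<in> r ^^ m" for m
    unfolding n_def by (rule Least_le) (rule that)
  obtain f where f: "f 0 = a" "f n = b" "\<And>i. i < n \<Longrightarrow> (f i, f (Suc i)) \<in> r"
    using n unfolding relpow_fun_conv by auto
  have seg: "(f i, f (i + k)) \<in> r ^^ k" if "i + k \<le> n" for i k
    using that f(3) unfolding relpow_fun_conv by (intro exI[of _ "\<lambda>j. f (i + j)"]) auto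
  have "f i \<noteq> f j" if "i < j" "j \<le> n" for i j
  proof
    assume "f i = f j"
    moreover have "(f 0, f i) \<in> r ^^ i" using seg[of 0 i] that by simp
    moreover have "(f j, f n) \<in> r ^^ (n - j)" using seg[of j "n - j"] that by simp
    ultimately have "(a, b) \<in> r ^^ (i + (n - j))"
      using f(1,2) by (auto simp: relpow_add)
    then show False using least that by fastforce
  qed
  then have "inj_on f {..n}" by (intro linorder_inj_onI') auto
  then show thesis using that f by blast
qed

lemma sym_adjacency: "sym (adjacency Q)"
  unfolding sym_def adjacency_def by (auto simp: insert_commute)

text \<open>Turns cycles given by lists into the redundancy of an edge that \<open>indep\<close>
  speaks of: an edge lies on a cycle iff its ends are joined without it. A loop corresponds to a
  path of length zero.\<close>

lemma no_cycle_iff: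
  "(\<nexists>vs es. is_cycle Q vs es) \<longleftrightarrow>
    (\<forall>e\<in>edges Q. \<forall>a b. endpoints Q e = {a, b} \<longrightarrow> (a, b) \<notin> (adjacency (Q\<lparr>edges := edges Q - {e}\<rparr>))\<^sup>*)"
  (is "?L \<longleftrightarrow> ?R")
proof
  assume L: ?L
  show ?R
  proof (intro ballI allI impI notI)
    fix e a b
    let ?Q = "Q\<lparr>edges := edges Q - {e}\<rparr>"
    assume e: "e \<in> edges Q" "endpoints Q e = {a, b}" and "(a, b) \<in> (adjacency ?Q)\<^sup>*"
    then obtain n f where f: "f 0 = a" "f n = b" "\<And>i. i < n \<Longrightarrow> (f i, f (Suc i)) \<in> adjacency ?Q"
      "inj_on f {..n::nat}" using rtrancl_simple_path by metis
    have "\<forall>i<n. \<exists>g. g \<in> edges Q - {e} \<and> endpoints Q g = {f i, f (Suc i)}"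
      using f(3) by (fastforce simp: adjacency_def)
    then obtain g where g: "\<And>i. i < n \<Longrightarrow> g i \<in> edges Q - {e}"
      "\<And>i. i < n \<Longrightarrow> endpoints Q (g i) = {f i, f (Suc i)}" by metis
    have "g i \<noteq> g j" if "i < j" "j < n" for i j
    proof
      assume "g i = g j"
      then have "{f i, f (Suc i)} = {f j, f (Suc j)}" using g(2)[of i] g(2)[of j] that by simp
      then have "f i = f j \<or> f i = f (Suc j)" by (auto simp: doubleton_eq_iff)
      then show False
        using inj_onD[OF f(4), of i j] inj_onD[OF f(4), of i "Suc j"] that by auto
    qed
    then have g_inj: "inj_on g {0..<n}" by (intro linorder_inj_onI') auto
    \<comment> \<open>The simple path from \<open>a\<close> to \<open>b\<close>, closed up by
      \<open>e\<close> as the last edge.\<close>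
    let ?vs = "map f [0..<Suc n]" and ?es = "map g [0..<n] @ [e]"
    have "is_cycle Q ?vs ?es"
      unfolding is_cycle_def
    proof (intro conjI allI impI)
      show "distinct ?vs"
        using f(4) by (simp add: distinct_map atLeast0LessThan lessThan_Suc_atMost del: upt_Suc)
      have "e \<notin> g ` {0..<n}" using g(1) by force
      then show "distinct ?es" using g_inj by (simp add: distinct_map)
      show "set ?es \<subseteq> edges Q" using g(1) e(1) by auto
      fix i assume "i < length ?es"
      then have "i < Suc n" by simp
      then consider "i < n" | "i = n" by linarith
      then show "endpoints Q (?es ! i) = {?vs ! i, ?vs ! (Suc i mod length ?es)}"
      proof cases
        case 1
        then have "?es ! i = g i" "?vs ! i = f i" "?vs ! (Suc i mod length ?es) = f (Suc i)"
          by (simp_all add: nth_append del: upt_Suc)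
        then show ?thesis using g(2)[OF 1] by simp
      next
        case 2
        then have "?es ! i = e" "?vs ! i = b" "?vs ! (Suc i mod length ?es) = a"
          using f(1,2) by (simp_all add: nth_append del: upt_Suc)
        then show ?thesis using e(2) by auto
      qed
    qed auto
    then show False using L by blast
  qed
next
  assume R: ?R
  show ?L
  proof (intro notI, elim exE)
    fix vs es assume c: "is_cycle Q vs es"
    define k where "k = length es - 1"
    have len: "length es = Suc k" "length vs = Suc k" using c by (auto simp: is_cycle_def k_def)
    let ?e = "es ! k"
    let ?Q = "Q\<lparr>edges := edges Q - {?e}\<rparr>"
    have ep: "endpoints Q (es ! i) = {vs ! i, vs ! (Suc i mod Suc k)}" if "i \<le> k" for i
      using c that len by (auto simp: is_cycle_def)
    have mem: "es ! i \<in> edges Q" if "i \<le> k" for i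
      using c that len by (force simp: is_cycle_def)
    have "i \<le> k \<Longrightarrow> (vs ! 0, vs ! i) \<in> (adjacency ?Q)\<^sup>*" for i
    proof (induction i)
      case (Suc i)
      have "es ! i \<noteq> ?e" using c Suc.prems len by (auto simp: is_cycle_def nth_eq_iff_index_eq)
      then have "(vs ! i, vs ! Suc i) \<in> adjacency ?Q"
        using ep[of i] mem[of i] Suc.prems by (auto simp: adjacency_def)
      then show ?case using Suc by (auto intro: rtrancl_into_rtrancl)
    qed simp
    moreover have "endpoints Q ?e = {vs ! 0, vs ! k}" using ep[of k] by auto
    ultimately show False using R mem[of k] by blast
  qed
qed

lemma incseq_filterlim_finite_subsets:
  fixes f :: "nat \<Rightarrow> 'a set"
  assumes "\<And>n. f n \<subseteq> f (Suc n)" "\<And>n. finite (f n)" "(\<Union>n. f n) = A"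
  shows "filterlim f (finite_subsets_at_top A) sequentially"
  unfolding filterlim_finite_subsets_at_top
proof (intro allI impI, elim conjE)
  fix X assume X: "finite X" "X \<subseteq> A"
  have inc: "f m \<subseteq> f n" if "m \<le> n" for m n using lift_Suc_mono_le[of f] assms(1) that by blast
  have "\<exists>n. X \<subseteq> f n" using X
  proof (induction rule: finite_induct)
    case (insert x X)
    then obtain n m where "X \<subseteq> f n" "x \<in> f m" using assms(3) by auto
    then have "insert x X \<subseteq> f (max n m)" using inc[of n "max n m"] inc[of m "max n m"] by auto
    then show ?case by blast
  qed simp
  then obtain n where "X \<subseteq> f n" by blast
  then show "\<forall>\<^sub>F y in sequentially. finite (f y) \<and> X \<subseteq> f y \<and> f y \<subseteq> A"
    using inc assms(2,3) by (intro eventually_sequentiallyI[of n]) blast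
qed

text \<open>Only probabilities of containing a finite set are recorded; they determine the limit law
  and the limits of all local functions. The filter is a parameter: finite vertex sets for wired
  laws, finite edge sets for free ones.\<close>

definition law_limit ::
  "('v, 'e) multigraph \<Rightarrow> 'i filter \<Rightarrow> ('i \<Rightarrow> ('e set \<Rightarrow> real) \<Rightarrow> real) \<Rightarrow> 'e set measure \<Rightarrow> bool" where
  "law_limit G F X M \<longleftrightarrow> prob_space M \<and> sets M = sets (subgraph_space G) \<and>
    (\<forall>D. finite D \<longrightarrow> D \<subseteq> edges G \<longrightarrow>
      ((\<lambda>i. X i (\<lambda>T. of_bool (D \<subseteq> T))) \<longlongrightarrow> measure M (superset_event G D)) F)"

context edge_ends
begin

section \<open>Convergence of means of local functions\<close>

lemma local_integrable:
  assumes "prob_space M" "sets M = sets (subgraph_space G)" "finite D" "D \<subseteq> edges G" "local_on D \<phi>"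
  shows "integrable M \<phi>"
  using assms(3,5)
proof (induction rule: local_on_induct)
  case (superset D')
  interpret prob_space M by fact
  have sp: "space M = Pow (edges G)" using sets_eq_imp_space_eq[OF assms(2)] by simp
  have "superset_event G D' \<in> sets M"
    using superset_event_sets[of D' G] superset assms(2-4) finite_subset by blast
  then have "integrable M (indicator (superset_event G D') :: _ \<Rightarrow> real)"
    by (intro integrable_real_indicator) (auto simp: emeasure_eq_measure)
  then show ?case
    by (rule Bochner_Integration.integrable_cong[THEN iffD1, rotated -1]) (auto simp: sp indicator_def)
next
  case (lin c f g)
  then show ?case by simp
qed

lemma integral_superset:
  assumes "sets M = sets (subgraph_space G)" "finite D" "D \<subseteq> edges G"
  shows "(\<integral>X. of_bool (D \<subseteq> X) \<partial>M) = measure M (superset_event G D)"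
proof -
  have sp: "space M = Pow (edges G)" using sets_eq_imp_space_eq[OF assms(1)] by simp
  have "(\<integral>X. of_bool (D \<subseteq> X) \<partial>M) = (\<integral>X. (indicator (superset_event G D) X :: real) \<partial>M)"
    by (rule Bochner_Integration.integral_cong) (auto simp: sp indicator_def)
  moreover have "superset_event G D \<inter> space M = superset_event G D" using sp by blast
  ultimately show ?thesis by simp
qed

lemma law_limit_tendsto:
  assumes "law_limit G F (\<lambda>i. Ex (R i) (E i)) M" "finite D" "D \<subseteq> edges G" "local_on D \<phi>"
  shows "((\<lambda>i. Ex (R i) (E i) \<phi>) \<longlongrightarrow> integral\<^sup>L M \<phi>) F"
proof -
  have M: "prob_space M" "sets M = sets (subgraph_space G)" using assms(1) by (auto simp: law_limit_def)
  have "integrable M \<phi> \<and> ((\<lambda>i. Ex (R i) (E i) \<phi>) \<longlongrightarrow> integral\<^sup>L M \<phi>) F"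
    using assms(2,4)
  proof (induction rule: local_on_induct)
    case (superset D')
    then have D': "finite D'" "D' \<subseteq> edges G" using assms(2,3) finite_subset by auto
    then show ?case
      using assms(1) local_integrable[OF M D' local_on_superset] integral_superset[OF M(2) D']
      unfolding law_limit_def by simp
  next
    case (lin c f g)
    then show ?case by (auto simp: Ex_add Ex_cmult intro!: tendsto_intros)
  qed
  then show ?thesis ..
qed

lemma local_on_trace: "local_on D (\<lambda>T. of_bool (T \<inter> D = A))"
  by (auto simp: local_on_def)

lemma integral_trace:
  assumes "sets M = sets (subgraph_space G)" "finite D" "D \<subseteq> edges G"
  shows "(\<integral>X. of_bool (X \<inter> D = A) \<partial>M) = measure M {X\<in>space M. X \<inter> D = A}"
proof -
  have sp: "space M = Pow (edges G)" using sets_eq_imp_space_eq[OF assms(1)] by simp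
  have "(\<integral>X. of_bool (X \<inter> D = A) \<partial>M) = (\<integral>X. (indicator {X\<in>space M. X \<inter> D = A} X :: real) \<partial>M)"
    by (rule Bochner_Integration.integral_cong) (auto simp: indicator_def)
  then show ?thesis by (simp add: Int_absorb2)
qed

lemma prob_uniform_basis:
  assumes "finite E"
  shows "measure_pmf.prob (pmf_of_set (bases R E)) {T. Q T} = Ex R E (\<lambda>T. of_bool (Q T))"
proof -
  have "real (card (bases R E \<inter> {T. Q T})) = (\<Sum>T\<in>bases R E. of_bool (Q T))"
    using assms by simp
  then show ?thesis
    unfolding Ex_def using assms bases_nonempty by (subst measure_pmf_of_set) auto
qed

lemma law_limit_exists:
  fixes G :: "('w, 'e) multigraph"
  assumes "F \<noteq> bot" and fin: "\<forall>\<^sub>F i in F. finite (E i)"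
    and lim: "\<And>D. finite D \<Longrightarrow> D \<subseteq> edges G \<Longrightarrow> \<exists>l. ((\<lambda>i. Ex (R i) (E i) (\<lambda>T. of_bool (D \<subseteq> T))) \<longlongrightarrow> l) F"
  obtains M where "law_limit G F (\<lambda>i. Ex (R i) (E i)) M"
proof -
  let ?p = "\<lambda>i. pmf_of_set (bases (R i) (E i))"
  have prob: "\<forall>\<^sub>F i in F. Ex (R i) (E i) (\<lambda>T. of_bool (Q T)) = measure_pmf.prob (?p i) {T. Q T}" for Q
    using fin by eventually_elim (simp add: prob_uniform_basis)
  have "\<exists>l. ((\<lambda>i. measure_pmf.prob (?p i) {T. T \<inter> D = A}) \<longlongrightarrow> l) F"
    if D: "finite D" "D \<subseteq> edges G" "A \<subseteq> D" for D A
  proof -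
    have "\<exists>l. ((\<lambda>i. Ex (R i) (E i) (\<lambda>T. of_bool (T \<inter> D = A))) \<longlongrightarrow> l) F"
      using D(1) local_on_trace[of D A]
    proof (induction rule: local_on_induct)
      case (superset D')
      then show ?case using D finite_subset by (intro lim) auto
    next
      case (lin c f g)
      then obtain l l' where "((\<lambda>i. Ex (R i) (E i) f) \<longlongrightarrow> l) F" "((\<lambda>i. Ex (R i) (E i) g) \<longlongrightarrow> l') F" by blast
      then have "((\<lambda>i. Ex (R i) (E i) f + c * Ex (R i) (E i) g) \<longlongrightarrow> l + c * l') F"
        by (intro tendsto_intros)
      then show ?case by (auto simp: Ex_add Ex_cmult)
    qed
    then show ?thesis using tendsto_cong[OF prob] by blast
  qed
  then obtain M where M: "prob_space M" "sets M = sets (subgraph_space G)"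
    "\<And>D A. finite D \<Longrightarrow> D \<subseteq> edges G \<Longrightarrow> A \<subseteq> D \<Longrightarrow>
      ((\<lambda>i. measure_pmf.prob (?p i) {T. T \<inter> D = A}) \<longlongrightarrow> measure M {T\<in>space M. T \<inter> D = A}) F"
    by (rule limit_measure_exists[OF assms(1), of G ?p]) blast+
  have sp: "space M = Pow (edges G)" using sets_eq_imp_space_eq[OF M(2)] by simp
  have "law_limit G F (\<lambda>i. Ex (R i) (E i)) M"
    unfolding law_limit_def
  proof (intro conjI allI impI M(1,2))
    fix D assume D: "finite D" "D \<subseteq> edges G"
    have "T \<inter> D = D \<longleftrightarrow> D \<subseteq> T" for T by auto
    then show "((\<lambda>i. Ex (R i) (E i) (\<lambda>T. of_bool (D \<subseteq> T))) \<longlongrightarrow> measure M (superset_event G D)) F"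
      using M(3)[OF D order_refl] tendsto_cong[OF prob, of "\<lambda>T. D \<subseteq> T"] by (simp add: sp)
  qed
  then show thesis using that by blast
qed

text \<open>\<open>\<phi>\<close> is the quotient map onto the vertices of \<open>Q\<close>. A walk
  in \<open>Q\<close> may enter a vertex through one preimage and leave it through another; the
  assumption on fibres bridges this gap inside \<open>conn\<close>.\<close>

lemma adjacency_conn:
  fixes Q :: "('w, 'e) multigraph" and \<phi> :: "'v \<Rightarrow> 'w"
  assumes ep: "\<And>e. e \<in> T \<Longrightarrow> endpoints Q e = {\<phi> (fst (en e)), \<phi> (snd (en e))}"
    and ends: "\<And>e. e \<in> T \<Longrightarrow> fst (en e) \<in> V \<and> snd (en e) \<in> V"
    and rel: "\<And>a b. (a, b) \<in> R \<Longrightarrow> \<phi> a = \<phi> b"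
    and fib: "\<And>a b. a \<in> V \<Longrightarrow> b \<in> V \<Longrightarrow> \<phi> a = \<phi> b \<Longrightarrow> (a, b) \<in> conn R {}"
    and uv: "u \<in> V" "v \<in> V"
  shows "(\<phi> u, \<phi> v) \<in> (adjacency (Q\<lparr>edges := T\<rparr>))\<^sup>* \<longleftrightarrow> (u, v) \<in> conn R T"
proof
  let ?A = "adjacency (Q\<lparr>edges := T\<rparr>)"
  have fib': "(a, b) \<in> conn R T" if "a \<in> V" "b \<in> V" "\<phi> a = \<phi> b" for a b
    using fib[OF that] by (rule conn_monoD) auto
  have "(\<phi> u, z) \<in> ?A\<^sup>* \<Longrightarrow> (\<forall>v\<in>V. \<phi> v = z \<longrightarrow> (u, v) \<in> conn R T)" for z
  proof (induction rule: rtrancl_induct)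
    case base
    then show ?case using fib' uv(1) by metis
  next
    case (step y z)
    then obtain e where e: "e \<in> T" "{\<phi> (fst (en e)), \<phi> (snd (en e))} = {y, z}"
      using ep by (auto simp: adjacency_def)
    have edge: "(fst (en e), snd (en e)) \<in> conn R T" using conn_edge[OF e(1)] by simp
    obtain a b where ab: "a \<in> V" "b \<in> V" "\<phi> a = y" "\<phi> b = z" "(a, b) \<in> conn R T"
      using e(2) ends[OF e(1)] edge conn_sym[OF edge] unfolding doubleton_eq_iff by metis
    then have "(u, b) \<in> conn R T" using step.IH conn_trans by metis
    then show ?case using fib' ab conn_trans by metis
  qed
  then show "(\<phi> u, \<phi> v) \<in> ?A\<^sup>* \<Longrightarrow> (u, v) \<in> conn R T" using uv by blast
  have sym: "(x, y) \<in> ?A\<^sup>* \<Longrightarrow> (y, x) \<in> ?A\<^sup>*" for x y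
    by (rule sym_rtrancl[OF sym_adjacency, THEN symD])
  assume "(u, v) \<in> conn R T"
  then show "(\<phi> u, \<phi> v) \<in> ?A\<^sup>*"
  proof (induction rule: conn_induct)
    case (rel a b)
    then show ?case using assms(3) by metis
  next
    case (edge e a b)
    then have "(\<phi> a, \<phi> b) \<in> ?A" using ep by (force simp: adjacency_def)
    then show ?case using sym by (meson r_into_rtrancl rtrancl_trans)
  qed simp
qed

text \<open>Links spanning trees of concrete graphs to bases. It is applied with the identity for
  free boundary conditions and with the map collapsing everything outside a finite set for wired
  ones.\<close>

lemma spanning_trees_eq_bases:
  fixes Q :: "('w, 'e) multigraph" and \<phi> :: "'v \<Rightarrow> 'w"
  assumes verts: "verts Q = \<phi> ` V" "V \<noteq> {}"
    and ep: "\<And>e. e \<in> edges Q \<Longrightarrow> endpoints Q e = {\<phi> (fst (en e)), \<phi> (snd (en e))}"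
    and ends: "\<And>e. e \<in> edges Q \<Longrightarrow> fst (en e) \<in> V \<and> snd (en e) \<in> V"
    and rel: "\<And>a b. (a, b) \<in> R \<Longrightarrow> \<phi> a = \<phi> b"
    and fib: "\<And>a b. a \<in> V \<Longrightarrow> b \<in> V \<Longrightarrow> \<phi> a = \<phi> b \<Longrightarrow> (a, b) \<in> conn R {}"
    and con: "\<And>a b. a \<in> V \<Longrightarrow> b \<in> V \<Longrightarrow> (a, b) \<in> conn R (edges Q)"
  shows "spanning_trees Q = bases R (edges Q)"
proof -
  have adj: "(\<phi> u, \<phi> v) \<in> (adjacency (Q\<lparr>edges := T\<rparr>))\<^sup>* \<longleftrightarrow> (u, v) \<in> conn R T"
    if "T \<subseteq> edges Q" "u \<in> V" "v \<in> V" for T u v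
    using that(1) by (intro adjacency_conn[of T Q \<phi> V R, OF ep ends rel fib that(2,3)]) auto
  have "is_tree (spanning_subgraph Q T) \<longleftrightarrow> basis R (edges Q) T" if T: "T \<subseteq> edges Q" for T
  proof -
    have "connected_graph (spanning_subgraph Q T) \<longleftrightarrow> (\<forall>u\<in>V. \<forall>v\<in>V. (u, v) \<in> conn R T)"
      unfolding connected_graph_def spanning_subgraph_def using verts adj[OF T] by simp
    also have "\<dots> \<longleftrightarrow> (\<forall>e\<in>edges Q. en e \<in> conn R T)"
    proof
      assume "\<forall>u\<in>V. \<forall>v\<in>V. (u, v) \<in> conn R T"
      then show "\<forall>e\<in>edges Q. en e \<in> conn R T" using ends by (metis prod.collapse)
    next
      assume *: "\<forall>e\<in>edges Q. en e \<in> conn R T"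
      have "conn R (edges Q) \<subseteq> conn R T"
        by (rule conn_least) (use * conn_rel in auto)
      then show "\<forall>u\<in>V. \<forall>v\<in>V. (u, v) \<in> conn R T" using con by blast
    qed
    finally have 1: "connected_graph (spanning_subgraph Q T) \<longleftrightarrow> (\<forall>e\<in>edges Q. en e \<in> conn R T)" .
    have "(\<nexists>vs es. is_cycle (spanning_subgraph Q T) vs es) \<longleftrightarrow> indep R T"
    proof -
      have "(\<forall>a b. endpoints Q e = {a, b} \<longrightarrow> (a, b) \<notin> (adjacency (Q\<lparr>edges := T - {e}\<rparr>))\<^sup>*)
        \<longleftrightarrow> en e \<notin> conn R (T - {e})" if e: "e \<in> T" for e
      proof -
        have eQ: "e \<in> edges Q" "T - {e} \<subseteq> edges Q" using e T by auto
        let ?A = "(adjacency (Q\<lparr>edges := T - {e}\<rparr>))\<^sup>*"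
        have sym: "(x, y) \<in> ?A \<longleftrightarrow> (y, x) \<in> ?A" for x y
          by (rule iffI; erule sym_rtrancl[OF sym_adjacency, THEN symD])
        have "(\<forall>a b. endpoints Q e = {a, b} \<longrightarrow> (a, b) \<notin> ?A)
          \<longleftrightarrow> (\<phi> (fst (en e)), \<phi> (snd (en e))) \<notin> ?A"
          unfolding ep[OF eQ(1)] doubleton_eq_iff using sym by blast
        also have "\<dots> \<longleftrightarrow> en e \<notin> conn R (T - {e})"
          using adj[OF eQ(2)] ends[OF eQ(1)] by simp
        finally show ?thesis .
      qed
      then show ?thesis unfolding no_cycle_iff indep_def spanning_subgraph_def by simp
    qed
    then show ?thesis unfolding is_tree_def basis_def using 1 T by blast
  qed
  then show ?thesis unfolding spanning_trees_def bases_def by (auto simp: basis_def)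
qed

end

section \<open>The free and wired spanning forests as limits of maximal forests\<close>

lemma law_limit_prob: "law_limit G F X M \<Longrightarrow> prob_space M"
  and law_limit_sets: "law_limit G F X M \<Longrightarrow> sets M = sets (subgraph_space G)"
  unfolding law_limit_def by blast+

locale lf_graph = edge_ends en for en :: "'e \<Rightarrow> 'v \<times> 'v" +
  fixes G :: "('v, 'e) multigraph"
  assumes endpoints_eq: "\<And>e. e \<in> edges G \<Longrightarrow> endpoints G e = {fst (en e), snd (en e)}"
    and ends_in: "\<And>e. e \<in> edges G \<Longrightarrow> fst (en e) \<in> verts G \<and> snd (en e) \<in> verts G"
    and locally_finite: "locally_finite_graph G"
    and connected: "connected_graph G"
begin

abbreviation linked :: "'e set \<Rightarrow> ('v \<times> 'v) set" where
  "linked F \<equiv> conn {} F"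

text \<open>With \<open>P\<close> the connections of all of \<open>G\<close> this describes the
  wired spanning forest, with \<open>P = linked F\<close> the resampling on the components of
  \<open>F\<close>. Lemmas about a general \<open>P\<close> serve both.\<close>

definition wired_law :: "('v \<times> 'v) set \<Rightarrow> 'e set measure \<Rightarrow> bool" where
  "wired_law P = law_limit G (finite_subsets_at_top (verts G)) (Ex_wired (edges G) P)"

definition free_law :: "('v \<times> 'v) set \<Rightarrow> 'e set measure \<Rightarrow> bool" where
  "free_law P = law_limit G (finite_subsets_at_top (edges_in P (edges G))) (Ex {})"

lemma finite_touching:
  assumes "finite W" "W \<subseteq> verts G"
  shows "finite (touching W (edges G))"
proof -
  have "touching W (edges G) = (\<Union>w\<in>W. {e\<in>edges G. w \<in> endpoints G e})"
    using endpoints_eq by (auto simp: touching_def)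
  then show ?thesis using assms locally_finite by (auto simp: locally_finite_graph_def)
qed

lemma finite_touching_in:
  assumes "finite W" "W \<subseteq> verts G"
  shows "finite (touching W (edges_in P (edges G)))"
  by (rule finite_subset[OF touching_mono[OF order_refl edges_in_subset] finite_touching[OF assms]])

lemma linked_verts:
  assumes "(u, v) \<in> linked F" "F \<subseteq> edges G" "u \<in> verts G"
  shows "v \<in> verts G"
  using assms(1)
proof (induction rule: conn_induct)
  case (edge e a b)
  then show ?case using ends_in[of e] assms(2) by auto
qed (use assms in auto)

lemma adjacency_linked:
  assumes "F \<subseteq> edges G" "u \<in> verts G" "v \<in> verts G"
  shows "(u, v) \<in> (adjacency (spanning_subgraph G F))\<^sup>* \<longleftrightarrow> (u, v) \<in> linked F"
proof -
  have "(id u, id v) \<in> (adjacency (G\<lparr>edges := F\<rparr>))\<^sup>* \<longleftrightarrow> (u, v) \<in> linked F"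
    by (rule adjacency_conn[where V = "verts G"]) (use assms endpoints_eq ends_in in auto)
  then show ?thesis by (simp add: spanning_subgraph_def)
qed

lemma linked_all: "u \<in> verts G \<Longrightarrow> v \<in> verts G \<Longrightarrow> (u, v) \<in> linked (edges G)"
  using adjacency_linked[of "edges G" u v] connected
  by (simp add: connected_graph_def spanning_subgraph_def)

lemma edges_in_linked [simp]: "edges_in (linked (edges G)) (edges G) = edges G"
  using conn_edge by (auto simp: edges_in_def)

lemma wf: "wf_graph G"
  unfolding wf_graph_def using endpoints_eq ends_in by (auto simp: card_insert_if)

lemma wired_law_exists:
  obtains M where "wired_law P M"
proof -
  let ?F = "finite_subsets_at_top (verts G)"
  have fin: "\<forall>\<^sub>F W in ?F. finite (touching W (edges_in P (edges G)))"
    by (intro eventually_finite_subsets_at_top_weakI finite_touching_in)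
  have lim: "\<exists>l. ((\<lambda>W. Ex_wired (edges G) P W (\<lambda>T. of_bool (D \<subseteq> T))) \<longlongrightarrow> l) ?F" for D
  proof (rule finite_subsets_monotone_limit[where f = "\<lambda>W. Ex_wired (edges G) P W (\<lambda>T. of_bool (D \<subseteq> T))"
        and B = 1 and A = "verts G"])
    fix X Y assume "finite Y" "X \<subseteq> Y" "Y \<subseteq> verts G"
    then show "Ex_wired (edges G) P X (\<lambda>T. of_bool (D \<subseteq> T)) \<le> Ex_wired (edges G) P Y (\<lambda>T. of_bool (D \<subseteq> T))"
      by (intro Ex_wired_mono finite_touching increasing_superset)
  next
    fix X assume "finite X" "X \<subseteq> verts G"
    then show "Ex_wired (edges G) P X (\<lambda>T. of_bool (D \<subseteq> T)) \<le> 1"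
      unfolding Ex_wired_def by (intro Ex_indicator_bounds finite_touching_in)
  qed blast
  have "\<exists>M. law_limit G ?F (\<lambda>W. Ex (wired_rel P W) (touching W (edges_in P (edges G)))) M"
    by (rule law_limit_exists[OF _ fin, of G "wired_rel P"])
      (use lim in \<open>auto simp: Ex_wired_def\<close>)
  then show thesis using that unfolding wired_law_def Ex_wired_def[abs_def] by blast
qed

lemma free_law_exists:
  obtains M where "free_law P M"
proof -
  let ?E = "edges_in P (edges G)"
  let ?F = "finite_subsets_at_top ?E"
  have fin: "\<forall>\<^sub>F E in ?F. finite E"
    by (rule eventually_finite_subsets_at_top_weakI) simp
  have lim: "\<exists>l. ((\<lambda>E. Ex {} E (\<lambda>T. of_bool (D \<subseteq> T))) \<longlongrightarrow> l) ?F" if D: "finite D" for D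
  proof (cases "D \<subseteq> ?E")
    case True
    \<comment> \<open>The probability of containing \<open>D\<close> is decreasing in
      \<open>E\<close> only once \<open>E\<close> contains \<open>D\<close>. Adjoining
      \<open>D\<close> makes it monotone throughout, and eventually
      \<open>E \<union> D = E\<close>.\<close>
    let ?f = "\<lambda>E. - Ex {} (E \<union> D) (\<lambda>T. of_bool (D \<subseteq> T))"
    obtain l where "(?f \<longlongrightarrow> l) ?F"
    proof (rule finite_subsets_monotone_limit[where f = ?f and B = 0 and A = ?E])
      fix X Y assume "finite Y" "X \<subseteq> Y" "Y \<subseteq> ?E"
      then show "?f X \<le> ?f Y" using D
        by (auto intro!: Ex_add_edges_le[where D = D] increasing_superset local_on_superset)
    next
      fix X assume "finite X" "X \<subseteq> ?E"
      then show "?f X \<le> 0" using D by (auto intro!: Ex_indicator_bounds)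
    qed
    then have "((\<lambda>E. - ?f E) \<longlongrightarrow> - l) ?F" by (rule tendsto_minus)
    moreover have "\<forall>\<^sub>F E in ?F. - ?f E = Ex {} E (\<lambda>T. of_bool (D \<subseteq> T))"
      unfolding eventually_finite_subsets_at_top
      using D True by (intro exI[of _ D]) (auto simp: Un_absorb2)
    ultimately have "((\<lambda>E. Ex {} E (\<lambda>T. of_bool (D \<subseteq> T))) \<longlongrightarrow> - l) ?F"
      by (rule Lim_transform_eventually)
    then show ?thesis ..
  next
    case False
    have "\<forall>\<^sub>F E in ?F. Ex {} E (\<lambda>T. of_bool (D \<subseteq> T)) = 0"
    proof (rule eventually_finite_subsets_at_top_weakI)
      fix E assume E: "finite E" "E \<subseteq> ?E"
      have "Ex {} E (\<lambda>T. of_bool (D \<subseteq> T)) = Ex {} E (\<lambda>T. 0)"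
      proof (rule Ex_cong)
        fix T assume "T \<in> bases {} E"
        then have "T \<subseteq> ?E" using order_trans[OF bases_subset E(2)] by blast
        then have "\<not> D \<subseteq> T" using False order_trans[of D T ?E] by blast
        then show "of_bool (D \<subseteq> T) = (0::real)" by simp
      qed
      then show "Ex {} E (\<lambda>T. of_bool (D \<subseteq> T)) = 0" using E by (simp add: Ex_const)
    qed
    then have "((\<lambda>E. Ex {} E (\<lambda>T. of_bool (D \<subseteq> T))) \<longlongrightarrow> 0) ?F"
      by (rule tendsto_eventually)
    then show ?thesis ..
  qed
  have lim': "\<exists>l. ((\<lambda>E. Ex {} E (\<lambda>T. of_bool (D \<subseteq> T))) \<longlongrightarrow> l) ?F"
    if "finite D" "D \<subseteq> edges G" for D using lim[OF that(1)] .
  obtain M where "law_limit G ?F (\<lambda>E. Ex {} E) M"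
    by (rule law_limit_exists[where F = ?F, OF finite_subsets_at_top_neq_bot fin lim'])
  then show thesis using that unfolding free_law_def by blast
qed

text \<open>Balls around \<open>r\<close>, finite by local finiteness. They provide countability, a
  concrete exhaustion, and a sequence along which dominated convergence can replace limits over all
  finite sets.\<close>

definition spread :: "'v \<Rightarrow> nat \<Rightarrow> 'v set" where
  "spread r n = rec_nat {r} (\<lambda>_ B. B \<union> {v. \<exists>u\<in>B. (u, v) \<in> adjacency G}) n"

lemma spread_simps [simp]:
  "spread r 0 = {r}"
  "spread r (Suc n) = spread r n \<union> {v. \<exists>u\<in>spread r n. (u, v) \<in> adjacency G}"
  by (simp_all add: spread_def)

lemma adjacency_verts: "(u, v) \<in> adjacency G \<Longrightarrow> u \<in> verts G \<and> v \<in> verts G"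
  using wf unfolding adjacency_def wf_graph_def by blast

lemma finite_neighbours:
  assumes "u \<in> verts G"
  shows "finite {v. (u, v) \<in> adjacency G}"
proof (rule finite_subset)
  show "{v. (u, v) \<in> adjacency G} \<subseteq> (\<Union>e\<in>{e\<in>edges G. u \<in> endpoints G e}. endpoints G e)"
    unfolding adjacency_def by blast
  show "finite (\<Union>e\<in>{e\<in>edges G. u \<in> endpoints G e}. endpoints G e)"
    using assms locally_finite endpoints_eq by (auto simp: locally_finite_graph_def)
qed

lemma spread_finite: "r \<in> verts G \<Longrightarrow> finite (spread r n) \<and> spread r n \<subseteq> verts G"
proof (induction n)
  case (Suc n)
  have "{v. \<exists>u\<in>spread r n. (u, v) \<in> adjacency G} = (\<Union>u\<in>spread r n. {v. (u, v) \<in> adjacency G})"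
    by auto
  moreover have "finite (\<Union>u\<in>spread r n. {v. (u, v) \<in> adjacency G})"
    using Suc finite_neighbours by blast
  ultimately show ?case using Suc adjacency_verts by auto
qed auto

lemma spread_Union:
  assumes "r \<in> verts G"
  shows "(\<Union>n. spread r n) = verts G"
proof
  show "(\<Union>n. spread r n) \<subseteq> verts G" using spread_finite[OF assms] by blast
  have "(r, v) \<in> (adjacency G)\<^sup>* \<Longrightarrow> \<exists>n. v \<in> spread r n" for v
  proof (induction rule: rtrancl_induct)
    case base
    have "r \<in> spread r 0" by simp
    then show ?case by blast
  next
    case (step y z)
    then obtain n where "y \<in> spread r n" by blast
    then have "z \<in> spread r (Suc n)" using step(2) by auto
    then show ?case by blast
  qed
  then show "verts G \<subseteq> (\<Union>n. spread r n)"
    using connected assms by (auto simp: connected_graph_def)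
qed

text \<open>The forests are characterised by a condition on all exhaustions; uniqueness of the law
  requires that one exists.\<close>

lemma spread_exhaustion:
  assumes r: "r \<in> verts G"
  shows "induced_exhaustion G (\<lambda>n. induced_subgraph G (spread r n))"
proof -
  let ?H = "\<lambda>n. induced_subgraph G (spread r n)"
  have H: "verts (?H n) = spread r n" "endpoints (?H n) = endpoints G"
    "edges (?H n) = {e \<in> edges G. endpoints G e \<subseteq> spread r n}" for n
    by (simp_all add: induced_subgraph_def)
  have mono: "spread r n \<subseteq> spread r (Suc n)" for n by auto
  have inc: "spread r m \<subseteq> spread r n" if "m \<le> n" for m n
    using lift_Suc_mono_le[of "spread r"] mono that by blast
  have wfH: "wf_graph (?H n)" for n
    using wf by (simp add: wf_graph_def H)
  have sub: "subgraph (?H n) G" "subgraph (?H n) (?H (Suc n))" for n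
    using wfH[of n] spread_finite[OF r, of n] mono[of n] order_trans[OF _ mono[of n]]
    unfolding subgraph_def H by blast+
  have fin: "finite_graph (?H n)" for n
  proof -
    have "edges (?H n) \<subseteq> touching (spread r n) (edges G)"
      using endpoints_eq by (auto simp: H touching_def)
    moreover have "finite (touching (spread r n) (edges G))"
      using spread_finite[OF r, of n] by (intro finite_touching) auto
    ultimately have "finite (edges (?H n))" by (rule finite_subset)
    then show ?thesis unfolding finite_graph_def using spread_finite[OF r, of n] H(1) by simp
  qed
  have reach: "v \<in> spread r n \<Longrightarrow> (r, v) \<in> (adjacency (?H n))\<^sup>*" for v n
  proof (induction n arbitrary: v)
    case (Suc n)
    have adj: "adjacency (?H n) \<subseteq> adjacency (?H (Suc n))"
      unfolding adjacency_def H using mono[of n] by blast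
    have old: "(r, u) \<in> (adjacency (?H (Suc n)))\<^sup>*" if "u \<in> spread r n" for u
      using Suc.IH[OF that] rtrancl_mono[OF adj] by blast
    have new: "(u, v) \<in> adjacency (?H (Suc n))"
      if u: "u \<in> spread r n" "(u, v) \<in> adjacency G" for u
    proof -
      have "v \<in> spread r (Suc n)" "u \<in> spread r (Suc n)" using u by auto
      moreover obtain e where "e \<in> edges G" "endpoints G e = {u, v}"
        using u(2) by (auto simp: adjacency_def)
      ultimately have "e \<in> edges (?H (Suc n))" "endpoints (?H (Suc n)) e = {u, v}"
        unfolding H by simp_all
      then show ?thesis unfolding adjacency_def by blast
    qed
    have "v \<in> spread r n \<or> (\<exists>u\<in>spread r n. (u, v) \<in> adjacency G)"
      using Suc.prems unfolding spread_simps by (rule UnE) (rule disjI1, assumption, rule disjI2, erule CollectD)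
    then consider "v \<in> spread r n" | u where "u \<in> spread r n" "(u, v) \<in> adjacency G"
      by (elim disjE bexE)
    then show ?case
    proof cases
      case 1
      then show ?thesis by (rule old)
    next
      case (2 u)
      show ?thesis by (rule rtrancl_into_rtrancl[OF old[OF 2(1)] new[OF 2]])
    qed
  qed simp
  have con: "connected_graph (?H n)" for n
    unfolding connected_graph_def H
  proof (intro conjI ballI)
    have "r \<in> spread r n" using inc[of 0 n] by auto
    then show "spread r n \<noteq> {}" by blast
    fix u v assume "u \<in> spread r n" "v \<in> spread r n"
    then show "(u, v) \<in> (adjacency (?H n))\<^sup>*"
      using reach sym_rtrancl[OF sym_adjacency, THEN symD] by (meson rtrancl_trans)
  qed
  have "(\<Union>n. edges (?H n)) = edges G"
  proof
    show "edges G \<subseteq> (\<Union>n. edges (?H n))"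
    proof
      fix e assume e: "e \<in> edges G"
      then obtain m n where "fst (en e) \<in> spread r m" "snd (en e) \<in> spread r n"
        using ends_in[OF e] spread_Union[OF r] by blast
      then have "endpoints G e \<subseteq> spread r (max m n)"
        using endpoints_eq[OF e] inc[of m "max m n"] inc[of n "max m n"] by auto
      then show "e \<in> (\<Union>n. edges (?H n))" using e H by auto
    qed
  qed (auto simp: H)
  then show ?thesis
    unfolding induced_exhaustion_def exhaustion_def
    using sub fin con spread_Union[OF r] by (simp add: H)
qed

section \<open>Identification of the limits with the two spanning forests\<close>

lemma exhaustion_filterlims:
  assumes "exhaustion G Gs"
  shows "filterlim (\<lambda>n. verts (Gs n)) (finite_subsets_at_top (verts G)) sequentially"
    and "filterlim (\<lambda>n. edges (Gs n)) (finite_subsets_at_top (edges G)) sequentially"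
  using assms
  by (auto intro!: incseq_filterlim_finite_subsets simp: exhaustion_def subgraph_def finite_graph_def)

lemma spanning_trees_wired:
  assumes "verts H \<subseteq> verts G"
  shows "spanning_trees (wired_graph G H) =
    bases (wired_rel (linked (edges G)) (verts H)) (touching (verts H) (edges G))"
proof -
  let ?W = "verts H" and ?P = "linked (edges G)"
  let ?R = "wired_rel ?P ?W"
  define \<phi> where "\<phi> v = (if v \<in> ?W then Some v else None)" for v
  have Q: "verts (wired_graph G H) = \<phi> ` verts G"
    "edges (wired_graph G H) = touching ?W (edges G)"
    "endpoints (wired_graph G H) e = \<phi> ` endpoints G e" for e
    using endpoints_eq by (auto simp: wired_graph_def Let_def \<phi>_def[abs_def] touching_def)
  have "spanning_trees (wired_graph G H) = bases ?R (edges (wired_graph G H))"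
  proof (rule spanning_trees_eq_bases[where V = "verts G" and \<phi> = \<phi>])
    show "verts G \<noteq> {}" using connected by (simp add: connected_graph_def)
    show "(a, b) \<in> conn ?R {}" if "a \<in> verts G" "b \<in> verts G" "\<phi> a = \<phi> b" for a b
    proof (cases "a = b")
      case False
      then have "(a, b) \<in> ?R"
        using that linked_all by (auto simp: wired_rel_def \<phi>_def split: if_splits)
      then show ?thesis by (rule conn_rel)
    qed simp
    \<comment> \<open>Edges that do not touch \<open>?W\<close> are dropped in the wired graph, but
      \<open>?R\<close> identifies their ends, so connections survive.\<close>
    have "linked (edges G) \<subseteq> conn ?R (touching ?W (edges G))"
    proof (rule conn_least)
      show "\<forall>e\<in>edges G. en e \<in> conn ?R (touching ?W (edges G))"
      proof
        fix e assume e: "e \<in> edges G"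
        show "en e \<in> conn ?R (touching ?W (edges G))"
        proof (cases "e \<in> touching ?W (edges G)")
          case False
          then have "en e \<in> ?R"
            using e conn_edge[OF e, of "{}"]
            by (cases "en e") (auto simp: wired_rel_def touching_def)
          then show ?thesis using conn_rel by (metis surj_pair)
        qed (rule conn_edge)
      qed
    qed simp
    then show "(a, b) \<in> conn ?R (edges (wired_graph G H))" if "a \<in> verts G" "b \<in> verts G" for a b
      using linked_all[OF that] Q(2) by auto
  qed (use ends_in endpoints_eq in \<open>auto simp: Q touching_def wired_rel_def \<phi>_def\<close>)
  then show ?thesis using Q by simp
qed

lemma spanning_trees_subgraph:
  assumes "subgraph H G" "connected_graph H"
  shows "spanning_trees H = bases {} (edges H)"
proof -
  have H: "endpoints H = endpoints G" "edges H \<subseteq> edges G" "verts H \<subseteq> verts G"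
    using assms(1) by (auto simp: subgraph_def)
  have ep: "endpoints H e = {id (fst (en e)), id (snd (en e))}" if "e \<in> edges H" for e
    using that H endpoints_eq by auto
  have ends: "fst (en e) \<in> verts H \<and> snd (en e) \<in> verts H" if "e \<in> edges H" for e
  proof -
    have "endpoints H e \<subseteq> verts H" using assms(1) that unfolding subgraph_def wf_graph_def by blast
    then show ?thesis using ep[OF that] by simp
  qed
  show ?thesis
  proof (rule spanning_trees_eq_bases[where V = "verts H" and \<phi> = id])
    show "verts H \<noteq> {}" using assms(2) by (simp add: connected_graph_def)
    fix a b assume ab: "a \<in> verts H" "b \<in> verts H"
    then have 1: "(id a, id b) \<in> (adjacency (H\<lparr>edges := edges H\<rparr>))\<^sup>*"
      using assms(2) by (simp add: connected_graph_def)
    have "(id a, id b) \<in> (adjacency (H\<lparr>edges := edges H\<rparr>))\<^sup>* \<longleftrightarrow> (a, b) \<in> conn {} (edges H)"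
      by (rule adjacency_conn[where V = "verts H"]) (use ep ends ab in auto)
    then show "(a, b) \<in> conn {} (edges H)" using 1 by blast
  qed (use ep ends in auto)
qed

lemma weak_limit_tendsto:
  assumes "weak_limit_on_finite G p M" "finite D" "D \<subseteq> edges G" "space M = Pow (edges G)"
  shows "(\<lambda>n. measure_pmf.prob (p n) {T. T \<inter> D = D}) \<longlonglongrightarrow> measure M (superset_event G D)"
proof -
  have "{F\<in>space M. F \<inter> D = D} = superset_event G D" using assms(4) by auto
  moreover have "(\<lambda>n. measure_pmf.prob (p n) {T. T \<inter> D = D}) \<longlonglongrightarrow> measure M {F\<in>space M. F \<inter> D = D}"
    using assms(1-3) unfolding weak_limit_on_finite_def by blast
  ultimately show ?thesis by simp
qed

lemma weak_limit_unique:
  assumes "weak_limit_on_finite G p M" "weak_limit_on_finite G p N"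
    and "prob_space M" "sets M = sets (subgraph_space G)"
    and "prob_space N" "sets N = sets (subgraph_space G)"
  shows "M = N"
proof (rule measure_eqI_superset_events[OF assms(3-6)])
  have sp: "space M = Pow (edges G)" "space N = Pow (edges G)"
    using sets_eq_imp_space_eq[OF assms(4)] sets_eq_imp_space_eq[OF assms(6)] by simp_all
  fix D assume D: "finite D" "D \<subseteq> edges G"
  show "measure M (superset_event G D) = measure N (superset_event G D)"
    by (rule LIMSEQ_unique[OF weak_limit_tendsto[OF assms(1) D sp(1)] weak_limit_tendsto[OF assms(2) D sp(2)]])
qed

lemma weak_limit_of_law:
  assumes "law_limit G F (\<lambda>i. Ex (R i) (E i)) M" "filterlim f F sequentially"
    and p: "\<And>n. finite (E (f n))" "\<And>n. p n = pmf_of_set (bases (R (f n)) (E (f n)))"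
  shows "weak_limit_on_finite G p M"
  unfolding weak_limit_on_finite_def
proof (intro allI impI)
  fix K A assume K: "finite K" "K \<subseteq> edges G"
  have "sets M = sets (subgraph_space G)" using assms(1) by (simp add: law_limit_def)
  then have "((\<lambda>i. Ex (R i) (E i) (\<lambda>T. of_bool (T \<inter> K = A))) \<longlongrightarrow> measure M {F \<in> space M. F \<inter> K = A}) F"
    using law_limit_tendsto[OF assms(1) K local_on_trace[of K A]] integral_trace[of M G K A] K by simp
  from filterlim_compose[OF this assms(2)]
  show "(\<lambda>n. measure_pmf.prob (p n) {T. T \<inter> K = A}) \<longlonglongrightarrow> measure M {F \<in> space M. F \<inter> K = A}"
    using p by (simp add: prob_uniform_basis)
qed

lemma verts_nonempty: "\<exists>r. r \<in> verts G"
  using connected by (auto simp: connected_graph_def)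

text \<open>The limit over finite vertex sets meets the defining condition along every exhaustion,
  and the exhaustion by balls leaves no other candidate. This resolves the definite
  description.\<close>

theorem WSF_law: "wired_law (linked (edges G)) (WSF G)"
proof -
  obtain M where M: "wired_law (linked (edges G)) M" by (rule wired_law_exists)
  have M': "prob_space M" "sets M = sets (subgraph_space G)"
    using M unfolding wired_law_def by (rule law_limit_prob, rule law_limit_sets)
  have lim: "weak_limit_on_finite G (\<lambda>n. UST (wired_graph G (Gs n))) M"
    if Gs: "induced_exhaustion G Gs" for Gs
  proof (rule weak_limit_of_law)
    show "law_limit G (finite_subsets_at_top (verts G))
      (\<lambda>W. Ex (wired_rel (linked (edges G)) W) (touching W (edges G))) M"
      using M by (simp add: wired_law_def Ex_wired_def[abs_def])
    have ex: "exhaustion G Gs" using Gs by (simp add: induced_exhaustion_def)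
    then show "filterlim (\<lambda>n. verts (Gs n)) (finite_subsets_at_top (verts G)) sequentially"
      by (rule exhaustion_filterlims)
    fix n
    have V: "finite (verts (Gs n))" "verts (Gs n) \<subseteq> verts G"
      using ex by (auto simp: exhaustion_def finite_graph_def subgraph_def)
    show "finite (touching (verts (Gs n)) (edges G))" by (rule finite_touching[OF V])
    show "UST (wired_graph G (Gs n)) = pmf_of_set
      (bases (wired_rel (linked (edges G)) (verts (Gs n))) (touching (verts (Gs n)) (edges G)))"
      by (simp add: UST_def spanning_trees_wired[OF V(2)])
  qed
  have "WSF G = M"
    unfolding WSF_def
  proof (rule the_equality)
    fix N assume N: "prob_space N \<and> sets N = sets (subgraph_space G) \<and>
      (\<forall>Gs. induced_exhaustion G Gs \<longrightarrow> weak_limit_on_finite G (\<lambda>n. UST (wired_graph G (Gs n))) N)"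
    obtain r where "r \<in> verts G" using verts_nonempty by blast
    then have "induced_exhaustion G (\<lambda>n. induced_subgraph G (spread r n))" by (rule spread_exhaustion)
    then show "N = M" using N lim M' weak_limit_unique by blast
  qed (use M' lim in blast)
  then show ?thesis using M by simp
qed

theorem FSF_law: "free_law (linked (edges G)) (FSF G)"
proof -
  obtain M where M: "free_law (linked (edges G)) M" by (rule free_law_exists)
  have M': "prob_space M" "sets M = sets (subgraph_space G)"
    using M unfolding free_law_def by (rule law_limit_prob, rule law_limit_sets)
  have lim: "weak_limit_on_finite G (\<lambda>n. UST (Gs n)) M" if Gs: "exhaustion G Gs" for Gs
  proof (rule weak_limit_of_law)
    show "law_limit G (finite_subsets_at_top (edges G)) (\<lambda>E. Ex {} E) M"
      using M by (simp add: free_law_def)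
    show "filterlim (\<lambda>n. edges (Gs n)) (finite_subsets_at_top (edges G)) sequentially"
      by (rule exhaustion_filterlims[OF Gs])
    fix n
    show "finite (edges (Gs n))" using Gs by (simp add: exhaustion_def finite_graph_def)
    show "UST (Gs n) = pmf_of_set (bases {} (edges (Gs n)))"
      using Gs spanning_trees_subgraph[of "Gs n"] by (simp add: UST_def exhaustion_def)
  qed
  have "FSF G = M"
    unfolding FSF_def
  proof (rule the_equality)
    fix N assume N: "prob_space N \<and> sets N = sets (subgraph_space G) \<and>
      (\<forall>Gs. exhaustion G Gs \<longrightarrow> weak_limit_on_finite G (\<lambda>n. UST (Gs n)) N)"
    obtain r where "r \<in> verts G" using verts_nonempty by blast
    then have "exhaustion G (\<lambda>n. induced_subgraph G (spread r n))"
      using spread_exhaustion by (simp add: induced_exhaustion_def)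
    then show "N = M" using N lim M' weak_limit_unique by blast
  qed (use M' lim in blast)
  then show ?thesis using M by simp
qed

end

section \<open>Sampling on components\<close>

context edge_ends
begin

lemma conn_separated:
  assumes "(u, v) \<in> conn R (T1 \<union> T2)" "u \<in> S"
    and R: "\<And>a b. (a, b) \<in> R \<Longrightarrow> a \<in> S \<longleftrightarrow> b \<in> S"
    and T1: "\<And>e. e \<in> T1 \<Longrightarrow> fst (en e) \<in> S \<and> snd (en e) \<in> S"
    and T2: "\<And>e. e \<in> T2 \<Longrightarrow> fst (en e) \<notin> S \<and> snd (en e) \<notin> S"
  shows "v \<in> S \<and> (u, v) \<in> conn R T1"
  using assms(1)
proof (induction rule: conn_induct)
  case refl
  then show ?case using assms(2) by simp
next
  case (rel a b)
  then have "(a, b) \<in> conn R T1" by (rule conn_rel)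
  then show ?case using R[OF rel] conn_trans conn_sym by meson
next
  case (edge e a b)
  show ?case
  proof (cases "e \<in> T1")
    case True
    then have "(a, b) \<in> conn R T1" using conn_edge[OF True, of R] edge by simp
    then show ?thesis using T1[OF True] edge(2) conn_trans conn_sym by (metis fst_conv snd_conv)
  next
    case False
    then show ?thesis using T2[of e] edge by auto
  qed
qed

text \<open>Neither identifications nor edges cross between \<open>S\<close> and its complement, so
  paths stay on their side.\<close>

lemma bases_disjoint:
  assumes R: "\<And>a b. (a, b) \<in> R \<Longrightarrow> a \<in> S \<longleftrightarrow> b \<in> S"
    and E1: "\<And>e. e \<in> E1 \<Longrightarrow> fst (en e) \<in> S \<and> snd (en e) \<in> S"
    and E2: "\<And>e. e \<in> E2 \<Longrightarrow> fst (en e) \<notin> S \<and> snd (en e) \<notin> S"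
    and T: "T1 \<subseteq> E1" "T2 \<subseteq> E2"
  shows "basis R (E1 \<union> E2) (T1 \<union> T2) \<longleftrightarrow> basis R E1 T1 \<and> basis R E2 T2"
proof -
  have disj: "E1 \<inter> E2 = {}" using E1 E2 by blast
  have 1: "en e \<in> conn R (U1 \<union> U2) \<longleftrightarrow> en e \<in> conn R U1"
    if "e \<in> E1" "U1 \<subseteq> E1" "U2 \<subseteq> E2" for e U1 U2
  proof
    assume "en e \<in> conn R (U1 \<union> U2)"
    then have "(fst (en e), snd (en e)) \<in> conn R (U1 \<union> U2)" by simp
    then have "(fst (en e), snd (en e)) \<in> conn R U1"
      using conn_separated[of _ _ R U1 U2 S] R E1 E2 that by blast
    then show "en e \<in> conn R U1" by simp
  qed (use conn_mono[of R R U1 "U1 \<union> U2"] in blast)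
  have 2: "en e \<in> conn R (U1 \<union> U2) \<longleftrightarrow> en e \<in> conn R U2"
    if "e \<in> E2" "U1 \<subseteq> E1" "U2 \<subseteq> E2" for e U1 U2
  proof
    assume "en e \<in> conn R (U1 \<union> U2)"
    then have "(fst (en e), snd (en e)) \<in> conn R (U2 \<union> U1)" by (simp add: Un_commute)
    then have "(fst (en e), snd (en e)) \<in> conn R U2"
      using conn_separated[of _ _ R U2 U1 "- S"] R E1 E2 that by blast
    then show "en e \<in> conn R U2" by simp
  qed (use conn_mono[of R R U2 "U1 \<union> U2"] in blast)
  have "indep R (T1 \<union> T2) \<longleftrightarrow> indep R T1 \<and> indep R T2"
  proof -
    have "en e \<in> conn R (T1 \<union> T2 - {e}) \<longleftrightarrow> en e \<in> conn R (T1 - {e})" if "e \<in> T1" for e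
    proof -
      have "T1 \<union> T2 - {e} = (T1 - {e}) \<union> T2" using that T disj by blast
      then show ?thesis using 1[of e "T1 - {e}" T2] that T by auto
    qed
    moreover have "en e \<in> conn R (T1 \<union> T2 - {e}) \<longleftrightarrow> en e \<in> conn R (T2 - {e})" if "e \<in> T2" for e
    proof -
      have "T1 \<union> T2 - {e} = T1 \<union> (T2 - {e})" using that T disj by blast
      then show ?thesis using 2[of e T1 "T2 - {e}"] that T by auto
    qed
    ultimately show ?thesis unfolding indep_def by blast
  qed
  then show ?thesis unfolding basis_def using 1[OF _ T] 2[OF _ T] T by blast
qed

text \<open>Bases of the union form a product set, so the two parts of a uniform basis are
  independent. This is the finite form of sampling independently on components.\<close>

lemma Ex_disjoint:
  assumes R: "\<And>a b. (a, b) \<in> R \<Longrightarrow> a \<in> S \<longleftrightarrow> b \<in> S"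
    and E1: "\<And>e. e \<in> E1 \<Longrightarrow> fst (en e) \<in> S \<and> snd (en e) \<in> S"
    and E2: "\<And>e. e \<in> E2 \<Longrightarrow> fst (en e) \<notin> S \<and> snd (en e) \<notin> S"
  shows "Ex R (E1 \<union> E2) (\<lambda>T. f (T \<inter> E1) * g (T \<inter> E2)) = Ex R E1 f * Ex R E2 g"
proof -
  have disj: "E1 \<inter> E2 = {}" using E1 E2 by blast
  note bd = bases_disjoint[of R S E1 E2, OF R E1 E2]
  have bij: "bij_betw (\<lambda>T. (T \<inter> E1, T \<inter> E2)) (bases R (E1 \<union> E2)) (bases R E1 \<times> bases R E2)"
  proof (rule bij_betwI[where g = "\<lambda>(T1, T2). T1 \<union> T2"])
    show "(\<lambda>T. (T \<inter> E1, T \<inter> E2)) \<in> bases R (E1 \<union> E2) \<rightarrow> bases R E1 \<times> bases R E2"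
    proof
      fix T assume T: "T \<in> bases R (E1 \<union> E2)"
      then have "T = (T \<inter> E1) \<union> (T \<inter> E2)" using bases_subset by blast
      then show "(T \<inter> E1, T \<inter> E2) \<in> bases R E1 \<times> bases R E2"
        using T bd[of "T \<inter> E1" "T \<inter> E2"] unfolding bases_def by auto
    qed
    show "(\<lambda>(T1, T2). T1 \<union> T2) \<in> bases R E1 \<times> bases R E2 \<rightarrow> bases R (E1 \<union> E2)"
      using bd basis_subset unfolding bases_def by auto
    show "(case (T \<inter> E1, T \<inter> E2) of (T1, T2) \<Rightarrow> T1 \<union> T2) = T" if "T \<in> bases R (E1 \<union> E2)" for T
      using bases_subset[OF that] by auto
    show "(\<lambda>T. (T \<inter> E1, T \<inter> E2)) (case p of (T1, T2) \<Rightarrow> T1 \<union> T2) = p"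
      if "p \<in> bases R E1 \<times> bases R E2" for p
      using that disj by (auto dest!: bases_subset)
  qed
  have "(\<Sum>T\<in>bases R (E1 \<union> E2). f (T \<inter> E1) * g (T \<inter> E2))
    = (\<Sum>p\<in>bases R E1 \<times> bases R E2. f (fst p) * g (snd p))"
    using sum.reindex_bij_betw[OF bij, of "\<lambda>p. f (fst p) * g (snd p)"] by simp
  also have "\<dots> = (\<Sum>T\<in>bases R E1. f T) * (\<Sum>T\<in>bases R E2. g T)"
    by (simp add: sum_product sum.cartesian_product split_beta)
  finally show ?thesis
    using bij_betw_same_card[OF bij] by (simp add: Ex_def card_cartesian_product)
qed

lemma conn_transfer:
  assumes "(u, v) \<in> conn R T" "u \<in> S"
    and R: "\<And>a b. (a, b) \<in> R \<Longrightarrow> a \<in> S \<longleftrightarrow> b \<in> S"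
    and RR': "\<And>a b. a \<in> S \<Longrightarrow> b \<in> S \<Longrightarrow> a \<noteq> b \<Longrightarrow> (a, b) \<in> R \<Longrightarrow> (a, b) \<in> R'"
    and T: "\<And>e. e \<in> T \<Longrightarrow> fst (en e) \<in> S \<and> snd (en e) \<in> S"
  shows "v \<in> S \<and> (u, v) \<in> conn R' T"
  using assms(1)
proof (induction rule: conn_induct)
  case refl
  then show ?case using assms(2) by simp
next
  case (rel a b)
  show ?case
  proof (cases "a \<in> S")
    case True
    then have "(a, b) \<in> conn R' T"
      using R[OF rel] RR'[OF _ _ _ rel] conn_rel[of a b R' T] by (cases "a = b") auto
    then show ?thesis using R[OF rel] conn_trans conn_sym by meson
  next
    case False
    then show ?thesis using R[OF rel] by blast
  qed
next
  case (edge e a b)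
  have "(a, b) \<in> conn R' T" using conn_edge[OF edge(1), of R'] edge by simp
  moreover have "a \<in> S" "b \<in> S" using T[OF edge(1)] edge(2) by auto
  ultimately show ?case using conn_trans conn_sym by meson
qed

text \<open>Serves to replace the connections of a component, taken as a graph of its own, by those
  of the whole forest. Diagonal pairs may differ since \<open>conn\<close> is reflexive.\<close>

lemma bases_rel_cong:
  assumes R: "\<And>a b. (a, b) \<in> R \<Longrightarrow> a \<in> S \<longleftrightarrow> b \<in> S"
    and R': "\<And>a b. (a, b) \<in> R' \<Longrightarrow> a \<in> S \<longleftrightarrow> b \<in> S"
    and RR': "\<And>a b. a \<in> S \<Longrightarrow> b \<in> S \<Longrightarrow> a \<noteq> b \<Longrightarrow> (a, b) \<in> R \<longleftrightarrow> (a, b) \<in> R'"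
    and E: "\<And>e. e \<in> E \<Longrightarrow> fst (en e) \<in> S \<and> snd (en e) \<in> S"
  shows "bases R E = bases R' E"
proof -
  have eq: "en e \<in> conn R T \<longleftrightarrow> en e \<in> conn R' T" if "T \<subseteq> E" "e \<in> E" for T e
  proof
    note T = E[OF subsetD[OF that(1)]]
    have e: "fst (en e) \<in> S" using E[OF that(2)] by simp
    {
      assume "en e \<in> conn R T"
      then have "(fst (en e), snd (en e)) \<in> conn R T" by simp
      from conn_transfer[OF this e R iffD1[OF RR'] T]
      show "en e \<in> conn R' T" by simp
    next
      assume "en e \<in> conn R' T"
      then have "(fst (en e), snd (en e)) \<in> conn R' T" by simp
      from conn_transfer[OF this e R' iffD2[OF RR'] T]
      show "en e \<in> conn R T" by simp
    }
  qed
  have "basis R E T \<longleftrightarrow> basis R' E T" for T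
  proof (cases "T \<subseteq> E")
    case True
    then have "en e \<in> conn R (T - {e}) \<longleftrightarrow> en e \<in> conn R' (T - {e})" if "e \<in> T" for e
      using eq[of "T - {e}" e] that by auto
    then show ?thesis unfolding basis_def indep_def using eq[OF True] by simp
  qed (simp add: basis_def)
  then show ?thesis by (simp add: bases_def)
qed

end

text \<open>The family is extended by one-point spaces outside \<open>I\<close>, so that every index
  carries a probability measure.\<close>

lemma emeasure_PiM_Collect:
  assumes prob: "\<And>i. i \<in> I \<Longrightarrow> prob_space (M i)"
    and J: "J \<subseteq> I" "finite J" "\<And>i. i \<in> J \<Longrightarrow> X i \<in> sets (M i)"
  shows "emeasure (PiM I M) {x\<in>space (PiM I M). \<forall>i\<in>J. x i \<in> X i} = (\<Prod>i\<in>J. emeasure (M i) (X i))"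
proof -
  let ?M = "\<lambda>i. if i \<in> I then M i else count_space {undefined}"
  interpret M': prob_space "?M i" for i
    using prob by (cases "i \<in> I") (auto intro!: prob_spaceI)
  interpret product_prob_space ?M I
    by unfold_locales
  have eq: "PiM I ?M = PiM I M" by (intro PiM_cong) auto
  have "emeasure (PiM I ?M) {x\<in>space (PiM I ?M). \<forall>i\<in>J. x i \<in> X i} = (\<Prod>i\<in>J. emeasure (?M i) (X i))"
    by (rule emeasure_PiM_Collect) (use J in auto)
  also have "\<dots> = (\<Prod>i\<in>J. emeasure (M i) (X i))"
    using J(1) by (intro prod.cong) auto
  finally show ?thesis unfolding eq .
qed

lemma filterlim_Int_finite_subsets:
  assumes "B \<subseteq> A"
  shows "filterlim (\<lambda>X. X \<inter> B) (finite_subsets_at_top B) (finite_subsets_at_top A)"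
  unfolding filterlim_finite_subsets_at_top
proof (intro allI impI, elim conjE)
  fix X assume "finite X" "X \<subseteq> B"
  then show "\<forall>\<^sub>F Y in finite_subsets_at_top A. finite (Y \<inter> B) \<and> X \<subseteq> Y \<inter> B \<and> Y \<inter> B \<subseteq> B"
    using assms unfolding eventually_finite_subsets_at_top by (intro exI[of _ X]) auto
qed

context lf_graph
begin

abbreviation comps :: "'e set \<Rightarrow> 'v set set" where
  "comps F \<equiv> graph_components (spanning_subgraph G F)"

abbreviation part :: "'e set \<Rightarrow> 'v set \<Rightarrow> ('v, 'e) multigraph" where
  "part F C \<equiv> induced_subgraph (spanning_subgraph G F) C"

lemma comps_eq:
  assumes "F \<subseteq> edges G"
  shows "comps F = (\<lambda>v. {u \<in> verts G. (v, u) \<in> linked F}) ` verts G"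
  unfolding graph_components_def using adjacency_linked[OF assms]
  by (intro image_cong) (auto simp: spanning_subgraph_def)

lemma comps_memD:
  assumes "F \<subseteq> edges G" "C \<in> comps F"
  shows "C \<subseteq> verts G" "C \<noteq> {}"
    and "\<And>u v. u \<in> C \<Longrightarrow> v \<in> verts G \<Longrightarrow> v \<in> C \<longleftrightarrow> (u, v) \<in> linked F"
proof -
  obtain r where r: "r \<in> verts G" "C = {u \<in> verts G. (r, u) \<in> linked F}"
    using assms comps_eq by auto
  show "C \<subseteq> verts G" "C \<noteq> {}" using r by auto
  show "v \<in> C \<longleftrightarrow> (u, v) \<in> linked F" if "u \<in> C" "v \<in> verts G" for u v
    using that r conn_trans conn_sym by blast
qed

lemma comps_cover:
  assumes "F \<subseteq> edges G" "v \<in> verts G"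
  shows "\<exists>C\<in>comps F. v \<in> C"
  using assms(2) unfolding comps_eq[OF assms(1)] by (intro bexI[of _ "{u \<in> verts G. (v, u) \<in> linked F}"]) auto

lemma comps_linked_iff:
  assumes "F \<subseteq> edges G" "C \<in> comps F" "(u, v) \<in> linked F"
  shows "u \<in> C \<longleftrightarrow> v \<in> C"
proof -
  have dir: "b \<in> C" if "a \<in> C" "(a, b) \<in> linked F" for a b
  proof -
    have "a \<in> verts G" using that(1) comps_memD(1)[OF assms(1,2)] by blast
    then have "b \<in> verts G" using linked_verts[OF that(2) assms(1)] by blast
    then show ?thesis using comps_memD(3)[OF assms(1,2) that(1)] that(2) by blast
  qed
  then show ?thesis using assms(3) conn_sym[OF assms(3)] by blast
qed

lemma comps_unique:
  assumes "F \<subseteq> edges G" "C \<in> comps F" "C' \<in> comps F" "v \<in> C" "v \<in> C'"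
  shows "C = C'"
proof -
  have "u \<in> C \<longleftrightarrow> u \<in> C'" if "u \<in> verts G" for u
    using comps_memD(3)[OF assms(1,2,4) that] comps_memD(3)[OF assms(1,3,5) that] by simp
  then show ?thesis using comps_memD(1)[OF assms(1,2)] comps_memD(1)[OF assms(1,3)] by blast
qed

lemma part_simps:
  assumes "F \<subseteq> edges G"
  shows "verts (part F C) = C" "endpoints (part F C) = endpoints G"
    "edges (part F C) = {e\<in>F. fst (en e) \<in> C \<and> snd (en e) \<in> C}"
  using endpoints_eq assms by (auto simp: induced_subgraph_def spanning_subgraph_def)

lemma edges_comps:
  assumes "F \<subseteq> edges G"
  shows "F = (\<Union>C\<in>comps F. edges (part F C))"
proof (intro equalityI subsetI)
  fix e assume e: "e \<in> F"
  then have e': "(fst (en e), snd (en e)) \<in> linked F" using conn_edge[OF e, of "{}"] by simp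
  obtain C where C: "C \<in> comps F" "fst (en e) \<in> C"
    using comps_cover[OF assms] ends_in[of e] e assms by blast
  then have "snd (en e) \<in> C" using comps_linked_iff[OF assms _ e'] by blast
  then show "e \<in> (\<Union>C\<in>comps F. edges (part F C))" using C e by (auto simp: part_simps[OF assms])
qed (auto simp: part_simps[OF assms])

lemma part_edge_unique:
  assumes "F \<subseteq> edges G" "C \<in> comps F" "C' \<in> comps F" "e \<in> edges (part F C)" "e \<in> edges (part F C')"
  shows "C = C'"
  using comps_unique[OF assms(1-3), of "fst (en e)"] assms(4,5) by (simp add: part_simps[OF assms(1)])

lemma part_lf_graph:
  assumes "F \<subseteq> edges G" "C \<in> comps F"
  shows "lf_graph en (part F C)"
proof
  fix e assume "e \<in> edges (part F C)"
  then show "endpoints (part F C) e = {fst (en e), snd (en e)}"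
    "fst (en e) \<in> verts (part F C) \<and> snd (en e) \<in> verts (part F C)"
    using endpoints_eq assms(1) by (auto simp: part_simps[OF assms(1)])
next
  have "finite {e \<in> edges (part F C). v \<in> endpoints (part F C) e}" if "v \<in> verts (part F C)" for v
  proof (rule finite_subset)
    show "{e \<in> edges (part F C). v \<in> endpoints (part F C) e} \<subseteq> {e \<in> edges G. v \<in> endpoints G e}"
      using assms(1) by (auto simp: part_simps[OF assms(1)])
    have "v \<in> verts G" using that comps_memD(1)[OF assms] by (auto simp: part_simps[OF assms(1)])
    then show "finite {e \<in> edges G. v \<in> endpoints G e}"
      using locally_finite by (simp add: locally_finite_graph_def)
  qed
  then show "locally_finite_graph (part F C)" by (simp add: locally_finite_graph_def)
next
  let ?A = "(adjacency (part F C))\<^sup>*"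
  have sym: "(x, y) \<in> ?A \<Longrightarrow> (y, x) \<in> ?A" for x y
    by (rule sym_rtrancl[OF sym_adjacency, THEN symD])
  have "(u, v) \<in> ?A" if uv: "u \<in> C" "v \<in> C" for u v
  proof -
    have "(u, v) \<in> linked F" using comps_memD[OF assms] uv by blast
    then have "v \<in> C \<and> (u, v) \<in> ?A"
    proof (induction rule: conn_induct)
      case (edge e a b)
      have ab: "(a, b) \<in> linked F" using conn_edge[OF edge(1), of "{}"] edge(2) by simp
      have "(a, b) \<in> adjacency (part F C)" if "a \<in> C" "b \<in> C"
      proof -
        have "e \<in> edges (part F C)" "endpoints (part F C) e = {a, b}"
          using that edge assms(1) endpoints_eq[of e] by (auto simp: part_simps[OF assms(1)])
        then show ?thesis unfolding adjacency_def by blast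
      qed
      then have "a \<in> C \<Longrightarrow> b \<in> C \<Longrightarrow> (a, b) \<in> ?A \<and> (b, a) \<in> ?A" using sym by blast
      then show ?case using comps_linked_iff[OF assms ab] by (meson rtrancl_trans)
    qed (use uv in auto)
    then show ?thesis by simp
  qed
  then show "connected_graph (part F C)"
    using comps_memD(2)[OF assms] by (simp add: connected_graph_def part_simps[OF assms(1)])
qed

text \<open>Components are split off one at a time, each in the role of the set \<open>S\<close> of
  \<open>Ex_disjoint\<close>.\<close>

lemma Ex_component_product:
  assumes F: "F \<subseteq> edges G" and "finite J" "J \<subseteq> comps F"
    and R: "\<And>C a b. C \<in> comps F \<Longrightarrow> (a, b) \<in> R \<Longrightarrow> a \<in> C \<longleftrightarrow> b \<in> C"
    and D: "D \<subseteq> (\<Union>C\<in>J. E \<inter> edges (part F C))"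
  shows "Ex R (\<Union>C\<in>J. E \<inter> edges (part F C)) (\<lambda>T. of_bool (D \<subseteq> T)) =
    (\<Prod>C\<in>J. Ex R (E \<inter> edges (part F C)) (\<lambda>T. of_bool (D \<inter> edges (part F C) \<subseteq> T)))"
  using assms(2,3) D
proof (induction J arbitrary: D rule: finite_induct)
  case empty
  then have "bases R {} = {{}}" using bases_nonempty[of "{}" R] bases_subset[of _ R "{}"] by fastforce
  then show ?case using empty by (simp add: Ex_def)
next
  case (insert C J)
  let ?E = "\<lambda>C. E \<inter> edges (part F C)"
  let ?E2 = "\<Union>C\<in>J. ?E C"
  have C: "C \<in> comps F" "J \<subseteq> comps F" using insert.prems by auto
  have E1: "fst (en e) \<in> C \<and> snd (en e) \<in> C" if "e \<in> ?E C" for e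
    using that by (simp add: part_simps[OF F])
  have E2: "fst (en e) \<notin> C \<and> snd (en e) \<notin> C" if e: "e \<in> ?E2" for e
  proof -
    obtain C' where C': "C' \<in> J" "fst (en e) \<in> C'" "snd (en e) \<in> C'"
      using e by (auto simp: part_simps[OF F])
    then have "C' \<noteq> C" "C' \<in> comps F" using insert.hyps C by auto
    then show ?thesis using comps_unique[OF F C(1)] C' by blast
  qed
  have D_split: "(of_bool (D \<subseteq> T) :: real) =
    of_bool (D \<inter> edges (part F C) \<subseteq> T \<inter> ?E C) * of_bool (D \<inter> ?E2 \<subseteq> T \<inter> ?E2)" for T
  proof -
    have "D \<subseteq> T \<longleftrightarrow> D \<inter> edges (part F C) \<subseteq> T \<inter> ?E C \<and> D \<inter> ?E2 \<subseteq> T \<inter> ?E2"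
      using insert.prems(2) by blast
    then show ?thesis by (simp only: of_bool_conj)
  qed
  have "Ex R (?E C \<union> ?E2) (\<lambda>T. of_bool (D \<subseteq> T)) =
    Ex R (?E C) (\<lambda>T. of_bool (D \<inter> edges (part F C) \<subseteq> T)) * Ex R ?E2 (\<lambda>T. of_bool (D \<inter> ?E2 \<subseteq> T))"
    unfolding D_split by (rule Ex_disjoint[where S = C]) (use R[OF C(1)] E1 E2 in auto)
  also have "Ex R ?E2 (\<lambda>T. of_bool (D \<inter> ?E2 \<subseteq> T)) =
    (\<Prod>C\<in>J. Ex R (?E C) (\<lambda>T. of_bool (D \<inter> ?E2 \<inter> edges (part F C) \<subseteq> T)))"
    by (rule insert.IH) (use C in auto)
  also have "\<dots> = (\<Prod>C\<in>J. Ex R (?E C) (\<lambda>T. of_bool (D \<inter> edges (part F C) \<subseteq> T)))"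
  proof (rule prod.cong)
    fix C' assume C': "C' \<in> J"
    have "D \<inter> ?E2 \<inter> edges (part F C') = D \<inter> edges (part F C')"
    proof -
      have "e \<in> ?E2" if "e \<in> D" "e \<in> edges (part F C')" for e
        using that insert.prems C' by auto
      then show ?thesis by blast
    qed
    then show "Ex R (?E C') (\<lambda>T. of_bool (D \<inter> ?E2 \<inter> edges (part F C') \<subseteq> T)) =
      Ex R (?E C') (\<lambda>T. of_bool (D \<inter> edges (part F C') \<subseteq> T))" by simp
  qed simp
  finally show ?case using insert.hyps by simp
qed

text \<open>An edge lies in at most one component, so its presence in the union depends on a single
  coordinate.\<close>

lemma sample_measurable:
  assumes F: "F \<subseteq> edges G"
    and sets: "\<And>C. C \<in> comps F \<Longrightarrow> sets (\<Phi> (part F C)) = sets (subgraph_space (part F C))"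
  shows "(\<lambda>\<omega>. \<Union>C\<in>comps F. \<omega> C) \<in> measurable (PiM (comps F) (\<lambda>C. \<Phi> (part F C))) (subgraph_space G)"
  unfolding subgraph_space_def
proof (rule measurable_measure_of)
  let ?M = "PiM (comps F) (\<lambda>C. \<Phi> (part F C))"
  have sp: "space (\<Phi> (part F C)) = Pow (edges (part F C))" if "C \<in> comps F" for C
    using sets_eq_imp_space_eq[OF sets[OF that]] by simp
  have sub: "\<omega> C \<subseteq> edges (part F C)" if "\<omega> \<in> space ?M" "C \<in> comps F" for \<omega> C
    using that sp[OF that(2)] by (auto simp: space_PiM PiE_def Pi_def)
  have in_G: "(\<Union>C\<in>comps F. \<omega> C) \<subseteq> edges G" if "\<omega> \<in> space ?M" for \<omega>
    using sub[OF that] F edges_comps[OF F] by blast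
  then show "(\<lambda>\<omega>. \<Union>C\<in>comps F. \<omega> C) \<in> space ?M \<rightarrow> Pow (edges G)" by simp
  fix Y assume "Y \<in> (\<lambda>e. {F \<in> Pow (edges G). e \<in> F}) ` edges G"
  then obtain e where e: "e \<in> edges G" "Y = {F \<in> Pow (edges G). e \<in> F}" by auto
  show "(\<lambda>\<omega>. \<Union>C\<in>comps F. \<omega> C) -` Y \<inter> space ?M \<in> sets ?M"
  proof (cases "\<exists>C\<in>comps F. e \<in> edges (part F C)")
    case True
    then obtain C where C: "C \<in> comps F" "e \<in> edges (part F C)" by blast
    have "(\<lambda>\<omega>. \<Union>C\<in>comps F. \<omega> C) -` Y \<inter> space ?M = {\<omega>\<in>space ?M. \<omega> C \<in> superset_event (part F C) {e}}"
      using in_G sub part_edge_unique[OF F C(1) _ C(2)] C unfolding e by blast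
    also have "\<dots> \<in> sets ?M"
    proof (rule measurable_sets_Collect[where N = "\<Phi> (part F C)"])
      show "(\<lambda>\<omega>. \<omega> C) \<in> measurable ?M (\<Phi> (part F C))" by (rule measurable_component_singleton[OF C(1)])
      have "{x \<in> space (\<Phi> (part F C)). x \<in> superset_event (part F C) {e}} = superset_event (part F C) {e}"
        using sp[OF C(1)] by blast
      then show "{x \<in> space (\<Phi> (part F C)). x \<in> superset_event (part F C) {e}} \<in> sets (\<Phi> (part F C))"
        using superset_event_sets[of "{e}" "part F C"] C sets by simp
    qed
    finally show ?thesis .
  next
    case False
    then have "(\<lambda>\<omega>. \<Union>C\<in>comps F. \<omega> C) -` Y \<inter> space ?M = {}"
      using sub unfolding e by blast
    then show ?thesis by simp
  qed
qed auto

text \<open>The sample is a product over components by definition, the uniform basis because no path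
  leaves a component. As \<open>D\<close> meets only finitely many components, convergence of the
  factors suffices.\<close>

lemma sample_law:
  assumes F: "F \<subseteq> edges G"
    and prob: "\<And>C. C \<in> comps F \<Longrightarrow> prob_space (\<Phi> (part F C))"
    and sets: "\<And>C. C \<in> comps F \<Longrightarrow> sets (\<Phi> (part F C)) = sets (subgraph_space (part F C))"
    and ev: "\<forall>\<^sub>F i in \<F>. finite (E i) \<and> E i \<subseteq> F"
    and R: "\<And>i C a b. C \<in> comps F \<Longrightarrow> (a, b) \<in> R i \<Longrightarrow> a \<in> C \<longleftrightarrow> b \<in> C"
    and lim: "\<And>C D. C \<in> comps F \<Longrightarrow> finite D \<Longrightarrow> D \<subseteq> edges (part F C) \<Longrightarrow>
      ((\<lambda>i. Ex (R i) (E i \<inter> edges (part F C)) (\<lambda>T. of_bool (D \<subseteq> T)))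
        \<longlongrightarrow> measure (\<Phi> (part F C)) (superset_event (part F C) D)) \<F>"
    and ex: "\<And>D. finite D \<Longrightarrow> D \<subseteq> F \<Longrightarrow> \<forall>\<^sub>F i in \<F>. D \<subseteq> E i"
  shows "law_limit G \<F> (\<lambda>i. Ex (R i) (E i)) (sample_on_components \<Phi> G F)"
proof -
  let ?M = "PiM (comps F) (\<lambda>C. \<Phi> (part F C))"
  let ?U = "\<lambda>\<omega>. \<Union>C\<in>comps F. \<omega> C"
  let ?K = "sample_on_components \<Phi> G F"
  note meas = sample_measurable[where \<Phi> = \<Phi>, OF F sets]
  have K: "?K = distr ?M (subgraph_space G) ?U" by (simp add: sample_on_components_def Let_def)
  interpret M: prob_space ?M by (rule prob_space_PiM) (rule prob)
  have sp: "space (\<Phi> (part F C)) = Pow (edges (part F C))" if "C \<in> comps F" for C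
    using sets_eq_imp_space_eq[OF sets[OF that]] by simp
  have sub: "\<omega> C \<subseteq> edges (part F C)" if "\<omega> \<in> space ?M" "C \<in> comps F" for \<omega> C
    using that sp[OF that(2)] by (auto simp: space_PiM PiE_def Pi_def)
  show ?thesis
    unfolding law_limit_def
  proof (intro conjI allI impI)
    show "prob_space ?K" unfolding K by (rule M.prob_space_distr[OF meas])
    show "sets ?K = sets (subgraph_space G)" unfolding K by simp
    fix D assume D: "finite D" "D \<subseteq> edges G"
    have mD: "measure ?K (superset_event G D) = measure ?M {\<omega>\<in>space ?M. D \<subseteq> ?U \<omega>}"
    proof -
      have "?U -` superset_event G D \<inter> space ?M = {\<omega>\<in>space ?M. D \<subseteq> ?U \<omega>}"
        using measurable_space[OF meas] by auto
      then show ?thesis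
        unfolding K by (subst measure_distr[OF meas]) (use superset_event_sets[OF D] in auto)
    qed
    show "((\<lambda>i. Ex (R i) (E i) (\<lambda>T. of_bool (D \<subseteq> T))) \<longlongrightarrow> measure ?K (superset_event G D)) \<F>"
    proof (cases "D \<subseteq> F")
      case False
      then have "{\<omega>\<in>space ?M. D \<subseteq> ?U \<omega>} = {}"
        using sub edges_comps[OF F] by blast
      then have 0: "measure ?K (superset_event G D) = 0" using mD by (metis measure_empty)
      have "\<forall>\<^sub>F i in \<F>. Ex (R i) (E i) (\<lambda>T. of_bool (D \<subseteq> T)) = 0"
        using ev
      proof eventually_elim
        case (elim i)
        have "Ex (R i) (E i) (\<lambda>T. of_bool (D \<subseteq> T)) = Ex (R i) (E i) (\<lambda>T. 0)"
        proof (rule Ex_cong)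
          fix T assume "T \<in> bases (R i) (E i)"
          then have "T \<subseteq> F" using bases_subset elim by blast
          then have "\<not> D \<subseteq> T" using False by auto
          then show "of_bool (D \<subseteq> T) = (0::real)" by simp
        qed
        then show ?case using elim by (simp add: Ex_const)
      qed
      then show ?thesis unfolding 0 by (rule tendsto_eventually)
    next
      case True
      \<comment> \<open>The components met by \<open>X\<close>; for finite \<open>X\<close> there
        are finitely many, because an edge determines its component.\<close>
      define J where "J X = {C\<in>comps F. X \<inter> edges (part F C) \<noteq> {}}" for X
      have J_fin: "finite (J X)" if "finite X" for X
      proof (rule finite_subset)
        show "J X \<subseteq> (\<lambda>e. THE C. C \<in> comps F \<and> e \<in> edges (part F C)) ` X"
        proof
          fix C assume "C \<in> J X"
          then obtain e where e: "C \<in> comps F" "e \<in> X" "e \<in> edges (part F C)" unfolding J_def by blast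
          then have "(THE C. C \<in> comps F \<and> e \<in> edges (part F C)) = C"
            by (intro the_equality) (use part_edge_unique[OF F] in blast)+
          then show "C \<in> (\<lambda>e. THE C. C \<in> comps F \<and> e \<in> edges (part F C)) ` X" using e(2) by blast
        qed
      qed (use that in simp)
      let ?m = "\<lambda>C. measure (\<Phi> (part F C)) (superset_event (part F C) (D \<inter> edges (part F C)))"
      let ?x = "\<lambda>i C. Ex (R i) (E i \<inter> edges (part F C)) (\<lambda>T. of_bool (D \<inter> edges (part F C) \<subseteq> T))"
      have val: "measure ?K (superset_event G D) = (\<Prod>C\<in>J D. ?m C)"
      proof -
        have "{\<omega>\<in>space ?M. D \<subseteq> ?U \<omega>} =
          {\<omega>\<in>space ?M. \<forall>C\<in>J D. \<omega> C \<in> superset_event (part F C) (D \<inter> edges (part F C))}" (is "?A = ?B")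
        proof (intro equalityI subsetI)
          fix \<omega> assume \<omega>: "\<omega> \<in> ?A"
          have "D \<inter> edges (part F C) \<subseteq> \<omega> C" if "C \<in> comps F" for C
          proof
            fix e assume e: "e \<in> D \<inter> edges (part F C)"
            then obtain C' where C': "C' \<in> comps F" "e \<in> \<omega> C'" using \<omega> by blast
            then have "C' = C" using part_edge_unique[OF F C'(1) that] sub[of \<omega> C'] \<omega> e by blast
            then show "e \<in> \<omega> C" using C' by simp
          qed
          then show "\<omega> \<in> ?B" using \<omega> sub unfolding J_def by blast
        next
          fix \<omega> assume \<omega>: "\<omega> \<in> ?B"
          have "e \<in> ?U \<omega>" if eD: "e \<in> D" for e
          proof -
            have "e \<in> F" using eD True by blast
            then obtain C where C: "C \<in> comps F" "e \<in> edges (part F C)"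
              using edges_comps[OF F] by blast
            then have "C \<in> J D" using eD unfolding J_def by blast
            then have "e \<in> \<omega> C" using \<omega> eD C by blast
            then show ?thesis using C by blast
          qed
          then show "\<omega> \<in> ?A" using \<omega> by blast
        qed
        moreover have "emeasure ?M ?B = (\<Prod>C\<in>J D. emeasure (\<Phi> (part F C)) (superset_event (part F C) (D \<inter> edges (part F C))))"
        proof (rule emeasure_PiM_Collect)
          show "J D \<subseteq> comps F" "finite (J D)" using J_fin D by (auto simp: J_def)
          fix C assume "C \<in> J D"
          then show "superset_event (part F C) (D \<inter> edges (part F C)) \<in> sets (\<Phi> (part F C))"
            using superset_event_sets[of "D \<inter> edges (part F C)" "part F C"] sets D by (auto simp: J_def)
        qed (rule prob)
        moreover have "(\<Prod>C\<in>J D. emeasure (\<Phi> (part F C)) (superset_event (part F C) (D \<inter> edges (part F C))))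
          = ennreal (\<Prod>C\<in>J D. ?m C)"
        proof -
          have "emeasure (\<Phi> (part F C)) (superset_event (part F C) (D \<inter> edges (part F C))) = ennreal (?m C)"
            if "C \<in> J D" for C
          proof -
            interpret prob_space "\<Phi> (part F C)" using prob that by (simp add: J_def)
            show ?thesis by (rule emeasure_eq_measure)
          qed
          then show ?thesis by (simp add: prod_ennreal cong: prod.cong)
        qed
        ultimately show ?thesis
          unfolding mD by (simp add: measure_def prod_nonneg)
      qed
      have lim_prod: "((\<lambda>i. \<Prod>C\<in>J D. ?x i C) \<longlongrightarrow> (\<Prod>C\<in>J D. ?m C)) \<F>"
      proof (rule tendsto_prod)
        fix C assume "C \<in> J D"
        then show "((\<lambda>i. ?x i C) \<longlongrightarrow> ?m C) \<F>"
          using D(1) by (intro lim) (simp_all add: J_def)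
      qed
      have prod_eq: "\<forall>\<^sub>F i in \<F>. (\<Prod>C\<in>J D. ?x i C) = Ex (R i) (E i) (\<lambda>T. of_bool (D \<subseteq> T))"
        using ev ex[OF D(1) True]
      proof eventually_elim
        case (elim i)
        have E: "E i = (\<Union>C\<in>J (E i). E i \<inter> edges (part F C))"
          using elim(1) edges_comps[OF F] unfolding J_def by blast
        have "Ex (R i) (E i) (\<lambda>T. of_bool (D \<subseteq> T)) =
          Ex (R i) (\<Union>C\<in>J (E i). E i \<inter> edges (part F C)) (\<lambda>T. of_bool (D \<subseteq> T))"
          using E by simp
        also have "\<dots> = (\<Prod>C\<in>J (E i). ?x i C)"
        proof (rule Ex_component_product[OF F])
          show "D \<subseteq> (\<Union>C\<in>J (E i). E i \<inter> edges (part F C))" using elim(2) E by simp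
        qed (use J_fin elim R in \<open>auto simp: J_def\<close>)
        \<comment> \<open>A component that \<open>D\<close> misses contributes the probability of a
          sure event.\<close>
        also have "\<dots> = (\<Prod>C\<in>J D. ?x i C)"
        proof (rule prod.mono_neutral_right)
          show "J D \<subseteq> J (E i)" using elim(2) unfolding J_def by blast
          show "\<forall>C\<in>J (E i) - J D. ?x i C = 1"
          proof
            fix C assume "C \<in> J (E i) - J D"
            then have "D \<inter> edges (part F C) = {}" unfolding J_def by blast
            then show "?x i C = 1" using elim by (simp add: Ex_const)
          qed
        qed (use J_fin elim in simp)
        finally show ?case by simp
      qed
      show ?thesis unfolding val by (rule Lim_transform_eventually[OF lim_prod prod_eq])
    qed
  qed
qed

text \<open>Wiring class by class outside one window \<open>W\<close> of \<open>G\<close> restricts,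
  on each component \<open>C\<close>, to wiring \<open>C\<close> outside its own window
  \<open>W \<inter> C\<close>. So a single window serves all components.\<close>

theorem sample_WSF_law:
  assumes F: "F \<subseteq> edges G"
  shows "law_limit G (finite_subsets_at_top (verts G)) (Ex_wired F (linked F)) (sample_on_components WSF G F)"
proof -
  let ?P = "linked F"
  have part_law: "lf_graph.wired_law en (part F C) (linked (edges (part F C))) (WSF (part F C))"
    if "C \<in> comps F" for C
    by (rule lf_graph.WSF_law[OF part_lf_graph[OF F that]])
  have "law_limit G (finite_subsets_at_top (verts G))
    (\<lambda>W. Ex (wired_rel ?P W) (touching W F)) (sample_on_components WSF G F)"
  proof (rule sample_law[OF F])
    fix C assume C: "C \<in> comps F"
    interpret H: lf_graph en "part F C" by (rule part_lf_graph[OF F C])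
    show "prob_space (WSF (part F C))" "sets (WSF (part F C)) = sets (subgraph_space (part F C))"
      using part_law[OF C] unfolding H.wired_law_def by (rule law_limit_prob, rule law_limit_sets)
    show "a \<in> C \<longleftrightarrow> b \<in> C" if "(a, b) \<in> wired_rel ?P W" for a b W
      using that comps_linked_iff[OF F C] by (auto simp: wired_rel_def)
    fix D assume D: "finite D" "D \<subseteq> edges (part F C)"
    let ?Q = "linked (edges (part F C))"
    let ?g = "\<lambda>W. Ex_wired (edges (part F C)) ?Q W (\<lambda>T. of_bool (D \<subseteq> T))"
    have "(?g \<longlongrightarrow> measure (WSF (part F C)) (superset_event (part F C) D)) (finite_subsets_at_top C)"
      using part_law[OF C] D unfolding H.wired_law_def law_limit_def part_simps(1)[OF F] by blast
    then have "((\<lambda>W. ?g (W \<inter> C)) \<longlongrightarrow> measure (WSF (part F C)) (superset_event (part F C) D))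
      (finite_subsets_at_top (verts G))"
      by (rule filterlim_compose) (rule filterlim_Int_finite_subsets[OF comps_memD(1)[OF F C]])
    moreover have "?g (W \<inter> C) = Ex (wired_rel ?P W)
      (touching W F \<inter> edges (part F C)) (\<lambda>T. of_bool (D \<subseteq> T))" for W
    proof -
      have E: "touching (W \<inter> C) (edges_in ?Q (edges (part F C))) =
        touching W F \<inter> edges (part F C)"
        unfolding H.edges_in_linked by (auto simp: touching_def part_simps[OF F])
      have inC: "(a, b) \<in> ?P" "(a, b) \<in> ?Q" if "a \<in> C" "b \<in> C" for a b
        using that comps_memD[OF F C] H.linked_all[of a b] by (auto simp: part_simps[OF F])
      have Qcross: "a \<in> C \<longleftrightarrow> b \<in> C" if "(a, b) \<in> ?Q" for a b
        using H.linked_verts[OF that] H.linked_verts[OF conn_sym[OF that]] by (auto simp: part_simps[OF F])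
      have "bases (wired_rel ?Q (W \<inter> C)) (touching W F \<inter> edges (part F C)) =
        bases (wired_rel ?P W) (touching W F \<inter> edges (part F C))"
      proof (rule bases_rel_cong[where S = C])
        show "a \<in> C \<longleftrightarrow> b \<in> C" if "(a, b) \<in> wired_rel ?Q (W \<inter> C)" for a b
          using that Qcross by (auto simp: wired_rel_def)
        show "a \<in> C \<longleftrightarrow> b \<in> C" if "(a, b) \<in> wired_rel ?P W" for a b
          using that comps_linked_iff[OF F C] by (auto simp: wired_rel_def)
        show "(a, b) \<in> wired_rel ?Q (W \<inter> C) \<longleftrightarrow> (a, b) \<in> wired_rel ?P W" if "a \<in> C" "b \<in> C" for a b
          using that inC by (auto simp: wired_rel_def)
      qed (auto simp: part_simps[OF F])
      then show ?thesis unfolding Ex_wired_def E Ex_def by simp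
    qed
    ultimately show "((\<lambda>W. Ex (wired_rel ?P W) (touching W F \<inter> edges (part F C)) (\<lambda>T. of_bool (D \<subseteq> T)))
      \<longlongrightarrow> measure (WSF (part F C)) (superset_event (part F C) D)) (finite_subsets_at_top (verts G))"
      by simp
  next
    show "\<forall>\<^sub>F W in finite_subsets_at_top (verts G). finite (touching W F)
      \<and> touching W F \<subseteq> F"
      using finite_touching finite_subset[OF touching_mono[OF order_refl F]] touching_subset
      by (intro eventually_finite_subsets_at_top_weakI) blast
    fix D assume D: "finite D" "D \<subseteq> F"
    show "\<forall>\<^sub>F W in finite_subsets_at_top (verts G). D \<subseteq> touching W F"
      unfolding eventually_finite_subsets_at_top
      by (intro exI[of _ "(\<lambda>e. fst (en e)) ` D"])
        (use D ends_in F in \<open>auto simp: touching_def\<close>)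
  qed
  moreover have "edges_in ?P F = F" using conn_edge by (auto simp: edges_in_def)
  ultimately show ?thesis by (simp add: Ex_wired_def[abs_def])
qed

theorem sample_FSF_law:
  assumes F: "F \<subseteq> edges G"
  shows "law_limit G (finite_subsets_at_top F) (Ex {}) (sample_on_components FSF G F)"
proof -
  have part_law: "lf_graph.free_law en (part F C) (linked (edges (part F C))) (FSF (part F C))"
    if "C \<in> comps F" for C
    by (rule lf_graph.FSF_law[OF part_lf_graph[OF F that]])
  show ?thesis
  proof (rule sample_law[OF F])
    fix C assume C: "C \<in> comps F"
    interpret H: lf_graph en "part F C" by (rule part_lf_graph[OF F C])
    show "prob_space (FSF (part F C))" "sets (FSF (part F C)) = sets (subgraph_space (part F C))"
      using part_law[OF C] unfolding H.free_law_def by (rule law_limit_prob, rule law_limit_sets)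
    fix D assume D: "finite D" "D \<subseteq> edges (part F C)"
    have sub: "edges (part F C) \<subseteq> F" using edges_comps[OF F] C by blast
    have "((\<lambda>E. Ex {} E (\<lambda>T. of_bool (D \<subseteq> T))) \<longlongrightarrow> measure (FSF (part F C)) (superset_event (part F C) D))
      (finite_subsets_at_top (edges (part F C)))"
      using part_law[OF C] D unfolding H.free_law_def law_limit_def H.edges_in_linked by blast
    then show "((\<lambda>E. Ex {} (E \<inter> edges (part F C)) (\<lambda>T. of_bool (D \<subseteq> T)))
      \<longlongrightarrow> measure (FSF (part F C)) (superset_event (part F C) D)) (finite_subsets_at_top F)"
      by (rule filterlim_compose) (rule filterlim_Int_finite_subsets[OF sub])
  next
    show "\<forall>\<^sub>F E in finite_subsets_at_top F. finite E \<and> E \<subseteq> F"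
      by (intro eventually_finite_subsets_at_top_weakI) blast
    fix D assume D: "finite D" "D \<subseteq> F"
    then show "\<forall>\<^sub>F E in finite_subsets_at_top F. D \<subseteq> E"
      unfolding eventually_finite_subsets_at_top by (intro exI[of _ D]) auto
  qed auto
qed

end

section \<open>Resampling within components\<close>

context edge_ends
begin

text \<open>Consecutive steps through \<open>R\<close> merge by transitivity, and a merged step
  between two edges has both ends in \<open>U\<close>. Only a final step may leave \<open>U\<close>,
  starting from \<open>w\<close>.\<close>

lemma conn_restrict_rel:
  assumes "(u, v) \<in> conn R T" "u \<in> U" and "sym R" "trans R"
    and T: "\<And>e. e \<in> T \<Longrightarrow> fst (en e) \<in> U \<and> snd (en e) \<in> U"
  shows "\<exists>w\<in>U. (u, w) \<in> conn (R \<inter> U \<times> U) T \<and> (w = v \<or> (w, v) \<in> R)"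
  using assms(1)
proof (induction rule: conn_induct)
  case refl
  then show ?case using assms(2) by (intro bexI[of _ u]) simp_all
next
  case (rel a b)
  have "(b, a) \<in> R" using rel assms(3) by (meson symD)
  then have "w = a \<or> (w, a) \<in> R \<Longrightarrow> w = b \<or> (w, b) \<in> R"
    "w = b \<or> (w, b) \<in> R \<Longrightarrow> w = a \<or> (w, a) \<in> R" for w
    using rel transD[OF assms(4)] by blast+
  then show ?case by blast
next
  case (edge e a b)
  have ab: "a \<in> U" "b \<in> U" "(a, b) \<in> conn (R \<inter> U \<times> U) T"
    using T[OF edge(1)] edge conn_edge[OF edge(1), of "R \<inter> U \<times> U"] by auto
  have dir: "\<exists>w\<in>U. (u, w) \<in> conn (R \<inter> U \<times> U) T \<and> (w = y \<or> (w, y) \<in> R)"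
    if "w \<in> U" "(u, w) \<in> conn (R \<inter> U \<times> U) T" "w = x \<or> (w, x) \<in> R"
      "x \<in> U" "y \<in> U" "(x, y) \<in> conn (R \<inter> U \<times> U) T" for x y w
  proof -
    have "(w, x) \<in> conn (R \<inter> U \<times> U) T" using that by (auto intro: conn_rel)
    then have "(u, y) \<in> conn (R \<inter> U \<times> U) T" using that conn_trans by blast
    then show ?thesis using that(5) by blast
  qed
  show ?case
    using dir[of _ a b] dir[of _ b a] ab conn_sym[OF ab(3)] by (intro iffI; elim bexE conjE) simp_all
qed

lemma bases_restrict_rel:
  assumes "sym R" "trans R" and E: "\<And>e. e \<in> E \<Longrightarrow> fst (en e) \<in> U \<and> snd (en e) \<in> U"
  shows "bases (R \<inter> U \<times> U) E = bases R E"
proof -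
  have eq: "en e \<in> conn (R \<inter> U \<times> U) T \<longleftrightarrow> en e \<in> conn R T" if TE: "T \<subseteq> E" "e \<in> E" for T e
  proof
    assume "en e \<in> conn R T"
    then have "(fst (en e), snd (en e)) \<in> conn R T" by simp
    from conn_restrict_rel[OF this _ assms(1,2), of U]
    obtain w where w: "w \<in> U" "(fst (en e), w) \<in> conn (R \<inter> U \<times> U) T" "w = snd (en e) \<or> (w, snd (en e)) \<in> R"
      using E TE by (meson subsetD)
    then have "(w, snd (en e)) \<in> conn (R \<inter> U \<times> U) T"
      using E[OF TE(2)] by (auto intro: conn_rel)
    then have "(fst (en e), snd (en e)) \<in> conn (R \<inter> U \<times> U) T" using w conn_trans by blast
    then show "en e \<in> conn (R \<inter> U \<times> U) T" by simp
  qed (use conn_mono[of "R \<inter> U \<times> U" R T T] in blast)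
  have "basis (R \<inter> U \<times> U) E T \<longleftrightarrow> basis R E T" for T
  proof (cases "T \<subseteq> E")
    case True
    then have "en e \<in> conn (R \<inter> U \<times> U) (T - {e}) \<longleftrightarrow> en e \<in> conn R (T - {e})" if "e \<in> T" for e
      using eq[of "T - {e}" e] that by auto
    then show ?thesis unfolding basis_def indep_def using eq[OF True] by simp
  qed (simp add: basis_def)
  then show ?thesis by (simp add: bases_def)
qed

definition end_verts :: "'e set \<Rightarrow> 'v set" where
  "end_verts K = (\<lambda>e. fst (en e)) ` K \<union> (\<lambda>e. snd (en e)) ` K"

text \<open>The law in a finite window depends on finitely many data: the edges touching
  \<open>W\<close> and the connections among their ends. This yields measurability in
  \<open>F\<close>, and stability when connections are computed in a large finite set.\<close>

lemma Ex_wired_restrict: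
  assumes "touching W A = touching W A'" "sym P" "trans P" "sym P'" "trans P'"
    and "P \<inter> end_verts (touching W A) \<times> end_verts (touching W A) =
      P' \<inter> end_verts (touching W A) \<times> end_verts (touching W A)"
  shows "Ex_wired A P W = Ex_wired A' P' W"
proof -
  let ?U = "end_verts (touching W A)"
  have red: "Ex_wired B Q W = Ex (wired_rel Q W \<inter> ?U \<times> ?U) (edges_in Q (touching W A))"
    if "touching W B = touching W A" "sym Q" "trans Q" for B Q
  proof -
    have s: "sym (wired_rel Q W)" "trans (wired_rel Q W)"
      using that(2,3) unfolding wired_rel_def sym_def trans_def by blast+
    have E: "touching W (edges_in Q B) = edges_in Q (touching W A)"
      using that(1) unfolding touching_def edges_in_def by blast
    have "bases (wired_rel Q W \<inter> ?U \<times> ?U) (edges_in Q (touching W A)) = bases (wired_rel Q W) (edges_in Q (touching W A))"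
      by (rule bases_restrict_rel[OF s]) (auto simp: edges_in_def end_verts_def)
    then show ?thesis unfolding Ex_wired_def E Ex_def by (simp add: fun_eq_iff)
  qed
  have "wired_rel P W \<inter> ?U \<times> ?U = wired_rel P' W \<inter> ?U \<times> ?U"
    using assms(6) unfolding wired_rel_def by blast
  moreover have "edges_in P (touching W A) = edges_in P' (touching W A)"
  proof -
    have "en e \<in> ?U \<times> ?U" if "e \<in> touching W A" for e
      using that by (cases "en e") (force simp: end_verts_def)
    then show ?thesis using assms(6) unfolding edges_in_def by blast
  qed
  ultimately show ?thesis using red[OF _ assms(2,3), of A] red[OF assms(1)[symmetric] assms(4,5)] by simp
qed

lemma sym_conn: "sym (conn R F)" and trans_conn: "trans (conn R F)"
  by (auto intro!: symI transI dest: conn_sym conn_trans)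

text \<open>Exchanging the part of a basis inside K for another one making the same connections within L
  keeps the number of edges and the span, hence gives a basis again.\<close>

lemma resample_class:
  assumes "finite E" "K \<subseteq> L" "L \<subseteq> E" "T0 \<in> bases R E"
  defines "\<rho> \<equiv> conn {} (T0 \<inter> L)" and "Y \<equiv> T0 \<inter> L - K"
  shows "bij_betw (\<lambda>T. T \<inter> K) {T\<in>bases R E. T - K = T0 - K \<and> conn {} (T \<inter> L) = \<rho>}
    (bases (en ` Y) (edges_in \<rho> K))"
proof -
  let ?X = "T0 - K" and ?K' = "edges_in \<rho> K"
  let ?S = "{T\<in>bases R E. T - K = ?X \<and> conn {} (T \<inter> L) = \<rho>}"
  have contract: "conn (en ` Y) F = conn {} (Y \<union> F)" for F
    using conn_contract[of "{}" Y F] by simp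
  have fwd: "T \<inter> K \<in> bases (en ` Y) ?K'" if T: "T \<in> ?S" for T
  proof -
    \<comment> \<open>All members of the class share the edges \<open>Y\<close> of
      \<open>L - K\<close>. With these contracted, the connections of \<open>T\<close> within
      \<open>L\<close> are those made by \<open>T \<inter> K\<close>.\<close>
    have TL: "T \<inter> L = Y \<union> (T \<inter> K)" and YT: "Y \<subseteq> T - K" using T assms(2) unfolding Y_def by auto
    have Tb: "basis R E T" using T by (simp add: bases_def)
    have conn_T: "conn (en ` Y) (T \<inter> K) = \<rho>" using T TL contract by simp
    have "T \<inter> K \<subseteq> ?K'"
    proof
      fix e assume e: "e \<in> T \<inter> K"
      then have "en e \<in> conn (en ` Y) (T \<inter> K)" by (rule conn_edge)
      then show "e \<in> ?K'" using e conn_T by (simp add: edges_in_def)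
    qed
    moreover have "indep (en ` Y) (T \<inter> K)"
      unfolding indep_def
    proof
      fix e assume e: "e \<in> T \<inter> K"
      have "conn (en ` Y) (T \<inter> K - {e}) \<subseteq> conn R (T - {e})"
        unfolding contract using YT e by (intro conn_mono) auto
      then show "en e \<notin> conn (en ` Y) (T \<inter> K - {e})" using basis_indep[OF Tb, of e] e by blast
    qed
    moreover have "\<forall>e\<in>?K'. en e \<in> conn (en ` Y) (T \<inter> K)"
      unfolding conn_T by (simp add: edges_in_def)
    ultimately show ?thesis by (simp add: bases_def basis_def)
  qed
  have T0: "T0 \<in> ?S" "basis R E T0" using assms(4) by (auto simp: \<rho>_def bases_def)
  have K': "finite ?K'" using assms(1-3) edges_in_subset by (meson finite_subset subset_trans)
  have bwd: "?X \<union> t \<in> ?S \<and> (?X \<union> t) \<inter> K = t" if t: "t \<in> bases (en ` Y) ?K'" for t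
  proof -
    let ?T = "?X \<union> t"
    have tb: "basis (en ` Y) ?K' t" using t by (simp add: bases_def)
    have tK: "t \<subseteq> K" using basis_subset[OF tb] edges_in_subset by blast
    then have 1: "?T - K = ?X" "?T \<inter> K = t" "?T \<inter> L = Y \<union> t"
      using assms(2) unfolding Y_def by auto
    have "conn {} (?T \<inter> L) = conn {} (Y \<union> ?K')"
      unfolding 1 using basis_conn[OF tb] contract by simp
    also have "\<dots> = \<rho>"
    proof
      have "Y \<subseteq> T0 \<inter> L" unfolding Y_def by auto
      then show "conn {} (Y \<union> ?K') \<subseteq> \<rho>"
        unfolding \<rho>_def by (intro conn_least) (auto intro: conn_edge simp: edges_in_def)
      have "T0 \<inter> K \<subseteq> ?K'" using fwd[OF T0(1)] bases_subset by blast
      then show "\<rho> \<subseteq> conn {} (Y \<union> ?K')"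
        unfolding \<rho>_def Y_def by (intro conn_mono) auto
    qed
    finally have 2: "conn {} (?T \<inter> L) = \<rho>" .
    \<comment> \<open>Edges of \<open>T0\<close> in \<open>K\<close> are recovered from the
      connections \<open>\<rho>\<close>; all others are still present.\<close>
    have spans: "conn R T0 \<subseteq> conn R ?T"
    proof (rule conn_least)
      show "R \<subseteq> conn R ?T" by (auto intro: conn_rel)
      show "\<forall>e\<in>T0. en e \<in> conn R ?T"
      proof
        fix e assume e: "e \<in> T0"
        show "en e \<in> conn R ?T"
        proof (cases "e \<in> K")
          case True
          then have "en e \<in> conn {} (?T \<inter> L)"
            unfolding 2 \<rho>_def using e assms(2) by (intro conn_edge) auto
          then show ?thesis using conn_mono[of "{}" R "?T \<inter> L" ?T] by blast
        qed (use e in \<open>auto intro: conn_edge\<close>)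
      qed
    qed
    have fin: "finite T0" "finite t" using assms(1) basis_subset[OF T0(2)] basis_subset[OF tb] K' finite_subset by blast+
    have "card t = card (T0 \<inter> K)"
      using basis_card[OF K' tb] fwd[OF T0(1)] by (simp add: bases_def)
    moreover have "card ?T = card ?X + card t"
      using fin tK by (intro card_Un_disjoint) auto
    moreover have "card T0 = card ?X + card (T0 \<inter> K)"
      using fin by (subst card_Un_disjoint[symmetric]) (auto intro: arg_cong[of _ _ card])
    ultimately have card: "card ?T = card T0" by simp
    have "basis R E ?T"
      by (rule spanning_card_basis[OF assms(1) T0(2)])
        (use basis_subset[OF T0(2)] tK assms(2,3) spans basis_spans[OF T0(2)] card in auto)
    then show ?thesis using 1 2 by (simp add: bases_def)
  qed
  show ?thesis
    by (rule bij_betwI[where g = "\<lambda>t. ?X \<union> t"]) (use fwd bwd in auto)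
qed

text \<open>Condition on the edges outside \<open>touching W L\<close> and on the connections within
  \<open>L\<close>. The left integrand is constant on each class, while the true conditional law is
  a uniform basis with fewer identifications than full wiring.\<close>

lemma resample_le:
  assumes "finite E" "L \<subseteq> E" "increasing \<phi>" "local_on D \<phi>" "D \<subseteq> touching W L"
  shows "Ex R E (\<lambda>T. Ex_wired L (conn {} (T \<inter> L)) W \<phi>) \<le> Ex R E \<phi>"
proof -
  let ?K = "touching W L" and ?B = "bases R E"
  let ?h = "\<lambda>T. Ex_wired L (conn {} (T \<inter> L)) W \<phi>"
  \<comment> \<open>The information conditioned on; its fibres are the classes of
    \<open>resample_class\<close>.\<close>
  define key where "key T = (T - ?K, conn {} (T \<inter> L))" for T
  have KL: "?K \<subseteq> L" by (rule touching_subset)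
  have class_le: "(\<Sum>T\<in>{T\<in>?B. key T = key T0}. ?h T) \<le> (\<Sum>T\<in>{T\<in>?B. key T = key T0}. \<phi> T)"
    if T0: "T0 \<in> ?B" for T0
  proof -
    define \<rho> where "\<rho> = conn {} (T0 \<inter> L)"
    define Y where "Y = T0 \<inter> L - ?K"
    let ?S = "{T\<in>?B. key T = key T0}" and ?C = "bases (en ` Y) (edges_in \<rho> ?K)"
    have S: "?S = {T\<in>?B. T - ?K = T0 - ?K \<and> conn {} (T \<inter> L) = \<rho>}"
      by (auto simp: key_def \<rho>_def)
    have bij: "bij_betw (\<lambda>T. T \<inter> ?K) ?S ?C"
      unfolding S \<rho>_def Y_def by (rule resample_class[OF assms(1) KL assms(2) T0])
    have fin: "finite (edges_in \<rho> ?K)"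
      using assms(1,2) KL edges_in_subset by (meson finite_subset subset_trans)
    have "?h T = Ex (wired_rel \<rho> W) (edges_in \<rho> ?K) \<phi>" if "T \<in> ?S" for T
    proof -
      have "touching W (edges_in \<rho> L) = edges_in \<rho> ?K" by (auto simp: touching_def edges_in_def)
      then show ?thesis using that unfolding S Ex_wired_def by simp
    qed
    \<comment> \<open>An edge of \<open>Y\<close> does not touch \<open>W\<close> and is used by
      \<open>T0\<close> within \<open>L\<close>, so its ends lie outside \<open>W\<close> in one
      class: full wiring identifies them too.\<close>
    moreover have "Ex (wired_rel \<rho> W) (edges_in \<rho> ?K) \<phi> \<le> Ex (en ` Y) (edges_in \<rho> ?K) \<phi>"
    proof (rule Ex_identify_le[OF fin _ assms(3)])
      show "en ` Y \<subseteq> wired_rel \<rho> W"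
      proof
        fix p assume "p \<in> en ` Y"
        then obtain e where e: "e \<in> T0 \<inter> L" "e \<notin> ?K" "p = en e" unfolding Y_def by blast
        then have "en e \<in> \<rho>" unfolding \<rho>_def by (intro conn_edge) auto
        then show "p \<in> wired_rel \<rho> W" using e by (cases "en e") (auto simp: wired_rel_def touching_def)
      qed
    qed
    ultimately have "(\<Sum>T\<in>?S. ?h T) \<le> card ?S * Ex (en ` Y) (edges_in \<rho> ?K) \<phi>"
      by (simp add: mult_left_mono)
    also have "\<dots> = (\<Sum>t\<in>?C. \<phi> t)"
      using bij_betw_same_card[OF bij] card_bases_pos[OF fin, of "en ` Y"] by (simp add: Ex_def)
    also have "\<dots> = (\<Sum>T\<in>?S. \<phi> (T \<inter> ?K))"
      by (rule sum.reindex_bij_betw[OF bij, symmetric])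
    also have "\<dots> = (\<Sum>T\<in>?S. \<phi> T)"
      using local_onD[OF local_on_mono[OF assms(4,5)]] by simp
    finally show ?thesis .
  qed
  have fB: "finite ?B" using assms(1) by simp
  have "(\<Sum>T\<in>?B. ?h T) = (\<Sum>y\<in>key ` ?B. \<Sum>T\<in>{T\<in>?B. key T = y}. ?h T)"
    by (rule sum.image_gen[OF fB])
  also have "\<dots> \<le> (\<Sum>y\<in>key ` ?B. \<Sum>T\<in>{T\<in>?B. key T = y}. \<phi> T)"
  proof (rule sum_mono)
    fix y assume "y \<in> key ` ?B"
    then obtain T0 where "T0 \<in> ?B" "y = key T0" by blast
    then show "(\<Sum>T\<in>{T\<in>?B. key T = y}. ?h T) \<le> (\<Sum>T\<in>{T\<in>?B. key T = y}. \<phi> T)"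
      using class_le by simp
  qed
  also have "\<dots> = (\<Sum>T\<in>?B. \<phi> T)"
    by (rule sum.image_gen[OF fB, symmetric])
  finally show ?thesis unfolding Ex_def[of R] by (rule divide_right_mono) simp
qed

text \<open>Stochastic domination of \<open>M\<close> by \<open>N\<close>, tested on those
  increasing functions whose means converge under \<open>law_limit\<close>.\<close>

definition dominated :: "('w, 'e) multigraph \<Rightarrow> 'e set measure \<Rightarrow> 'e set measure \<Rightarrow> bool" where
  "dominated G M N \<longleftrightarrow> (\<forall>D \<phi>. finite D \<longrightarrow> D \<subseteq> edges G \<longrightarrow> increasing \<phi> \<longrightarrow> local_on D \<phi> \<longrightarrow>
    integral\<^sup>L M \<phi> \<le> integral\<^sup>L N \<phi>)"

lemma local_bounded:
  assumes "finite D" "local_on D \<phi>"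
  obtains B where "\<And>X. \<bar>\<phi> X\<bar> \<le> B"
proof
  fix X
  have "\<bar>\<phi> X\<bar> = \<bar>\<phi> (X \<inter> D)\<bar>" using local_onD[OF assms(2)] by metis
  also have "\<dots> \<le> Max ((\<lambda>Y. \<bar>\<phi> Y\<bar>) ` Pow D)" using assms(1) by (intro Max_ge) auto
  finally show "\<bar>\<phi> X\<bar> \<le> Max ((\<lambda>Y. \<bar>\<phi> Y\<bar>) ` Pow D)" .
qed

lemma Ex_abs_le:
  assumes "finite E" "\<And>X. \<bar>\<phi> X\<bar> \<le> B"
  shows "\<bar>Ex R E \<phi>\<bar> \<le> B"
proof -
  have "- B \<le> \<phi> T \<and> \<phi> T \<le> B" for T using assms(2)[of T] by linarith
  then show ?thesis using Ex_bounds[OF assms(1), of R "- B" \<phi> B] by (simp add: abs_le_iff)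
qed

end

context lf_graph
begin

abbreviation "S \<equiv> subgraph_space G"

section \<open>Measurability of connections and of the sampling kernels\<close>

lemma spread_touching:
  assumes r: "r \<in> verts G"
  shows "finite (touching (spread r n) (edges G))"
    and "(\<Union>n. touching (spread r n) (edges G)) = edges G"
    and "touching (spread r n) (edges G) \<subseteq> touching (spread r (Suc n)) (edges G)"
proof -
  show "finite (touching (spread r n) (edges G))"
    using spread_finite[OF r] by (intro finite_touching) auto
  show "(\<Union>n. touching (spread r n) (edges G)) = edges G"
  proof
    show "edges G \<subseteq> (\<Union>n. touching (spread r n) (edges G))"
    proof
      fix e assume e: "e \<in> edges G"
      then obtain n where "fst (en e) \<in> spread r n" using ends_in[OF e] spread_Union[OF r] by blast
      then show "e \<in> (\<Union>n. touching (spread r n) (edges G))" using e by (auto simp: touching_def)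
    qed
  qed (auto simp: touching_def)
  show "touching (spread r n) (edges G) \<subseteq> touching (spread r (Suc n)) (edges G)"
    by (intro touching_mono) auto
qed

lemma countable_verts: "countable (verts G)"
proof -
  obtain r where r: "r \<in> verts G" using verts_nonempty by blast
  have "countable (\<Union>n. spread r n)"
    using spread_finite[OF r] by (intro countable_UN) (auto intro: countable_finite)
  then show ?thesis using spread_Union[OF r] by simp
qed

lemma countable_edges: "countable (edges G)"
proof -
  obtain r where r: "r \<in> verts G" using verts_nonempty by blast
  have "countable (\<Union>n. touching (spread r n) (edges G))"
    using spread_touching(1)[OF r] by (intro countable_UN) (auto intro: countable_finite)
  then show ?thesis using spread_touching(2)[OF r] by simp
qed

lemma spread_filterlim:
  "r \<in> verts G \<Longrightarrow> filterlim (spread r) (finite_subsets_at_top (verts G)) sequentially"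
  using spread_finite spread_Union by (intro incseq_filterlim_finite_subsets) auto

lemma spread_touching_filterlim:
  assumes r: "r \<in> verts G" and "A \<subseteq> edges G"
  shows "filterlim (\<lambda>n. A \<inter> touching (spread r n) (edges G)) (finite_subsets_at_top A) sequentially"
proof (rule incseq_filterlim_finite_subsets)
  show "(\<Union>n. A \<inter> touching (spread r n) (edges G)) = A"
    using spread_touching(2)[OF r] assms(2) by blast
qed (use spread_touching[OF r] in auto)

lemma pred_linked [measurable]: "Measurable.pred S (\<lambda>F. (u, v) \<in> linked F)"
proof -
  let ?I = "{D. (finite D \<and> D \<subseteq> edges G) \<and> (u, v) \<in> linked D}"
  have "{F\<in>space S. (u, v) \<in> linked F} = (\<Union>D\<in>?I. superset_event G D)"
  proof (intro equalityI subsetI)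
    fix F assume F: "F \<in> {F\<in>space S. (u, v) \<in> linked F}"
    then obtain D where D: "D \<subseteq> F" "finite D" "(u, v) \<in> linked D"
      using conn_finite_support[of u v "{}" F] by auto
    then have "D \<in> ?I" "F \<in> superset_event G D" using F by auto
    then show "F \<in> (\<Union>D\<in>?I. superset_event G D)" by blast
  next
    fix F assume "F \<in> (\<Union>D\<in>?I. superset_event G D)"
    then show "F \<in> {F\<in>space S. (u, v) \<in> linked F}" using conn_mono[of "{}" "{}"] by auto
  qed
  also have "\<dots> \<in> sets S"
  proof (rule sets.countable_UN'')
    have "countable {D. finite D \<and> D \<subseteq> edges G}"
      by (rule countable_Collect_finite_subset[OF countable_edges])
    then show "countable ?I" by (rule countable_subset[rotated]) auto
  qed (use superset_event_sets in auto)
  finally show ?thesis by (simp add: pred_def)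
qed

lemma pred_edge [measurable]: "Measurable.pred S (\<lambda>F. e \<in> F)"
proof (cases "e \<in> edges G")
  case True
  then show ?thesis using superset_event_sets[of "{e}" G] by (simp add: pred_def)
next
  case False
  then have "{F\<in>space S. e \<in> F} = {}" by auto
  then show ?thesis unfolding pred_def by (metis sets.empty_sets)
qed

text \<open>The function factors through a finite set, each point of which has a measurable
  preimage.\<close>

lemma finite_dependence_measurable:
  fixes H :: "'e set \<Rightarrow> ('v \<times> 'v) set \<Rightarrow> real"
  assumes "finite K" "finite U"
  shows "(\<lambda>F. H (F \<inter> K) (linked F \<inter> U)) \<in> borel_measurable S"
proof -
  let ?C = "Pow K \<times> Pow U"
  let ?f = "\<lambda>F. (F \<inter> K, linked F \<inter> U)"
  have "?f \<in> measurable S (count_space ?C)"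
  proof (subst measurable_count_space_eq2)
    show "finite ?C" using assms by simp
    show "?f \<in> space S \<rightarrow> ?C \<and> (\<forall>a\<in>?C. ?f -` {a} \<inter> space S \<in> sets S)"
    proof (intro conjI ballI)
      fix a assume a: "a \<in> ?C"
      have "?f -` {a} \<inter> space S =
        {F\<in>space S. (\<forall>e\<in>K. e \<in> F \<longleftrightarrow> e \<in> fst a) \<and> (\<forall>p\<in>U. (fst p, snd p) \<in> linked F \<longleftrightarrow> p \<in> snd a)}"
        using a by (auto simp: set_eq_iff)
      also have "\<dots> \<in> sets S" using assms by measurable
      finally show "?f -` {a} \<inter> space S \<in> sets S" .
    qed auto
  qed
  moreover have "(\<lambda>(A, Q). H A Q) \<in> borel_measurable (count_space ?C)" by simp
  ultimately have "(\<lambda>F. (\<lambda>(A, Q). H A Q) (?f F)) \<in> borel_measurable S" by (rule measurable_compose)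
  then show ?thesis by simp
qed

lemma finite_end_verts: "finite K \<Longrightarrow> finite (end_verts K)"
  by (simp add: end_verts_def)

lemma Ex_wired_measurable:
  assumes W: "finite W" "W \<subseteq> verts G"
  shows "(\<lambda>F. Ex_wired F (linked F) W \<phi>) \<in> borel_measurable S"
    and "(\<lambda>F. Ex_wired (edges G) (linked F) W \<phi>) \<in> borel_measurable S"
proof -
  let ?K = "touching W (edges G)"
  let ?U = "end_verts ?K"
  have fin: "finite ?K" "finite (?U \<times> ?U)" using finite_touching[OF W] finite_end_verts by auto
  have st: "sym (linked F \<inter> ?U \<times> ?U)" "trans (linked F \<inter> ?U \<times> ?U)" for F
    using sym_conn[of "{}" F] trans_conn[of "{}" F] unfolding sym_def trans_def by blast+
  have 1: "Ex_wired F (linked F) W = Ex_wired (F \<inter> ?K) (linked F \<inter> ?U \<times> ?U) W" if "F \<subseteq> edges G" for F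
  proof (rule Ex_wired_restrict)
    show "touching W F = touching W (F \<inter> ?K)" using that by (auto simp: touching_def)
    have "end_verts (touching W F) \<subseteq> ?U" using that by (auto simp: end_verts_def touching_def)
    then show "linked F \<inter> end_verts (touching W F) \<times> end_verts (touching W F) =
      linked F \<inter> ?U \<times> ?U \<inter> end_verts (touching W F) \<times> end_verts (touching W F)" by blast
  qed (rule sym_conn trans_conn st)+
  have 2: "Ex_wired (edges G) (linked F) W = Ex_wired (edges G) (linked F \<inter> ?U \<times> ?U) W" for F
    by (rule Ex_wired_restrict) (use sym_conn trans_conn st in auto)
  have "(\<lambda>F. Ex_wired (F \<inter> ?K) (linked F \<inter> ?U \<times> ?U) W \<phi>) \<in> borel_measurable S"
    by (rule finite_dependence_measurable[OF fin, of "\<lambda>A Q. Ex_wired A Q W \<phi>"])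
  then show "(\<lambda>F. Ex_wired F (linked F) W \<phi>) \<in> borel_measurable S"
    using 1 by (subst measurable_cong[of _ _ "\<lambda>F. Ex_wired (F \<inter> ?K) (linked F \<inter> ?U \<times> ?U) W \<phi>"]) auto
  have "(\<lambda>F. Ex_wired (edges G) (linked F \<inter> ?U \<times> ?U) W \<phi>) \<in> borel_measurable S"
    by (rule finite_dependence_measurable[OF fin, of "\<lambda>A Q. Ex_wired (edges G) Q W \<phi>"])
  then show "(\<lambda>F. Ex_wired (edges G) (linked F) W \<phi>) \<in> borel_measurable S" using 2 by simp
qed

lemma kernel_measurable:
  assumes \<kappa>: "\<And>F. F \<subseteq> edges G \<Longrightarrow> prob_space (\<kappa> F)" "\<And>F. F \<subseteq> edges G \<Longrightarrow> sets (\<kappa> F) = sets S"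
    and g: "\<And>D n. finite D \<Longrightarrow> D \<subseteq> edges G \<Longrightarrow> g D n \<in> borel_measurable S"
    and lim: "\<And>D F. finite D \<Longrightarrow> D \<subseteq> edges G \<Longrightarrow> F \<subseteq> edges G \<Longrightarrow>
      (\<lambda>n. g D n F) \<longlonglongrightarrow> measure (\<kappa> F) (superset_event G D)"
  shows "\<kappa> \<in> measurable S (subprob_algebra S)"
proof (rule measurable_subprob_algebra_generated)
  show "sets S = sigma_sets (Pow (edges G)) (superset_event G ` {D. finite D \<and> D \<subseteq> edges G})"
    by (rule subgraph_space_generator)
  show "Int_stable (superset_event G ` {D. finite D \<and> D \<subseteq> edges G})" by (rule superset_events_Int_stable)
  show "superset_event G ` {D. finite D \<and> D \<subseteq> edges G} \<subseteq> Pow (Pow (edges G))" by auto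
  show "subprob_space (\<kappa> F)" "sets (\<kappa> F) = sets S" if "F \<in> space S" for F
    using that \<kappa> by (auto intro: prob_space_imp_subprob_space)
  have ev: "(\<lambda>F. emeasure (\<kappa> F) (superset_event G D)) \<in> borel_measurable S"
    if D: "finite D" "D \<subseteq> edges G" for D
  proof -
    have "(\<lambda>F. measure (\<kappa> F) (superset_event G D)) \<in> borel_measurable S"
      by (rule borel_measurable_LIMSEQ_real[of _ "g D"]) (use g lim D in auto)
    then have "(\<lambda>F. ennreal (measure (\<kappa> F) (superset_event G D))) \<in> borel_measurable S" by simp
    moreover have "emeasure (\<kappa> F) (superset_event G D) = ennreal (measure (\<kappa> F) (superset_event G D))"
      if "F \<in> space S" for F
    proof -
      interpret prob_space "\<kappa> F" using \<kappa>(1) that by simp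
      show ?thesis by (rule emeasure_eq_measure)
    qed
    ultimately show ?thesis by (subst measurable_cong) auto
  qed
  show "(\<lambda>F. emeasure (\<kappa> F) A) \<in> borel_measurable S"
    if "A \<in> superset_event G ` {D. finite D \<and> D \<subseteq> edges G}" for A
    using that ev by auto
  have "superset_event G {} = Pow (edges G)" by auto
  then show "(\<lambda>F. emeasure (\<kappa> F) (Pow (edges G))) \<in> borel_measurable S" using ev[of "{}"] by simp
qed

lemma sample_WSF_measurable: "sample_on_components WSF G \<in> measurable S (subprob_algebra S)"
proof -
  obtain r where r: "r \<in> verts G" using verts_nonempty by blast
  show ?thesis
  proof (rule kernel_measurable[where g = "\<lambda>D n F. Ex_wired F (linked F) (spread r n) (\<lambda>T. of_bool (D \<subseteq> T))"])
    fix F assume F: "F \<subseteq> edges G"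
    show "prob_space (sample_on_components WSF G F)" by (rule law_limit_prob[OF sample_WSF_law[OF F]])
    show "sets (sample_on_components WSF G F) = sets S" by (rule law_limit_sets[OF sample_WSF_law[OF F]])
    fix D assume D: "finite D" "D \<subseteq> edges G"
    have "((\<lambda>W. Ex_wired F (linked F) W (\<lambda>T. of_bool (D \<subseteq> T)))
      \<longlongrightarrow> measure (sample_on_components WSF G F) (superset_event G D)) (finite_subsets_at_top (verts G))"
      using sample_WSF_law[OF F] D unfolding law_limit_def by blast
    from filterlim_compose[OF this spread_filterlim[OF r]]
    show "(\<lambda>n. Ex_wired F (linked F) (spread r n) (\<lambda>T. of_bool (D \<subseteq> T)))
      \<longlonglongrightarrow> measure (sample_on_components WSF G F) (superset_event G D)" .
  next
    fix D n show "(\<lambda>F. Ex_wired F (linked F) (spread r n) (\<lambda>T. of_bool (D \<subseteq> T))) \<in> borel_measurable S"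
      using spread_finite[OF r] by (intro Ex_wired_measurable(1)) auto
  qed
qed

lemma sample_FSF_measurable: "sample_on_components FSF G \<in> measurable S (subprob_algebra S)"
proof -
  obtain r where r: "r \<in> verts G" using verts_nonempty by blast
  let ?E = "\<lambda>n. touching (spread r n) (edges G)"
  show ?thesis
  proof (rule kernel_measurable[where g = "\<lambda>D n F. Ex {} (F \<inter> ?E n) (\<lambda>T. of_bool (D \<subseteq> T))"])
    fix F assume F: "F \<subseteq> edges G"
    show "prob_space (sample_on_components FSF G F)" by (rule law_limit_prob[OF sample_FSF_law[OF F]])
    show "sets (sample_on_components FSF G F) = sets S" by (rule law_limit_sets[OF sample_FSF_law[OF F]])
    fix D assume D: "finite D" "D \<subseteq> edges G"
    have "((\<lambda>E. Ex {} E (\<lambda>T. of_bool (D \<subseteq> T)))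
      \<longlongrightarrow> measure (sample_on_components FSF G F) (superset_event G D)) (finite_subsets_at_top F)"
      using sample_FSF_law[OF F] D unfolding law_limit_def by blast
    from filterlim_compose[OF this spread_touching_filterlim[OF r F]]
    show "(\<lambda>n. Ex {} (F \<inter> ?E n) (\<lambda>T. of_bool (D \<subseteq> T)))
      \<longlonglongrightarrow> measure (sample_on_components FSF G F) (superset_event G D)" .
  next
    fix D n show "(\<lambda>F. Ex {} (F \<inter> ?E n) (\<lambda>T. of_bool (D \<subseteq> T))) \<in> borel_measurable S"
      using finite_dependence_measurable[of "?E n" "{}" "\<lambda>A Q. Ex {} A (\<lambda>T. of_bool (D \<subseteq> T))"]
        spread_touching(1)[OF r] by simp
  qed
qed

lemma induced_component_graph_eq:
  assumes F: "F \<subseteq> edges G"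
  shows "induced_component_graph G F = edges_in (linked F) (edges G)"
proof (intro equalityI subsetI)
  fix e assume "e \<in> induced_component_graph G F"
  then obtain C where C: "e \<in> edges G" "C \<in> comps F" "endpoints G e \<subseteq> C"
    by (auto simp: induced_component_graph_def)
  have "fst (en e) \<in> C" "snd (en e) \<in> C" using C endpoints_eq[OF C(1)] by auto
  then have "(fst (en e), snd (en e)) \<in> linked F"
    using comps_memD(3)[OF F C(2)] ends_in[OF C(1)] by blast
  then show "e \<in> edges_in (linked F) (edges G)" using C by (simp add: edges_in_def)
next
  fix e assume "e \<in> edges_in (linked F) (edges G)"
  then have e: "e \<in> edges G" "(fst (en e), snd (en e)) \<in> linked F" by (auto simp: edges_in_def)
  obtain C where C: "C \<in> comps F" "fst (en e) \<in> C" using comps_cover[OF F] ends_in[OF e(1)] by blast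
  then have "endpoints G e \<subseteq> C" using comps_linked_iff[OF F C(1) e(2)] endpoints_eq[OF e(1)] by simp
  then show "e \<in> induced_component_graph G F" using e C by (auto simp: induced_component_graph_def)
qed

lemma linked_edges_in:
  assumes "F \<subseteq> edges G"
  shows "linked (edges_in (linked F) (edges G)) = linked F"
proof
  show "linked (edges_in (linked F) (edges G)) \<subseteq> linked F"
    by (rule conn_least) (auto simp: edges_in_def)
  show "linked F \<subseteq> linked (edges_in (linked F) (edges G))"
    using assms conn_edge by (intro conn_mono) (auto simp: edges_in_def)
qed

lemma induced_component_graph_measurable: "induced_component_graph G \<in> measurable S S"
proof -
  have "induced_component_graph G -` Y \<inter> space S \<in> sets S"
    if Y: "Y \<in> (\<lambda>e. {F \<in> Pow (edges G). e \<in> F}) ` edges G" for Y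
  proof -
    obtain e where e: "e \<in> edges G" "Y = {F \<in> Pow (edges G). e \<in> F}" using Y by auto
    have "induced_component_graph G -` Y \<inter> space S = {F\<in>space S. (fst (en e), snd (en e)) \<in> linked F}"
      using e induced_component_graph_eq by (auto simp: edges_in_def)
    then show ?thesis using pred_linked[of "fst (en e)" "snd (en e)"] by (simp add: pred_def)
  qed
  moreover have "induced_component_graph G \<in> space S \<rightarrow> Pow (edges G)"
    by (auto simp: induced_component_graph_def)
  ultimately have "induced_component_graph G \<in> measurable S
    (measure_of (Pow (edges G)) ((\<lambda>e. {F \<in> Pow (edges G). e \<in> F}) ` edges G) (\<lambda>_. 0))"
    by (intro measurable_measure_of) auto
  then show ?thesis by (simp only: subgraph_space_def[of G, symmetric])
qed

definition resample_WSF :: "'e set \<Rightarrow> 'e set measure" where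
  "resample_WSF F = sample_on_components WSF G (induced_component_graph G F)"

definition resample_FSF :: "'e set \<Rightarrow> 'e set measure" where
  "resample_FSF F = sample_on_components FSF G (induced_component_graph G F)"

lemma resample_WSF_law:
  assumes F: "F \<subseteq> edges G"
  shows "wired_law (linked F) (resample_WSF F)"
proof -
  let ?A = "edges_in (linked F) (edges G)"
  have "law_limit G (finite_subsets_at_top (verts G)) (Ex_wired ?A (linked ?A)) (resample_WSF F)"
    unfolding resample_WSF_def induced_component_graph_eq[OF F]
    by (rule sample_WSF_law) (rule edges_in_subset)
  \<comment> \<open>Edges between different components of \<open>F\<close> are already discarded by
    \<open>edges_in\<close>.\<close>
  moreover have "Ex_wired ?A (linked F) = Ex_wired (edges G) (linked F)"
  proof -
    have "edges_in (linked F) ?A = ?A" by (auto simp: edges_in_def)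
    then show ?thesis by (simp add: Ex_wired_def fun_eq_iff)
  qed
  ultimately show ?thesis unfolding wired_law_def by (simp add: linked_edges_in[OF F])
qed

lemma resample_FSF_law:
  assumes F: "F \<subseteq> edges G"
  shows "free_law (linked F) (resample_FSF F)"
  unfolding free_law_def resample_FSF_def induced_component_graph_eq[OF F]
  by (rule sample_FSF_law) (rule edges_in_subset)

lemma resample_measurable:
  "resample_WSF \<in> measurable S (subprob_algebra S)" "resample_FSF \<in> measurable S (subprob_algebra S)"
  unfolding resample_WSF_def[abs_def] resample_FSF_def[abs_def]
  by (rule measurable_compose[OF induced_component_graph_measurable sample_WSF_measurable],
      rule measurable_compose[OF induced_component_graph_measurable sample_FSF_measurable])

section \<open>Stochastic domination between the limit laws\<close>

lemma wired_law_tendsto: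
  assumes "wired_law P M" "finite D" "D \<subseteq> edges G" "local_on D \<phi>"
  shows "((\<lambda>W. Ex_wired (edges G) P W \<phi>) \<longlongrightarrow> integral\<^sup>L M \<phi>) (finite_subsets_at_top (verts G))"
  using law_limit_tendsto[of G _ "wired_rel P" "\<lambda>W. touching W (edges_in P (edges G))" M D \<phi>] assms
  unfolding wired_law_def Ex_wired_def by blast

lemma free_law_tendsto:
  assumes "free_law P M" "finite D" "D \<subseteq> edges G" "local_on D \<phi>"
  shows "((\<lambda>E. Ex {} E \<phi>) \<longlongrightarrow> integral\<^sup>L M \<phi>) (finite_subsets_at_top (edges_in P (edges G)))"
  using law_limit_tendsto[of G _ "\<lambda>_. {}" "\<lambda>E. E" M D \<phi>] assms
  unfolding free_law_def by blast

lemma eventually_touching: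
  assumes "finite D" "D \<subseteq> A" "A \<subseteq> edges G"
  shows "\<forall>\<^sub>F W in finite_subsets_at_top (verts G). finite W \<and> W \<subseteq> verts G \<and> D \<subseteq> touching W A"
  unfolding eventually_finite_subsets_at_top
proof (intro exI conjI allI impI)
  show "finite ((\<lambda>e. fst (en e)) ` D)" "(\<lambda>e. fst (en e)) ` D \<subseteq> verts G"
    using assms ends_in by auto
qed (use assms in \<open>auto simp: touching_def\<close>)

text \<open>For fixed finite \<open>E\<close> and a window \<open>W\<close> large enough to see it,
  removing the wiring raises the mean, and so does deleting the edges outside \<open>E\<close>. The
  limit in \<open>W\<close> is taken before the one in \<open>E\<close>.\<close>

lemma wired_dominated_free:
  assumes "wired_law P M" "free_law P N"
  shows "dominated G M N"
  unfolding dominated_def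
proof (intro allI impI)
  fix D \<phi> assume D: "finite D" "D \<subseteq> edges G" and \<phi>: "increasing \<phi>" "local_on D \<phi>"
  let ?A = "edges_in P (edges G)"
  have "\<forall>\<^sub>F E in finite_subsets_at_top ?A. integral\<^sup>L M \<phi> \<le> Ex {} E \<phi>"
    unfolding eventually_finite_subsets_at_top
  proof (intro exI[of _ "D \<inter> ?A"] conjI allI impI)
    fix E assume E: "finite E \<and> D \<inter> ?A \<subseteq> E \<and> E \<subseteq> ?A"
    have "\<forall>\<^sub>F W in finite_subsets_at_top (verts G). Ex_wired (edges G) P W \<phi> \<le> Ex {} E \<phi>"
      using eventually_touching[of E ?A]
    proof (rule eventually_mono)
      fix W assume W: "finite W \<and> W \<subseteq> verts G \<and> E \<subseteq> touching W ?A"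
      then have fin: "finite (touching W ?A)" by (intro finite_touching_in) auto
      have "Ex_wired (edges G) P W \<phi> \<le> Ex {} (touching W ?A) \<phi>"
        unfolding Ex_wired_def by (rule Ex_identify_le[OF fin _ \<phi>(1)]) simp
      also have "\<dots> \<le> Ex {} E \<phi>"
        by (rule Ex_add_edges_le[OF fin _ \<phi>]) (use W E touching_subset[of W ?A] in blast)+
      finally show "Ex_wired (edges G) P W \<phi> \<le> Ex {} E \<phi>" .
    qed (use E edges_in_subset in auto)
    then show "integral\<^sup>L M \<phi> \<le> Ex {} E \<phi>"
      by (rule tendsto_upperbound[OF wired_law_tendsto[OF assms(1) D \<phi>(2)]]) simp
  qed (use D in auto)
  then show "integral\<^sup>L M \<phi> \<le> integral\<^sup>L N \<phi>"
    by (rule tendsto_lowerbound[OF free_law_tendsto[OF assms(2) D \<phi>(2)]]) simp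
qed

text \<open>\<open>W\<close> stays fixed while the set \<open>?E n\<close> in which connections are
  read grows, and for each \<open>n\<close> the wired graphs on \<open>W'\<close> converge first.
  For fixed \<open>n\<close> the integrand \<open>?h n\<close> is local, so both sides of
  \<open>resample_le\<close> converge.\<close>

lemma resample_step_le:
  assumes \<mu>: "wired_law (linked (edges G)) \<mu>"
    and W: "finite W" "W \<subseteq> verts G" and D: "D \<subseteq> touching W (edges G)"
    and \<phi>: "increasing \<phi>" "local_on D \<phi>"
  shows "(\<integral>F. Ex_wired (edges G) (linked F) W \<phi> \<partial>\<mu>) \<le> integral\<^sup>L \<mu> \<phi>"
proof -
  obtain r where r: "r \<in> verts G" using verts_nonempty by blast
  let ?K = "touching W (edges G)"
  let ?U = "end_verts ?K"
  let ?E = "\<lambda>n. touching (spread r n) (edges G)"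
  let ?h = "\<lambda>n F. Ex_wired (?E n) (linked (F \<inter> ?E n)) W \<phi>"
  have \<mu>': "prob_space \<mu>" "sets \<mu> = sets S" using law_limit_prob law_limit_sets \<mu> unfolding wired_law_def by blast+
  interpret prob_space \<mu> by fact
  have sp: "space \<mu> = Pow (edges G)" using sets_eq_imp_space_eq[OF \<mu>'(2)] by simp
  have finK: "finite ?K" by (rule finite_touching[OF W])
  have finD: "finite D" "D \<subseteq> edges G" using finK D touching_subset finite_subset by blast+
  obtain B where B: "\<And>X. \<bar>\<phi> X\<bar> \<le> B" using local_bounded[OF finD(1) \<phi>(2)] by blast
  have E: "?E n \<subseteq> edges G" "finite (?E n)" for n using touching_subset spread_touching(1)[OF r] by auto
  have evE: "\<forall>\<^sub>F n in sequentially. X \<subseteq> ?E n" if X: "finite X" "X \<subseteq> edges G" for X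
    using spread_touching_filterlim[OF r order_refl] X
    unfolding filterlim_finite_subsets_at_top by (auto elim!: eventually_mono simp: Int_absorb1[OF touching_subset])
  have h_local: "local_on (?E n) (?h n)" for n by (simp add: local_on_def Int_assoc)
  have h_bound: "\<bar>?h n F\<bar> \<le> B" for n F
    unfolding Ex_wired_def using B
    by (intro Ex_abs_le finite_subset[OF order_trans[OF touching_subset edges_in_subset] E(2)])
  have step: "\<forall>\<^sub>F n in sequentially. integral\<^sup>L \<mu> (?h n) \<le> integral\<^sup>L \<mu> \<phi>"
    using evE[OF finD]
  proof eventually_elim
    case (elim n)
    have DW: "D \<subseteq> touching W (?E n)" using D elim by (auto simp: touching_def)
    have "\<forall>\<^sub>F W' in finite_subsets_at_top (verts G).
      Ex_wired (edges G) (linked (edges G)) W' (?h n) \<le> Ex_wired (edges G) (linked (edges G)) W' \<phi>"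
      using eventually_touching[OF E(2,1) order_refl]
    proof (rule eventually_mono)
      fix W' assume W': "finite W' \<and> W' \<subseteq> verts G \<and> ?E n \<subseteq> touching W' (edges G)"
      then show "Ex_wired (edges G) (linked (edges G)) W' (?h n) \<le> Ex_wired (edges G) (linked (edges G)) W' \<phi>"
        unfolding Ex_wired_def[of _ _ W'] edges_in_linked
        by (intro resample_le[OF finite_touching _ \<phi> DW]) auto
    qed
    then show ?case
      by (rule tendsto_le[rotated -1])
        (use wired_law_tendsto[OF \<mu> finD \<phi>(2)] wired_law_tendsto[OF \<mu> E(2,1) h_local] in auto)
  qed
  \<comment> \<open>Only connections among finitely many vertices matter. Each uses finitely many
    edges and so appears within \<open>?E n\<close> from some \<open>n\<close> on; conversely,
    \<open>F \<inter> ?E n\<close> makes no connection that \<open>F\<close> lacks.\<close>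
  have conv: "(\<lambda>n. ?h n F) \<longlonglongrightarrow> Ex_wired (edges G) (linked F) W \<phi>" if F: "F \<subseteq> edges G" for F
  proof (rule tendsto_eventually)
    have "\<forall>\<^sub>F n in sequentially. \<forall>p\<in>?U \<times> ?U. p \<in> linked F \<longrightarrow> p \<in> linked (F \<inter> ?E n)"
    proof (rule eventually_ball_finite)
      show "finite (?U \<times> ?U)" using finite_end_verts[OF finK] by simp
      show "\<forall>p\<in>?U \<times> ?U. \<forall>\<^sub>F n in sequentially. p \<in> linked F \<longrightarrow> p \<in> linked (F \<inter> ?E n)"
      proof
        fix p assume "p \<in> ?U \<times> ?U"
        show "\<forall>\<^sub>F n in sequentially. p \<in> linked F \<longrightarrow> p \<in> linked (F \<inter> ?E n)"
        proof (cases "p \<in> linked F")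
          case True
          then obtain X where X: "X \<subseteq> F" "finite X" "p \<in> linked X"
            using conn_finite_support[of "fst p" "snd p" "{}" F] by auto
          have "X \<subseteq> edges G" using X(1) F by blast
          from evE[OF X(2) this] show ?thesis
          proof eventually_elim
            case (elim n)
            then have "linked X \<subseteq> linked (F \<inter> ?E n)" using X(1) by (intro conn_mono) auto
            then show ?case using X(3) by blast
          qed
        qed simp
      qed
    qed
    then show "\<forall>\<^sub>F n in sequentially. ?h n F = Ex_wired (edges G) (linked F) W \<phi>"
      using evE[OF finK touching_subset]
    proof eventually_elim
      case (elim n)
      have t: "touching W (?E n) = ?K" using elim(2) E(1)[of n] by (auto simp: touching_def)
      have "linked (F \<inter> ?E n) \<subseteq> linked F" by (intro conn_mono) auto
      then have "linked (F \<inter> ?E n) \<inter> ?U \<times> ?U = linked F \<inter> ?U \<times> ?U" using elim(1) by blast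
      then have "Ex_wired (?E n) (linked (F \<inter> ?E n)) W = Ex_wired (edges G) (linked F) W"
        by (intro Ex_wired_restrict sym_conn trans_conn) (simp_all add: t)
      then show ?case by simp
    qed
  qed
  have "(\<lambda>n. integral\<^sup>L \<mu> (?h n)) \<longlonglongrightarrow> (\<integral>F. Ex_wired (edges G) (linked F) W \<phi> \<partial>\<mu>)"
  proof (rule integral_dominated_convergence[where w = "\<lambda>_. B"])
    show "(\<lambda>F. Ex_wired (edges G) (linked F) W \<phi>) \<in> borel_measurable \<mu>"
      using Ex_wired_measurable(2)[OF W] \<mu>'(2) by (simp cong: measurable_cong_sets)
    show "?h n \<in> borel_measurable \<mu>" for n
      by (rule borel_measurable_integrable[OF local_integrable[OF \<mu>' E(2,1) h_local]])
    show "AE F in \<mu>. (\<lambda>n. ?h n F) \<longlonglongrightarrow> Ex_wired (edges G) (linked F) W \<phi>"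
      using conv by (intro AE_I2) (simp add: sp)
  qed (use h_bound in auto)
  then show ?thesis by (rule tendsto_upperbound[OF _ step]) simp
qed

text \<open>The remaining limit, over the balls \<open>spread r n\<close>: the bounded means in the
  window converge to those of the resampled law, so the bound of \<open>resample_step_le\<close>
  passes to the mixture.\<close>

theorem resample_WSF_dominated:
  assumes \<mu>: "wired_law (linked (edges G)) \<mu>"
  shows "dominated G (\<mu> \<bind> resample_WSF) \<mu>"
  unfolding dominated_def
proof (intro allI impI)
  fix D \<phi> assume D: "finite D" "D \<subseteq> edges G" and \<phi>: "increasing \<phi>" "local_on D \<phi>"
  obtain r where r: "r \<in> verts G" using verts_nonempty by blast
  have \<mu>': "prob_space \<mu>" "sets \<mu> = sets S" using law_limit_prob law_limit_sets \<mu> unfolding wired_law_def by blast+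
  interpret prob_space \<mu> by fact
  have sp: "space \<mu> = Pow (edges G)" using sets_eq_imp_space_eq[OF \<mu>'(2)] by simp
  obtain B where B: "\<And>X. \<bar>\<phi> X\<bar> \<le> B" using local_bounded[OF D(1) \<phi>(2)] by blast
  let ?g = "\<lambda>n F. Ex_wired (edges G) (linked F) (spread r n) \<phi>"
  have g_meas: "?g n \<in> borel_measurable \<mu>" for n
    using Ex_wired_measurable(2)[of "spread r n" \<phi>] spread_finite[OF r, of n] \<mu>'(2)
    by (simp cong: measurable_cong_sets)
  have conv: "(\<lambda>n. ?g n F) \<longlonglongrightarrow> integral\<^sup>L (resample_WSF F) \<phi>" if "F \<subseteq> edges G" for F
    by (rule filterlim_compose[OF wired_law_tendsto[OF resample_WSF_law[OF that] D \<phi>(2)] spread_filterlim[OF r]])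
  have lim: "(\<lambda>n. integral\<^sup>L \<mu> (?g n)) \<longlonglongrightarrow> (\<integral>F. integral\<^sup>L (resample_WSF F) \<phi> \<partial>\<mu>)"
  proof (rule integral_dominated_convergence[where w = "\<lambda>_. B"])
    show "(\<lambda>F. integral\<^sup>L (resample_WSF F) \<phi>) \<in> borel_measurable \<mu>"
      by (rule borel_measurable_LIMSEQ_real[of _ ?g]) (use g_meas conv sp in auto)
    show "AE F in \<mu>. (\<lambda>n. ?g n F) \<longlonglongrightarrow> integral\<^sup>L (resample_WSF F) \<phi>"
      using conv by (intro AE_I2) (simp add: sp)
    have "\<bar>?g n F\<bar> \<le> B" for n F
      unfolding Ex_wired_def using B spread_finite[OF r, of n] by (intro Ex_abs_le finite_touching_in) auto
    then show "AE F in \<mu>. norm (?g n F) \<le> B" for n by simp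
  qed (use g_meas in auto)
  have "\<forall>\<^sub>F n in sequentially. D \<subseteq> touching (spread r n) (edges G)"
    using spread_touching_filterlim[OF r order_refl] D
    unfolding filterlim_finite_subsets_at_top by (auto elim!: eventually_mono simp: Int_absorb1[OF touching_subset])
  then have "\<forall>\<^sub>F n in sequentially. integral\<^sup>L \<mu> (?g n) \<le> integral\<^sup>L \<mu> \<phi>"
  proof eventually_elim
    case (elim n)
    then show ?case using spread_finite[OF r, of n] by (intro resample_step_le[OF \<mu> _ _ _ \<phi>]) auto
  qed
  then have "(\<integral>F. integral\<^sup>L (resample_WSF F) \<phi> \<partial>\<mu>) \<le> integral\<^sup>L \<mu> \<phi>"
    by (rule tendsto_upperbound[OF lim]) simp
  moreover have "integral\<^sup>L (\<mu> \<bind> resample_WSF) \<phi> = (\<integral>F. integral\<^sup>L (resample_WSF F) \<phi> \<partial>\<mu>)"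
  proof (rule integral_bind[where K = S and B = B and B' = 1])
    show "\<phi> \<in> borel_measurable S"
      using borel_measurable_integrable[OF local_integrable[OF \<mu>' D \<phi>(2)]] \<mu>'(2) by (simp cong: measurable_cong_sets)
    show "resample_WSF \<in> measurable \<mu> (subprob_algebra S)"
      using resample_measurable(1) \<mu>'(2) by (simp cong: measurable_cong_sets)
    show "AE F in \<mu>. emeasure (resample_WSF F) (space (resample_WSF F)) \<le> ennreal 1"
    proof (rule AE_I2)
      fix F assume "F \<in> space \<mu>"
      then have "prob_space (resample_WSF F)"
        using law_limit_prob resample_WSF_law[of F] unfolding sp wired_law_def by blast
      then show "emeasure (resample_WSF F) (space (resample_WSF F)) \<le> ennreal 1"
        by (simp add: prob_space.emeasure_space_1)
    qed
  qed (use B finite_measure_axioms in auto)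
  ultimately show "integral\<^sup>L (\<mu> \<bind> resample_WSF) \<phi> \<le> integral\<^sup>L \<mu> \<phi>" by simp
qed

section \<open>One-ended components\<close>

lemma limit_of_local:
  fixes \<phi> :: "nat \<Rightarrow> 'e set \<Rightarrow> real"
  assumes loc: "\<And>n. finite (D n)" "\<And>n. D n \<subseteq> edges G" "\<And>n. local_on (D n) (\<phi> n)"
    and bd: "\<And>n X. \<bar>\<phi> n X\<bar> \<le> 1"
    and conv: "\<And>F. F \<subseteq> edges G \<Longrightarrow> (\<lambda>n. \<phi> n F) \<longlonglongrightarrow> \<psi> F"
    and M: "prob_space M" "sets M = sets S"
  shows "\<psi> \<in> borel_measurable S" "integrable M \<psi>" "(\<lambda>n. integral\<^sup>L M (\<phi> n)) \<longlonglongrightarrow> integral\<^sup>L M \<psi>"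
proof -
  interpret prob_space M by fact
  have sp: "space M = Pow (edges G)" using sets_eq_imp_space_eq[OF M(2)] by simp
  have \<phi>: "\<phi> n \<in> borel_measurable M" for n
    by (rule borel_measurable_integrable[OF local_integrable[OF M loc]])
  have \<psi>: "\<psi> \<in> borel_measurable M"
    by (rule borel_measurable_LIMSEQ_real[of _ \<phi>]) (use \<phi> conv sp in auto)
  then show "\<psi> \<in> borel_measurable S" using M(2) by (simp cong: measurable_cong_sets)
  have ae: "AE F in M. (\<lambda>n. \<phi> n F) \<longlonglongrightarrow> \<psi> F" using conv by (intro AE_I2) (simp add: sp)
  have bd': "AE F in M. norm (\<phi> n F) \<le> 1" for n using bd by simp
  show "integrable M \<psi>"
    by (rule integrable_dominated_convergence[OF \<psi> \<phi> _ ae bd']) simp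
  show "(\<lambda>n. integral\<^sup>L M (\<phi> n)) \<longlonglongrightarrow> integral\<^sup>L M \<psi>"
    by (rule integral_dominated_convergence[OF \<psi> \<phi> _ ae bd']) simp
qed

lemma dominatedD:
  "dominated G M N \<Longrightarrow> finite D \<Longrightarrow> D \<subseteq> edges G \<Longrightarrow> local_on D \<phi> \<Longrightarrow> increasing \<phi> \<Longrightarrow>
    integral\<^sup>L M \<phi> \<le> integral\<^sup>L N \<phi>"
  by (simp add: dominated_def)

lemma spread_covers:
  assumes "r \<in> verts G" "finite X" "X \<subseteq> verts G"
  shows "\<exists>n. X \<subseteq> spread r n"
proof -
  have "\<forall>\<^sub>F n in sequentially. finite (spread r n) \<and> X \<subseteq> spread r n \<and> spread r n \<subseteq> verts G"
    using spread_filterlim[OF assms(1)] assms(2,3) unfolding filterlim_finite_subsets_at_top by simp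
  then show ?thesis unfolding eventually_sequentially by blast
qed

lemma dominated_limit:
  fixes \<phi> :: "nat \<Rightarrow> 'e set \<Rightarrow> real"
  assumes "dominated G M N" "prob_space M" "sets M = sets S" "prob_space N" "sets N = sets S"
    and loc: "\<And>n. finite (D n)" "\<And>n. D n \<subseteq> edges G" "\<And>n. local_on (D n) (\<phi> n)"
    and "\<And>n. increasing (\<phi> n)"
    and bd: "\<And>n X. \<bar>\<phi> n X\<bar> \<le> 1"
    and conv: "\<And>F. F \<subseteq> edges G \<Longrightarrow> (\<lambda>n. \<phi> n F) \<longlonglongrightarrow> \<psi> F"
  shows "integral\<^sup>L M \<psi> \<le> integral\<^sup>L N \<psi>"
proof (rule LIMSEQ_le)
  show "(\<lambda>n. integral\<^sup>L M (\<phi> n)) \<longlonglongrightarrow> integral\<^sup>L M \<psi>"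
    by (rule limit_of_local(3)[OF loc bd conv assms(2,3)])
  show "(\<lambda>n. integral\<^sup>L N (\<phi> n)) \<longlonglongrightarrow> integral\<^sup>L N \<psi>"
    by (rule limit_of_local(3)[OF loc bd conv assms(4,5)])
  show "\<exists>N'. \<forall>n\<ge>N'. integral\<^sup>L M (\<phi> n) \<le> integral\<^sup>L N (\<phi> n)"
    by (intro exI[of _ 0] allI impI dominatedD[OF assms(1) loc assms(9)])
qed

text \<open>The number of edges of \<open>D\<close> in \<open>X\<close> minus the indicator of
  \<open>D \<subseteq> X\<close> is increasing: when the indicator jumps, the number grows by at
  least one. Domination for this function and for the indicator pinches the inclusion
  probability.\<close>

lemma equal_marginals:
  assumes dom: "dominated G M N" and M: "prob_space M" "sets M = sets S" and N: "prob_space N" "sets N = sets S"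
    and marg: "\<And>e. e \<in> edges G \<Longrightarrow> (\<integral>F. of_bool (e \<in> F) \<partial>N) \<le> (\<integral>F. of_bool (e \<in> F) \<partial>M :: real)"
  shows "M = N"
proof (rule measure_eqI_superset_events[OF M N])
  fix D assume D: "finite D" "D \<subseteq> edges G"
  let ?s = "\<lambda>X. of_bool (D \<subseteq> X) :: real" and ?m = "\<lambda>e X. of_bool (e \<in> X) :: real"
  let ?g = "\<lambda>X. (\<Sum>e\<in>D. ?m e X) - ?s X"
  have sup: "integral\<^sup>L M ?s \<le> integral\<^sup>L N ?s"
    using dom D increasing_superset local_on_superset unfolding dominated_def by blast
  have int: "integrable Q ?s" "\<And>e. e \<in> D \<Longrightarrow> integrable Q (?m e)"
    if "prob_space Q" "sets Q = sets S" for Q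
  proof -
    show "integrable Q ?s" by (rule local_integrable[OF that D local_on_superset])
    show "integrable Q (?m e)" if "e \<in> D" for e
      by (rule local_integrable[OF \<open>prob_space Q\<close> \<open>sets Q = sets S\<close>, of "{e}"])
        (use D that in \<open>auto simp: local_on_def\<close>)
  qed
  have g_int: "integral\<^sup>L Q ?g = (\<Sum>e\<in>D. integral\<^sup>L Q (?m e)) - integral\<^sup>L Q ?s"
    if "prob_space Q" "sets Q = sets S" for Q
    using int[OF that] by simp
  have "increasing ?g"
    unfolding increasing_def
  proof (intro allI impI)
    fix X Y :: "'e set" assume XY: "X \<subseteq> Y"
    have le: "(\<Sum>e\<in>D. ?m e X) \<le> (\<Sum>e\<in>D. ?m e Y)" using XY by (intro sum_mono) auto
    show "?g X \<le> ?g Y"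
    proof (cases "\<not> D \<subseteq> X \<and> D \<subseteq> Y")
      case True
      then obtain e where e: "e \<in> D" "e \<notin> X" "e \<in> Y" by blast
      have "(\<Sum>e\<in>D. ?m e X) < (\<Sum>e\<in>D. ?m e Y)"
        using XY e by (intro sum_strict_mono_ex1 D(1)) auto
      moreover have "(\<Sum>e\<in>D. ?m e Z) = real (card (D \<inter> Z))" for Z
        using D(1) by simp
      ultimately show ?thesis using True by simp
    next
      case False
      then have "D \<subseteq> X \<longleftrightarrow> D \<subseteq> Y" using XY by blast
      then show ?thesis using le by simp
    qed
  qed
  moreover have "local_on D ?g"
    unfolding local_on_def by (auto intro!: sum.cong)
  ultimately have "integral\<^sup>L M ?g \<le> integral\<^sup>L N ?g"
    using dom D unfolding dominated_def by blast
  then have "integral\<^sup>L N ?s \<le> integral\<^sup>L M ?s + ((\<Sum>e\<in>D. integral\<^sup>L N (?m e)) - (\<Sum>e\<in>D. integral\<^sup>L M (?m e)))"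
    unfolding g_int[OF M] g_int[OF N] by simp
  moreover have "(\<Sum>e\<in>D. integral\<^sup>L N (?m e)) \<le> (\<Sum>e\<in>D. integral\<^sup>L M (?m e))"
    using marg D by (intro sum_mono) auto
  ultimately have "integral\<^sup>L M ?s = integral\<^sup>L N ?s" using sup by simp
  then show "measure M (superset_event G D) = measure N (superset_event G D)"
    using integral_superset[OF M(2) D] integral_superset[OF N(2) D] by simp
qed

definition unbounded :: "'e set \<Rightarrow> 'v \<Rightarrow> bool" where
  "unbounded F x \<longleftrightarrow> infinite {v. (x, v) \<in> linked F}"

text \<open>Window version of \<open>unbounded\<close>: increasing in \<open>F\<close>, decreasing
  in \<open>W\<close>, and for a finite window dependent on finitely many edges. Being in an
  infinite component is not local, so domination reaches it through this limit.\<close>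

definition leaves :: "'v set \<Rightarrow> 'e set \<Rightarrow> 'v \<Rightarrow> bool" where
  "leaves W F x \<longleftrightarrow> (\<exists>z. z \<notin> W \<and> (x, z) \<in> linked (F \<inter> touching W (edges G)))"

text \<open>If what is reached through edges touching \<open>W\<close> stays inside
  \<open>W\<close>, then all edges at it touch \<open>W\<close>, so it is already the whole
  component, and finite.\<close>

lemma unbounded_leaves:
  assumes "F \<subseteq> edges G" "unbounded F x" "finite W"
  shows "leaves W F x"
proof (rule ccontr)
  assume n: "\<not> leaves W F x"
  let ?A = "{v. (x, v) \<in> linked (F \<inter> touching W (edges G))}"
  have AW: "?A \<subseteq> W" using n by (auto simp: leaves_def)
  have "v \<in> ?A" if "(x, v) \<in> linked F" for v
    using that
  proof (induction rule: conn_induct)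
    case (edge e a b)
    have "(a, b) \<in> linked (F \<inter> touching W (edges G))" if "a \<in> W \<or> b \<in> W"
      using that edge assms(1) conn_edge[of e "F \<inter> touching W (edges G)" "{}"] by (auto simp: touching_def)
    then show ?case using AW conn_trans conn_sym by blast
  qed simp_all
  then have "finite {v. (x, v) \<in> linked F}"
    using assms(3) AW finite_subset by (metis (no_types, lifting) mem_Collect_eq subsetI)
  then show False using assms(2) by (simp add: unbounded_def)
qed

lemma leaves_unbounded:
  assumes r: "r \<in> verts G" and F: "F \<subseteq> edges G" and x: "x \<in> verts G"
    and "\<And>n. leaves (spread r n) F x"
  shows "unbounded F x"
  unfolding unbounded_def
proof
  let ?A = "{v. (x, v) \<in> linked F}"
  assume "finite ?A"
  moreover have "?A \<subseteq> verts G" using linked_verts[OF _ F x] by blast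
  ultimately obtain n where n: "?A \<subseteq> spread r n" using spread_covers[OF r] by meson
  obtain z where z: "z \<notin> spread r n" "(x, z) \<in> linked (F \<inter> touching (spread r n) (edges G))"
    using assms(4)[of n] by (auto simp: leaves_def)
  then have "(x, z) \<in> linked F" using conn_mono[of "{}" "{}"] by blast
  then show False using n z by blast
qed

lemma leaves_antimono:
  assumes "W \<subseteq> W'" "leaves W' F x" "F \<subseteq> edges G"
  shows "leaves W F x"
proof (rule ccontr)
  assume n: "\<not> leaves W F x"
  let ?A = "{v. (x, v) \<in> linked (F \<inter> touching W (edges G))}"
  have AW: "?A \<subseteq> W" using n by (auto simp: leaves_def)
  obtain z where z: "z \<notin> W'" "(x, z) \<in> linked (F \<inter> touching W' (edges G))"
    using assms(2) by (auto simp: leaves_def)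
  have "z \<in> ?A" using z(2)
  proof (induction rule: conn_induct)
    case (edge e a b)
    have "(a, b) \<in> linked (F \<inter> touching W (edges G))" if "a \<in> W \<or> b \<in> W"
      using that edge assms(3) conn_edge[of e "F \<inter> touching W (edges G)" "{}"] by (auto simp: touching_def)
    then show ?case using AW conn_trans conn_sym by blast
  qed simp_all
  then show False using AW z(1) assms(1) by blast
qed

lemma leaves_indicator:
  assumes r: "r \<in> verts G" and x: "x \<in> verts G"
  shows "increasing (\<lambda>F. of_bool (leaves W (F - A) x))"
    and "local_on (touching W (edges G)) (\<lambda>F. of_bool (leaves W (F - A) x))"
    and "F \<subseteq> edges G \<Longrightarrow>
      (\<lambda>n. of_bool (leaves (spread r n) (F - A) x) :: real) \<longlonglongrightarrow> of_bool (unbounded (F - A) x)"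
proof -
  show "increasing (\<lambda>F. of_bool (leaves W (F - A) x))"
    unfolding increasing_def
  proof (intro allI impI)
    fix X Y :: "'e set" assume "X \<subseteq> Y"
    then have "linked ((X - A) \<inter> touching W (edges G)) \<subseteq> linked ((Y - A) \<inter> touching W (edges G))"
      by (intro conn_mono) auto
    then have "leaves W (X - A) x \<Longrightarrow> leaves W (Y - A) x" unfolding leaves_def by blast
    then show "of_bool (leaves W (X - A) x) \<le> (of_bool (leaves W (Y - A) x) :: real)" by auto
  qed
  have eq: "(X - A) \<inter> touching W (edges G) = (X \<inter> touching W (edges G) - A) \<inter> touching W (edges G)" for X
    by auto
  then show "local_on (touching W (edges G)) (\<lambda>F. of_bool (leaves W (F - A) x))"
    unfolding local_on_def leaves_def by (simp only: eq[symmetric]) simp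
  assume F: "F \<subseteq> edges G"
  then have FA: "F - A \<subseteq> edges G" by auto
  show "(\<lambda>n. of_bool (leaves (spread r n) (F - A) x) :: real) \<longlonglongrightarrow> of_bool (unbounded (F - A) x)"
  proof (rule tendsto_eventually)
    show "\<forall>\<^sub>F n in sequentially. (of_bool (leaves (spread r n) (F - A) x) :: real) = of_bool (unbounded (F - A) x)"
    proof (cases "unbounded (F - A) x")
      case True
      then show ?thesis using unbounded_leaves[OF FA True] spread_finite[OF r] by simp
    next
      case False
      then obtain n where n: "\<not> leaves (spread r n) (F - A) x" using leaves_unbounded[OF r FA x] by blast
      have "\<not> leaves (spread r m) (F - A) x" if "n \<le> m" for m
      proof -
        have "spread r n \<subseteq> spread r m" using that lift_Suc_mono_le[of "spread r" n m] by auto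
        then show ?thesis using n leaves_antimono[OF _ _ FA] by blast
      qed
      then show ?thesis using False by (intro eventually_sequentiallyI[of n]) simp
    qed
  qed
qed

text \<open>The removed set \<open>A\<close> is empty for measurability of infinite components and a
  single edge in the comparison of marginals.\<close>

lemma unbounded_integrals:
  assumes x: "x \<in> verts G"
  shows "(\<lambda>F. of_bool (unbounded (F - A) x) :: real) \<in> borel_measurable S"
    and "prob_space M \<Longrightarrow> sets M = sets S \<Longrightarrow> integrable M (\<lambda>F. of_bool (unbounded (F - A) x) :: real)"
    and "dominated G M N \<Longrightarrow> prob_space M \<Longrightarrow> sets M = sets S \<Longrightarrow> prob_space N \<Longrightarrow> sets N = sets S \<Longrightarrow>
      (\<integral>F. of_bool (unbounded (F - A) x) \<partial>M) \<le> (\<integral>F. of_bool (unbounded (F - A) x) \<partial>N :: real)"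
proof -
  obtain r where r: "r \<in> verts G" using verts_nonempty by blast
  let ?\<phi> = "\<lambda>n F. of_bool (leaves (spread r n) (F - A) x) :: real"
  let ?D = "\<lambda>n. touching (spread r n) (edges G)"
  note ind = leaves_indicator[OF r x, of _ A]
  have loc: "finite (?D n)" "?D n \<subseteq> edges G" "local_on (?D n) (?\<phi> n)" "\<bar>?\<phi> n X\<bar> \<le> 1" for n X
    using spread_touching(1)[OF r] touching_subset ind(2) by auto
  show "integrable M (\<lambda>F. of_bool (unbounded (F - A) x) :: real)" if "prob_space M" "sets M = sets S" for M
    by (rule limit_of_local(2)[where \<phi> = ?\<phi> and D = ?D]) (use loc ind(3) that in auto)
  show "(\<integral>F. of_bool (unbounded (F - A) x) \<partial>M) \<le> (\<integral>F. of_bool (unbounded (F - A) x) \<partial>N :: real)"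
    if "dominated G M N" "prob_space M" "sets M = sets S" "prob_space N" "sets N = sets S"
    by (rule dominated_limit[OF that, where \<phi> = ?\<phi> and D = ?D]) (use loc ind(1,3) in auto)
  \<comment> \<open>Measurability mentions no law; the wired forest merely supplies a probability
    measure on the right space.\<close>
  obtain M where M: "prob_space M" "sets M = sets S"
    using law_limit_prob law_limit_sets WSF_law unfolding wired_law_def by blast
  show "(\<lambda>F. of_bool (unbounded (F - A) x) :: real) \<in> borel_measurable S"
    by (rule limit_of_local(1)[where \<phi> = ?\<phi> and D = ?D and M = M]) (use loc ind(3) M in auto)
qed

lemma pred_unbounded [measurable]:
  assumes "x \<in> verts G"
  shows "Measurable.pred S (\<lambda>F. unbounded F x)"
proof -
  have "{F\<in>space S. (of_bool (unbounded (F - {}) x) :: real) = 1} \<in> sets S"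
    using unbounded_integrals(1)[OF assms, of "{}"] by measurable
  then show ?thesis by (simp add: pred_def)
qed

text \<open>Let u(x) indicate that x lies in an infinite component of F without the edge e. If all components
  of F are infinite, then the indicator of e in F is at least 2 - u(s) - u(t) for the ends s, t of e,
  with equality for one-ended trees. Since u is increasing in F, the domination of M by N thus also
  compares the marginals in the opposite direction.\<close>

lemma one_ended_marginals:
  assumes dom: "dominated G M N" and M: "prob_space M" "sets M = sets S" and N: "prob_space N" "sets N = sets S"
    and M_inf: "AE F in M. \<forall>x\<in>verts G. unbounded F x"
    and N_inf: "AE F in N. \<forall>x\<in>verts G. unbounded F x"
    and N_one: "AE F in N. \<forall>e\<in>F. \<not> (unbounded (F - {e}) (fst (en e)) \<and> unbounded (F - {e}) (snd (en e)))"
  shows "M = N"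
proof (rule equal_marginals[OF dom M N])
  fix e assume e: "e \<in> edges G"
  let ?u = "\<lambda>x F. of_bool (unbounded (F - {e}) x) :: real"
  let ?s = "fst (en e)" and ?t = "snd (en e)"
  have st: "?s \<in> verts G" "?t \<in> verts G" using ends_in[OF e] by simp_all
  have m_int: "integrable Q (\<lambda>F. of_bool (e \<in> F) :: real)" if "prob_space Q" "sets Q = sets S" for Q
    by (rule local_integrable[OF that, of "{e}"]) (use e in \<open>auto simp: local_on_def\<close>)
  have u_int: "integrable Q (?u x)" if "prob_space Q" "sets Q = sets S" "x \<in> verts G" for Q x
    by (rule unbounded_integrals(2)[OF that(3,1,2)])
  have c_int: "integrable Q (\<lambda>F. 2 - ?u ?s F - ?u ?t F)"
    and c_val: "(\<integral>F. 2 - ?u ?s F - ?u ?t F \<partial>Q) = 2 - integral\<^sup>L Q (?u ?s) - integral\<^sup>L Q (?u ?t)"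
    if Q: "prob_space Q" "sets Q = sets S" for Q
  proof -
    interpret prob_space Q by fact
    note u = u_int[OF Q st(1)] u_int[OF Q st(2)]
    show "integrable Q (\<lambda>F. 2 - ?u ?s F - ?u ?t F)"
      by (intro Bochner_Integration.integrable_diff integrable_const u)
    show "(\<integral>F. 2 - ?u ?s F - ?u ?t F \<partial>Q) = 2 - integral\<^sup>L Q (?u ?s) - integral\<^sup>L Q (?u ?t)"
      using u by (simp add: prob_space)
  qed
  have "AE F in M. 2 - ?u ?s F - ?u ?t F \<le> of_bool (e \<in> F)"
    using M_inf
  proof eventually_elim
    case (elim F)
    show ?case
    proof (cases "e \<in> F")
      case False
      then show ?thesis using elim st by simp
    next
      case True
      have "unbounded (F - {e}) ?s \<or> unbounded (F - {e}) ?t"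
      proof (rule ccontr)
        assume "\<not> ?thesis"
        then have fin: "finite ({v. (?s, v) \<in> linked (F - {e})} \<union> {v. (?t, v) \<in> linked (F - {e})})"
          by (simp add: unbounded_def)
        \<comment> \<open>Without \<open>e\<close>, the component of \<open>?s\<close> falls into at
          most these two pieces, which cannot both be finite.\<close>
        have "{v. (?s, v) \<in> linked F} \<subseteq> {v. (?s, v) \<in> linked (F - {e})} \<union> {v. (?t, v) \<in> linked (F - {e})}"
          using conn_insert[of e ?s ?t ?s _ "{}" "F - {e}"] insert_Diff[OF True] by auto
        then have "\<not> unbounded F ?s" using fin finite_subset by (auto simp: unbounded_def)
        then show False using elim st by blast
      qed
      then show ?thesis using True by auto
    qed
  qed
  then have "(\<integral>F. 2 - ?u ?s F - ?u ?t F \<partial>M) \<le> (\<integral>F. of_bool (e \<in> F) \<partial>M)"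
    by (intro integral_mono_AE c_int[OF M] m_int[OF M])
  then have 1: "2 - integral\<^sup>L M (?u ?s) - integral\<^sup>L M (?u ?t) \<le> (\<integral>F. of_bool (e \<in> F) \<partial>M)"
    unfolding c_val[OF M] .
  have "AE F in N. (of_bool (e \<in> F) :: real) \<le> 2 - ?u ?s F - ?u ?t F"
    using N_inf N_one
  proof eventually_elim
    case (elim F)
    then show ?case using st by (cases "e \<in> F") auto
  qed
  then have "(\<integral>F. of_bool (e \<in> F) \<partial>N) \<le> (\<integral>F. 2 - ?u ?s F - ?u ?t F \<partial>N)"
    by (intro integral_mono_AE c_int[OF N] m_int[OF N])
  then have 2: "(\<integral>F. of_bool (e \<in> F) \<partial>N) \<le> 2 - integral\<^sup>L N (?u ?s) - integral\<^sup>L N (?u ?t)"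
    unfolding c_val[OF N] .
  have "integral\<^sup>L M (?u x) \<le> integral\<^sup>L N (?u x)" if "x \<in> verts G" for x
    by (rule unbounded_integrals(3)[OF that dom M N])
  from this[OF st(1)] this[OF st(2)]
  show "(\<integral>F. of_bool (e \<in> F) \<partial>N) \<le> (\<integral>F. of_bool (e \<in> F) \<partial>M :: real)" using 1 2 by linarith
qed

text \<open>A cycle is an edge \<open>e\<close> with a finite set \<open>D\<close> joining its ends.
  No basis contains both, so each such pair has limiting probability zero, and there are countably
  many pairs.\<close>

lemma law_acyclic:
  assumes "law_limit G \<F> (\<lambda>i. Ex (R i) (E i)) M" "\<F> \<noteq> bot"
  shows "AE F in M. indep {} F"
proof -
  have M: "prob_space M" "sets M = sets S" using assms(1) by (rule law_limit_prob, rule law_limit_sets)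
  interpret prob_space M by fact
  have sp: "space M = Pow (edges G)" using sets_eq_imp_space_eq[OF M(2)] by simp
  let ?I = "{(e, D). e \<in> edges G \<and> (finite D \<and> D \<subseteq> edges G) \<and> e \<notin> D \<and> en e \<in> linked D}"
  have ctb: "countable ?I"
  proof (rule countable_subset)
    show "?I \<subseteq> edges G \<times> {D. finite D \<and> D \<subseteq> edges G}" by auto
    show "countable (edges G \<times> {D. finite D \<and> D \<subseteq> edges G})"
      by (intro countable_SIGMA countable_edges countable_Collect_finite_subset)
  qed
  have "AE F in M. \<not> insert e D \<subseteq> F" if "(e, D) \<in> ?I" for e D
  proof -
    have D: "finite (insert e D)" "insert e D \<subseteq> edges G" using that by auto
    have "Ex (R i) (E i) (\<lambda>T. of_bool (insert e D \<subseteq> T)) = 0" for i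
    proof -
      have "\<not> insert e D \<subseteq> T" if T: "T \<in> bases (R i) (E i)" for T
      proof
        assume eD: "insert e D \<subseteq> T"
        have "linked D \<subseteq> conn (R i) (T - {e})" using eD \<open>(e, D) \<in> ?I\<close> by (intro conn_mono) auto
        then show False using basis_indep[of "R i" "E i" T e] T eD \<open>(e, D) \<in> ?I\<close> by (auto simp: bases_def)
      qed
      then have "Ex (R i) (E i) (\<lambda>T. of_bool (insert e D \<subseteq> T)) = Ex (R i) (E i) (\<lambda>T. 0)"
        by (intro Ex_cong) auto
      then show ?thesis by (simp add: Ex_def)
    qed
    moreover have "((\<lambda>i. Ex (R i) (E i) (\<lambda>T. of_bool (insert e D \<subseteq> T)))
      \<longlongrightarrow> measure M (superset_event G (insert e D))) \<F>"
      using assms(1) D unfolding law_limit_def by blast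
    ultimately have "((\<lambda>i. 0) \<longlongrightarrow> measure M (superset_event G (insert e D))) \<F>" by (simp only:)
    then have "measure M (superset_event G (insert e D)) = 0"
      by (rule tendsto_unique[OF assms(2) _ tendsto_const])
    then have "superset_event G (insert e D) \<in> null_sets M"
      using superset_event_sets[OF D] M(2) by (simp add: null_sets_def emeasure_eq_measure)
    then show ?thesis by (rule AE_I') (auto simp: sp)
  qed
  then have "AE F in M. \<forall>p\<in>?I. \<not> insert (fst p) (snd p) \<subseteq> F"
    by (intro AE_ball_countable[THEN iffD2] ctb) auto
  with AE_space show ?thesis
  proof eventually_elim
    case (elim F)
    show ?case unfolding indep_def
    proof (intro ballI notI)
      fix e assume e: "e \<in> F" "en e \<in> linked (F - {e})"
      then obtain D where D: "D \<subseteq> F - {e}" "finite D" "en e \<in> linked D"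
        using conn_finite_support[of "fst (en e)" "snd (en e)" "{}" "F - {e}"] by auto
      then have "(e, D) \<in> ?I" using e elim(1) sp by auto
      moreover have "insert e D \<subseteq> F" using D e by auto
      ultimately show False using elim(2) by fastforce
    qed
  qed
qed

text \<open>Every vertex lies in an infinite class, which reaches beyond each finite window. A wired
  basis therefore crosses the boundary of every nonempty finite set inside the window, and in the
  limit no finite set can be a component.\<close>

lemma wired_law_unbounded:
  assumes law: "wired_law (linked F) M" and F: "F \<subseteq> edges G"
    and inf: "\<And>x. x \<in> verts G \<Longrightarrow> unbounded F x"
  shows "AE X in M. \<forall>x\<in>verts G. unbounded X x"
proof -
  have M: "prob_space M" "sets M = sets S"
    using law unfolding wired_law_def by (rule law_limit_prob, rule law_limit_sets)
  interpret prob_space M by fact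
  have sp: "space M = Pow (edges G)" using sets_eq_imp_space_eq[OF M(2)] by simp
  let ?P = "linked F"
  define bd where "bd A = {e\<in>edges G. (fst (en e) \<in> A) \<noteq> (snd (en e) \<in> A)}" for A
  let ?I = "{A. (finite A \<and> A \<subseteq> verts G) \<and> A \<noteq> {}}"
  have ctb: "countable ?I"
    by (rule countable_subset[OF _ countable_Collect_finite_subset[OF countable_verts]]) auto
  have "AE X in M. X \<inter> bd A \<noteq> {}" if A: "A \<in> ?I" for A
  proof -
    have "bd A \<subseteq> touching A (edges G)" by (auto simp: bd_def touching_def)
    then have bdA: "finite (bd A)" "bd A \<subseteq> edges G"
      using finite_subset[OF _ finite_touching[of A]] touching_subset[of A] A by auto
    have "\<forall>\<^sub>F W in finite_subsets_at_top (verts G). Ex_wired (edges G) ?P W (\<lambda>T. of_bool (T \<inter> bd A = {})) = 0"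
      unfolding eventually_finite_subsets_at_top
    proof (intro exI[of _ A] conjI allI impI)
      fix W assume W: "finite W \<and> A \<subseteq> W \<and> W \<subseteq> verts G"
      let ?R = "wired_rel ?P W" and ?E = "touching W (edges_in ?P (edges G))"
      have "T \<inter> bd A \<noteq> {}" if T: "T \<in> bases ?R ?E" for T
      proof
        assume no: "T \<inter> bd A = {}"
        obtain x where x: "x \<in> A" using A by blast
        then have "infinite {v. (x, v) \<in> ?P}" using inf A by (auto simp: unbounded_def)
        then have "\<not> {v. (x, v) \<in> ?P} \<subseteq> W" using W finite_subset by blast
        then obtain z where z: "(x, z) \<in> ?P" "z \<notin> W" by blast
        \<comment> \<open>Edges of \<open>F\<close> that miss the window have identified ends, so
          the wired graph keeps all connections of \<open>F\<close>.\<close>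
        have "?P \<subseteq> conn ?R ?E"
        proof (rule conn_least)
          show "\<forall>e\<in>F. en e \<in> conn ?R ?E"
          proof
            fix e assume e: "e \<in> F"
            then have P: "en e \<in> ?P" by (rule conn_edge)
            show "en e \<in> conn ?R ?E"
            proof (cases "e \<in> touching W (edges G)")
              case True
              then show ?thesis using P e F by (intro conn_edge) (auto simp: touching_def edges_in_def)
            next
              case False
              then have "(fst (en e), snd (en e)) \<in> ?R" using P e F by (auto simp: wired_rel_def touching_def)
              then have "(fst (en e), snd (en e)) \<in> conn ?R ?E" by (rule conn_rel)
              then show ?thesis by simp
            qed
          qed
        qed simp
        then have "(x, z) \<in> conn ?R T" using z(1) basis_conn T by (auto simp: bases_def)
        \<comment> \<open>Edges of \<open>T\<close> do not cross the boundary of \<open>A\<close>,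
          and identifications concern only vertices outside \<open>W\<close>, hence outside
          \<open>A\<close>.\<close>
        then have "z \<in> A"
        proof (induction rule: conn_induct)
          case (rel a b)
          then show ?case using W by (auto simp: wired_rel_def)
        next
          case (edge e a b)
          then have "e \<notin> bd A" "e \<in> edges G"
            using no bases_subset[OF T] by (auto simp: touching_def edges_in_def)
          then show ?case using edge(2) by (auto simp: bd_def)
        qed (rule x)
        then show False using z W by blast
      qed
      then show "Ex_wired (edges G) ?P W (\<lambda>T. of_bool (T \<inter> bd A = {})) = 0"
        by (simp add: Ex_wired_def Ex_def)
    qed (use A in auto)
    then have "(\<integral>X. of_bool (X \<inter> bd A = {}) \<partial>M) = (0::real)"
      using tendsto_unique[OF _ wired_law_tendsto[OF law bdA local_on_trace[of "bd A" "{}"]]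
        tendsto_eventually] by simp
    then have 0: "measure M {X\<in>space M. X \<inter> bd A = {}} = 0"
      using integral_trace[OF M(2) bdA, of "{}"] by simp
    have "{X\<in>space M. X \<inter> bd A = {}} \<in> sets M"
    proof -
      have "{X\<in>space M. X \<inter> bd A = {}} = {X\<in>space S. \<forall>e\<in>bd A. \<not> e \<in> X}" by (auto simp: sp)
      also have "\<dots> \<in> sets S" using bdA(1) by measurable
      finally show ?thesis using M(2) by simp
    qed
    then have "{X\<in>space M. X \<inter> bd A = {}} \<in> null_sets M"
      using 0 by (simp add: null_sets_def emeasure_eq_measure)
    then show ?thesis by (rule AE_I') auto
  qed
  then have "AE X in M. \<forall>A\<in>?I. X \<inter> bd A \<noteq> {}"
    by (intro AE_ball_countable[THEN iffD2] ctb) auto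
  with AE_space show ?thesis
  proof eventually_elim
    case (elim X)
    have X: "X \<subseteq> edges G" using elim(1) sp by simp
    show ?case
    proof (intro ballI, unfold unbounded_def, rule notI)
      fix x assume x: "x \<in> verts G"
      let ?A = "{v. (x, v) \<in> linked X}"
      assume "finite ?A"
      moreover have "?A \<subseteq> verts G" using linked_verts[OF _ X x] by blast
      moreover have "x \<in> ?A" by simp
      ultimately have "X \<inter> bd ?A \<noteq> {}" using elim(2) by blast
      then obtain e where e: "e \<in> X" "(fst (en e) \<in> ?A) \<noteq> (snd (en e) \<in> ?A)" by (auto simp: bd_def)
      have "(fst (en e), snd (en e)) \<in> linked X" using conn_edge[OF e(1), of "{}"] by simp
      then show False using e(2) conn_trans conn_sym by blast
    qed
  qed
qed

text \<open>Koenig's lemma with self-avoidance built in: the invariant is that infinitely many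
  vertices can be reached while avoiding the visited ones.\<close>

lemma ray_exists:
  assumes F: "F \<subseteq> edges G" and x: "x \<in> verts G" and inf: "unbounded F x"
  obtains f :: "nat \<Rightarrow> 'v" and es :: "nat \<Rightarrow> 'e" where
    "f 0 = x" "inj f" "\<And>i. es i \<in> F \<and> endpoints G (es i) = {f i, f (Suc i)}"
proof -
  define av where "av U = {e\<in>F. fst (en e) \<notin> U \<and> snd (en e) \<notin> U}" for U
  define reach where "reach U y = {v. (y, v) \<in> linked (av U)}" for U y
  \<comment> \<open>The state is the current vertex with the set of visited ones. The last conjunct
    pins the initial state, which dependent choice would otherwise pick freely.\<close>
  let ?P = "\<lambda>n (y, U). y \<notin> U \<and> y \<in> verts G \<and> infinite (reach U y) \<and> (n = (0::nat) \<longrightarrow> (y, U) = (x, {}))"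
  let ?Q = "\<lambda>n (y, U) (z, U'). U' = insert y U \<and> (\<exists>e\<in>F. endpoints G e = {y, z})"
  have step: "\<exists>z. z \<notin> insert y U \<and> z \<in> verts G \<and> infinite (reach (insert y U) z) \<and> (\<exists>e\<in>F. endpoints G e = {y, z})"
    if y: "y \<notin> U" "y \<in> verts G" "infinite (reach U y)" for y U
  proof (rule ccontr)
    \<comment> \<open>If no neighbour kept the invariant, the set reached from \<open>y\<close>
      avoiding \<open>U\<close> would consist of \<open>y\<close> and finitely many finite sets, one
      for each admissible neighbour.\<close>
    let ?Nb = "{z. z \<notin> insert y U \<and> (\<exists>e\<in>F. endpoints G e = {y, z})}"
    assume none: "\<not> ?thesis"
    have fin: "finite (reach (insert y U) z)" if "z \<in> ?Nb" for z
    proof -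
      obtain g where "g \<in> edges G" "endpoints G g = {y, z}" using \<open>z \<in> ?Nb\<close> F by blast
      then have "z \<in> verts G"
        using endpoints_eq[of g] ends_in[of g] by (auto simp: doubleton_eq_iff)
      then show ?thesis using none that by blast
    qed
    have "?Nb \<subseteq> {z. (y, z) \<in> adjacency G}" using F by (auto simp: adjacency_def)
    then have "finite ?Nb" using finite_neighbours[OF y(2)] finite_subset by blast
    then have finI: "finite (insert y (\<Union>z\<in>?Nb. reach (insert y U) z))" using fin by blast
    have sub: "v \<in> insert y (\<Union>z\<in>?Nb. reach (insert y U) z)" if "(y, v) \<in> linked (av U)" for v
      using that
    proof (induction rule: conn_induct)
      case (edge e a b)
      have e: "e \<in> F" "a \<notin> U" "b \<notin> U" "endpoints G e = {a, b}"
        using edge F endpoints_eq[of e] by (auto simp: av_def)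
      have self: "w \<in> reach V' w" for w V' by (simp add: reach_def)
      have dir: "d \<in> insert y (\<Union>z\<in>?Nb. reach (insert y U) z)"
        if c: "c \<in> insert y (\<Union>z\<in>?Nb. reach (insert y U) z)" and cd: "{c, d} = {a, b}" "(c, d) = en e \<or> (d, c) = en e"
        for c d
      proof (cases "d = y \<or> c = y")
        case True
        show ?thesis
        proof (cases "d = y")
          case False
          then have "c = y" using True by simp
          then have "endpoints G e = {y, d}" "d \<notin> U" using e cd(1) by auto
          then have "d \<in> ?Nb" using False e(1) by blast
          then show ?thesis using self by blast
        qed simp
      next
        case False
        then obtain z where z: "z \<in> ?Nb" "c \<in> reach (insert y U) z" using c by blast
        have "e \<in> av (insert y U)" using e False cd edge by (auto simp: av_def doubleton_eq_iff)
        then have "en e \<in> linked (av (insert y U))" by (rule conn_edge)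
        then have "(c, d) \<in> linked (av (insert y U))" using cd(2) conn_sym by metis
        then have "d \<in> reach (insert y U) z" using z(2) conn_trans unfolding reach_def by blast
        then show ?thesis using z(1) by blast
      qed
      show ?case
      proof
        assume "a \<in> insert y (\<Union>z\<in>?Nb. reach (insert y U) z)"
        from dir[OF this refl] show "b \<in> insert y (\<Union>z\<in>?Nb. reach (insert y U) z)"
          using edge(2) by simp
      next
        assume "b \<in> insert y (\<Union>z\<in>?Nb. reach (insert y U) z)"
        from dir[OF this insert_commute] show "a \<in> insert y (\<Union>z\<in>?Nb. reach (insert y U) z)"
          using edge(2) by simp
      qed
    qed simp_all
    have "reach U y \<subseteq> insert y (\<Union>z\<in>?Nb. reach (insert y U) z)"
      unfolding reach_def[of U y] using sub by blast
    then show False using y(3) finite_subset[OF _ finI] by blast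
  qed
  have "av {} = F" by (auto simp: av_def)
  then have start: "\<exists>s. ?P 0 s" using x inf by (intro exI[of _ "(x, {})"]) (simp add: reach_def unbounded_def)
  have next_step: "\<exists>s'. ?P (Suc n) s' \<and> ?Q n s s'" if Ps: "?P n s" for n s
  proof -
    obtain y U where s: "s = (y, U)" by fastforce
    obtain z where "z \<notin> insert y U \<and> z \<in> verts G \<and> infinite (reach (insert y U) z) \<and> (\<exists>e\<in>F. endpoints G e = {y, z})"
      using step[of y U] Ps s by auto
    then show ?thesis by (intro exI[of _ "(z, insert y U)"]) (auto simp: s)
  qed
  obtain st where st: "\<And>n. ?P n (st n) \<and> ?Q n (st n) (st (Suc n))"
    using dependent_nat_choice[of ?P ?Q, OF start next_step] by blast
  define f where "f n = fst (st n)" for n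
  define U where "U n = snd (st n)" for n
  have f: "f n \<notin> U n" "U (Suc n) = insert (f n) (U n)" "\<exists>e\<in>F. endpoints G e = {f n, f (Suc n)}" "f 0 = x" for n
    using st[of n] st[of 0] unfolding f_def U_def by (auto simp: case_prod_unfold)
  have "i < j \<Longrightarrow> f i \<in> U j" for i j
    by (induction j) (auto simp: f(2) less_Suc_eq)
  then have "inj f" using f(1) by (intro linorder_inj_onI') metis
  moreover obtain es where "\<And>i. es i \<in> F \<and> endpoints G (es i) = {f i, f (Suc i)}"
    using f(3) by metis
  ultimately show thesis using that f(4) by blast
qed

text \<open>Having exactly one end includes having a ray, which visits infinitely many
  vertices.\<close>

lemma one_ended_unbounded:
  assumes F: "F \<subseteq> edges G" and one: "all_components_one_ended (spanning_subgraph G F)" and x: "x \<in> verts G"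
  shows "unbounded F x"
proof -
  obtain C where C: "C \<in> comps F" "x \<in> C" using comps_cover[OF F x] by blast
  have "tree_ends (part F C) \<noteq> {}"
    using one C(1) by (auto simp: all_components_one_ended_def one_ended_def is_singleton_def)
  then have "infinite_paths (part F C) \<noteq> {}" by (auto simp: tree_ends_def quotient_def)
  then obtain es and f :: "nat \<Rightarrow> 'v" where f: "inj f"
    "\<And>i. es i \<in> edges (part F C) \<and> endpoints (part F C) (es i) = {f i, f (Suc i)}"
    by (auto simp: infinite_paths_def)
  have "f i \<in> C" for i
  proof -
    have "endpoints G (es i) \<subseteq> C"
    proof -
      have "es i \<in> F" "fst (en (es i)) \<in> C" "snd (en (es i)) \<in> C"
        using f(2)[of i] by (simp_all add: part_simps[OF F])
      then show ?thesis using endpoints_eq[of "es i"] F by auto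
    qed
    then show ?thesis using f(2)[of i] by (auto simp: part_simps[OF F])
  qed
  then have "infinite C" using f(1) by (meson finite_subset image_subsetI infinite_UNIV_nat finite_imageD)
  moreover have "C \<subseteq> {v. (x, v) \<in> linked F}" using comps_memD[OF F C(1)] C(2) by blast
  ultimately show ?thesis unfolding unbounded_def using finite_subset by blast
qed

text \<open>If both sides of \<open>e\<close> were infinite, each would contain a ray. The rays
  share no edge, since otherwise the ends of \<open>e\<close> would be joined without
  \<open>e\<close>; so they represent different ends of the tree.\<close>

lemma one_ended_split:
  assumes F: "F \<subseteq> edges G" and one: "all_components_one_ended (spanning_subgraph G F)"
    and acyc: "indep {} F" and e: "e \<in> F"
  shows "\<not> (unbounded (F - {e}) (fst (en e)) \<and> unbounded (F - {e}) (snd (en e)))"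
proof
  let ?s = "fst (en e)" and ?t = "snd (en e)"
  assume inf: "unbounded (F - {e}) ?s \<and> unbounded (F - {e}) ?t"
  have st: "?s \<in> verts G" "?t \<in> verts G" using ends_in[of e] e F by auto
  have FE: "F - {e} \<subseteq> edges G" using F by auto
  obtain C where C: "C \<in> comps F" "?s \<in> C" using comps_cover[OF F st(1)] by blast
  have "(?s, ?t) \<in> linked F" using conn_edge[OF e, of "{}"] by simp
  then have tC: "?t \<in> C" using comps_linked_iff[OF F C(1)] C(2) by blast
  have ray: "\<exists>P \<in> infinite_paths (part F C). infinite P \<and>
      (\<forall>g\<in>P. \<forall>v\<in>endpoints G g. (x, v) \<in> linked (F - {e}))"
    if x: "x \<in> C" "x \<in> verts G" "unbounded (F - {e}) x" for x
  proof -
    obtain f :: "nat \<Rightarrow> 'v" and es where f: "f 0 = x" "inj f"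
      "\<And>i. es i \<in> F - {e} \<and> endpoints G (es i) = {f i, f (Suc i)}"
      using ray_exists[OF FE x(2,3)] by metis
    have adj: "(f i, f (Suc i)) \<in> linked (F - {e})" for i
    proof -
      have "en (es i) \<in> linked (F - {e})" using f(3) by (intro conn_edge) blast
      moreover have "{fst (en (es i)), snd (en (es i))} = {f i, f (Suc i)}"
        using endpoints_eq[of "es i"] f(3)[of i] F by auto
      ultimately show ?thesis by (cases "en (es i)") (auto simp: doubleton_eq_iff intro: conn_sym)
    qed
    have lk: "(x, f i) \<in> linked (F - {e})" for i
    proof (induction i)
      case (Suc i)
      then show ?case using adj conn_trans by blast
    qed (simp add: f(1))
    have fC: "f i \<in> C" for i
    proof -
      have "(x, f i) \<in> linked F" using lk conn_mono[of "{}" "{}" "F - {e}" F] by blast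
      then show ?thesis using comps_linked_iff[OF F C(1)] x(1) by blast
    qed
    have "es i \<in> edges (part F C)" for i
    proof -
      have "es i \<in> edges G" using f(3) F by blast
      then show ?thesis
        using f(3)[of i] endpoints_eq[of "es i"] fC[of i] fC[of "Suc i"]
        by (auto simp: part_simps[OF F] doubleton_eq_iff)
    qed
    then have "\<forall>i. es i \<in> edges (part F C) \<and> endpoints (part F C) (es i) = {f i, f (Suc i)}"
      using f(3) by (simp add: part_simps(2)[OF F])
    then have "range es \<in> infinite_paths (part F C)"
      unfolding infinite_paths_def using f(2) by blast
    \<comment> \<open>Inequivalence is about an infinite difference of edge sets, so the ray must
      have infinitely many edges.\<close>
    moreover have "inj es"
    proof (rule injI)
      fix i j assume "es i = es j"
      then have "{f i, f (Suc i)} = {f j, f (Suc j)}" using f(3) by metis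
      then show "i = j" using f(2) by (auto simp: doubleton_eq_iff inj_eq)
    qed
    then have "infinite (range es)" using finite_imageD infinite_UNIV_nat by blast
    moreover have "\<forall>g\<in>range es. \<forall>v\<in>endpoints G g. (x, v) \<in> linked (F - {e})"
      using f(3) lk by auto
    ultimately show ?thesis by blast
  qed
  obtain P where P: "P \<in> infinite_paths (part F C)" "infinite P"
    "\<And>g v. g \<in> P \<Longrightarrow> v \<in> endpoints G g \<Longrightarrow> (?s, v) \<in> linked (F - {e})"
    using ray[OF C(2) st(1)] inf by blast
  obtain P' where P': "P' \<in> infinite_paths (part F C)"
    "\<And>g v. g \<in> P' \<Longrightarrow> v \<in> endpoints G g \<Longrightarrow> (?t, v) \<in> linked (F - {e})"
    using ray[OF tC st(2)] inf by blast
  have "P \<inter> P' = {}"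
  proof (rule ccontr)
    assume "P \<inter> P' \<noteq> {}"
    then obtain g where g: "g \<in> P" "g \<in> P'" by blast
    have "endpoints G g \<noteq> {}"
      using P(1) g(1) by (auto simp: infinite_paths_def part_simps[OF F])
    then obtain v where "v \<in> endpoints G g" by blast
    then have "(?s, ?t) \<in> linked (F - {e})" using P(3) P'(2) g conn_trans conn_sym by blast
    then show False using indepD[OF acyc e] by simp
  qed
  let ?r = "{(P, Q). P \<in> infinite_paths (part F C) \<and> Q \<in> infinite_paths (part F C) \<and> finite ((P - Q) \<union> (Q - P))}"
  have "?r `` {P} \<in> tree_ends (part F C)" "?r `` {P'} \<in> tree_ends (part F C)"
    unfolding tree_ends_def by (rule quotientI[OF P(1)], rule quotientI[OF P'(1)])
  moreover obtain X where "tree_ends (part F C) = {X}"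
    using one C(1) by (auto simp: all_components_one_ended_def one_ended_def is_singleton_def)
  ultimately have "?r `` {P} = ?r `` {P'}" by (simp only: singleton_iff)
  moreover have "P \<in> ?r `` {P}" using P(1) by simp
  ultimately have "P \<in> ?r `` {P'}" by (simp only:)
  then have "finite (P - P')" by simp
  moreover have "P - P' = P" using \<open>P \<inter> P' = {}\<close> by blast
  ultimately show False using P(2) by simp
qed

section \<open>Stationarity of the resampling\<close>

lemma wired_law_props:
  assumes "wired_law P M"
  shows "prob_space M" "sets M = sets S" "AE F in M. indep {} F"
proof -
  have law: "law_limit G (finite_subsets_at_top (verts G))
    (\<lambda>W. Ex (wired_rel P W) (touching W (edges_in P (edges G)))) M"
    using assms by (simp add: wired_law_def Ex_wired_def[abs_def])
  show "prob_space M" "sets M = sets S" by (rule law_limit_prob[OF law], rule law_limit_sets[OF law])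
  show "AE F in M. indep {} F" by (rule law_acyclic[OF law]) simp
qed

lemma free_law_props:
  assumes "free_law P M"
  shows "prob_space M" "sets M = sets S" "AE F in M. indep {} F"
proof -
  have law: "law_limit G (finite_subsets_at_top (edges_in P (edges G))) (\<lambda>E. Ex {} E) M"
    using assms by (simp add: free_law_def)
  show "prob_space M" "sets M = sets S" by (rule law_limit_prob[OF law], rule law_limit_sets[OF law])
  show "AE F in M. indep {} F" by (rule law_acyclic[OF law]) simp
qed

lemma law_limit_within:
  assumes law: "law_limit G \<F> (\<lambda>i. Ex (R i) (E i)) M" and "\<F> \<noteq> bot"
    and ev: "\<forall>\<^sub>F i in \<F>. E i \<subseteq> A"
  shows "AE X in M. X \<subseteq> A"
proof -
  have M: "prob_space M" "sets M = sets S" using law by (rule law_limit_prob, rule law_limit_sets)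
  interpret prob_space M by fact
  have sp: "space M = Pow (edges G)" using sets_eq_imp_space_eq[OF M(2)] by simp
  have "AE X in M. e \<notin> X" if e: "e \<in> edges G - A" for e
  proof -
    have D: "finite {e}" "{e} \<subseteq> edges G" using e by auto
    have zero: "\<forall>\<^sub>F i in \<F>. Ex (R i) (E i) (\<lambda>T. of_bool ({e} \<subseteq> T)) = 0"
      using ev
    proof eventually_elim
      case (elim i)
      have "Ex (R i) (E i) (\<lambda>T. of_bool ({e} \<subseteq> T)) = Ex (R i) (E i) (\<lambda>T. 0)"
      proof (rule Ex_cong)
        fix T assume "T \<in> bases (R i) (E i)"
        then have "e \<notin> T" using bases_subset[of T] elim e by blast
        then show "of_bool ({e} \<subseteq> T) = (0::real)" by simp
      qed
      then show ?case by (simp add: Ex_def)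
    qed
    have "((\<lambda>i. Ex (R i) (E i) (\<lambda>T. of_bool ({e} \<subseteq> T))) \<longlongrightarrow> measure M (superset_event G {e})) \<F>"
      using law D unfolding law_limit_def by blast
    then have "measure M (superset_event G {e}) = 0"
      by (rule tendsto_unique[OF assms(2) _ tendsto_eventually[OF zero]])
    then have "superset_event G {e} \<in> null_sets M"
      using superset_event_sets[OF D] M(2) by (simp add: null_sets_def emeasure_eq_measure)
    then show ?thesis by (rule AE_I') (auto simp: sp)
  qed
  then have "AE X in M. \<forall>e\<in>edges G - A. e \<notin> X"
    by (intro AE_ball_countable[THEN iffD2] countable_Diff countable_edges) auto
  with AE_space show ?thesis by eventually_elim (auto simp: sp)
qed

lemma wired_law_within:
  assumes "wired_law P M"
  shows "AE X in M. X \<subseteq> edges_in P (edges G)"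
proof (rule law_limit_within)
  show "law_limit G (finite_subsets_at_top (verts G))
    (\<lambda>W. Ex (wired_rel P W) (touching W (edges_in P (edges G)))) M"
    using assms by (simp add: wired_law_def Ex_wired_def[abs_def])
qed (simp_all add: touching_subset)

lemma free_law_within:
  assumes "free_law P M"
  shows "AE X in M. X \<subseteq> edges_in P (edges G)"
proof (rule law_limit_within)
  show "law_limit G (finite_subsets_at_top (edges_in P (edges G))) (\<lambda>E. Ex {} E) M"
    using assms by (simp add: free_law_def)
  show "\<forall>\<^sub>F E in finite_subsets_at_top (edges_in P (edges G)). E \<subseteq> edges_in P (edges G)"
    by (rule eventually_finite_subsets_at_top_weakI)
qed simp

lemma linked_edges_in_subset:
  assumes "X \<subseteq> edges_in (linked F) (edges G)"
  shows "linked X \<subseteq> linked F"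
proof (rule conn_least)
  show "\<forall>e\<in>X. en e \<in> linked F" using assms unfolding edges_in_def by blast
qed simp

lemma eventually_spread_touching:
  assumes r: "r \<in> verts G" and X: "finite X" "X \<subseteq> edges G"
  shows "\<forall>\<^sub>F n in sequentially. X \<subseteq> touching (spread r n) (edges G)"
proof -
  let ?f = "\<lambda>n. edges G \<inter> touching (spread r n) (edges G)"
  have "\<forall>\<^sub>F n in sequentially. finite (?f n) \<and> X \<subseteq> ?f n \<and> ?f n \<subseteq> edges G"
    using spread_touching_filterlim[OF r order_refl] X unfolding filterlim_finite_subsets_at_top by simp
  then show ?thesis by (rule eventually_mono) blast
qed

text \<open>In a forest connecting its class, \<open>e\<close> is present iff its ends are not
  joined without it. The latter connection is an increasing event, which plays the part that
  \<open>unbounded\<close> plays for one-ended forests.\<close>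

lemma cycle_integrals:
  assumes "dominated G M N" "prob_space M" "sets M = sets S" "prob_space N" "sets N = sets S"
  shows "(\<integral>X. of_bool (en e \<in> linked (X - {e})) \<partial>M) \<le> (\<integral>X. of_bool (en e \<in> linked (X - {e})) \<partial>N :: real)"
    and "integrable M (\<lambda>X. of_bool (en e \<in> linked (X - {e})) :: real)"
    and "integrable N (\<lambda>X. of_bool (en e \<in> linked (X - {e})) :: real)"
proof -
  obtain r where r: "r \<in> verts G" using verts_nonempty by blast
  let ?D = "\<lambda>n. touching (spread r n) (edges G)"
  let ?\<phi> = "\<lambda>n X. of_bool (en e \<in> linked ((X - {e}) \<inter> ?D n)) :: real"
  have loc: "finite (?D n)" "?D n \<subseteq> edges G" "local_on (?D n) (?\<phi> n)" "\<bar>?\<phi> n X\<bar> \<le> 1" for n X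
  proof -
    have eq: "(X - {e}) \<inter> ?D n = (X \<inter> ?D n - {e}) \<inter> ?D n" for X by auto
    show "local_on (?D n) (?\<phi> n)" unfolding local_on_def by (simp only: eq[symmetric]) simp
  qed (use spread_touching(1)[OF r] touching_subset in auto)
  have inc: "increasing (?\<phi> n)" for n
    unfolding increasing_def
  proof (intro allI impI)
    fix X Y :: "'e set" assume "X \<subseteq> Y"
    then have "linked ((X - {e}) \<inter> ?D n) \<subseteq> linked ((Y - {e}) \<inter> ?D n)" by (intro conn_mono) auto
    then show "?\<phi> n X \<le> ?\<phi> n Y" by auto
  qed
  have conv: "(\<lambda>n. ?\<phi> n F) \<longlonglongrightarrow> of_bool (en e \<in> linked (F - {e}))" if F: "F \<subseteq> edges G" for F
  proof (rule tendsto_eventually)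
    show "\<forall>\<^sub>F n in sequentially. ?\<phi> n F = of_bool (en e \<in> linked (F - {e}))"
    proof (cases "en e \<in> linked (F - {e})")
      case True
      then obtain X where X: "X \<subseteq> F - {e}" "finite X" "en e \<in> linked X"
        using conn_finite_support[of "fst (en e)" "snd (en e)" "{}" "F - {e}"] by auto
      then have "X \<subseteq> edges G" using F by blast
      then have "\<forall>\<^sub>F n in sequentially. X \<subseteq> ?D n" by (rule eventually_spread_touching[OF r X(2)])
      then show ?thesis
      proof (rule eventually_mono)
        fix n assume "X \<subseteq> ?D n"
        then have "X \<subseteq> (F - {e}) \<inter> ?D n" using X(1) by blast
        then have "linked X \<subseteq> linked ((F - {e}) \<inter> ?D n)" by (rule conn_mono[OF order_refl])
        then have "en e \<in> linked ((F - {e}) \<inter> ?D n)" using X(3) by (rule subsetD)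
        then show "?\<phi> n F = of_bool (en e \<in> linked (F - {e}))" using True by simp
      qed
    next
      case False
      have "linked ((F - {e}) \<inter> ?D n) \<subseteq> linked (F - {e})" for n
        by (intro conn_mono) simp_all
      then have "en e \<notin> linked ((F - {e}) \<inter> ?D n)" for n using False by blast
      then show ?thesis using False by simp
    qed
  qed
  show "(\<integral>X. of_bool (en e \<in> linked (X - {e})) \<partial>M) \<le> (\<integral>X. of_bool (en e \<in> linked (X - {e})) \<partial>N :: real)"
    by (rule dominated_limit[OF assms, where \<phi> = ?\<phi> and D = ?D]) (use loc inc conv in auto)
  show "integrable M (\<lambda>X. of_bool (en e \<in> linked (X - {e})) :: real)"
    by (rule limit_of_local(2)[where \<phi> = ?\<phi> and D = ?D]) (use loc conv assms in auto)
  show "integrable N (\<lambda>X. of_bool (en e \<in> linked (X - {e})) :: real)"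
    by (rule limit_of_local(2)[where \<phi> = ?\<phi> and D = ?D]) (use loc conv assms in auto)
qed

text \<open>A wired forest that is already connected on every class cannot be enlarged without creating
  a cycle.\<close>

lemma wired_eq_free_if_connected:
  assumes F: "F \<subseteq> edges G" and M: "wired_law (linked F) M" and N: "free_law (linked F) N"
    and con: "AE X in M. \<forall>x\<in>verts G. \<forall>y\<in>verts G. (x, y) \<in> linked F \<longrightarrow> (x, y) \<in> linked X"
  shows "M = N"
proof -
  note Mp = wired_law_props[OF M] and Np = free_law_props[OF N]
  note dom = wired_dominated_free[OF M N]
  note cyc = cycle_integrals[OF dom Mp(1,2) Np(1,2)]
  interpret M: prob_space M by (rule Mp(1))
  interpret N: prob_space N by (rule Np(1))
  show ?thesis
  proof (rule equal_marginals[OF dom Mp(1,2) Np(1,2)])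
    fix e assume e: "e \<in> edges G"
    let ?J = "\<lambda>X. of_bool (en e \<in> linked (X - {e})) :: real"
    have m_int: "integrable Q (\<lambda>X. of_bool (e \<in> X) :: real)" if "prob_space Q" "sets Q = sets S" for Q
      by (rule local_integrable[OF that, of "{e}"]) (use e in \<open>auto simp: local_on_def\<close>)
    show "(\<integral>X. of_bool (e \<in> X) \<partial>N) \<le> (\<integral>X. of_bool (e \<in> X) \<partial>M :: real)"
    proof (cases "en e \<in> linked F")
      case True
      \<comment> \<open>Acyclicity: an edge of the free forest is the only connection of its
        ends.\<close>
      have "AE X in N. (of_bool (e \<in> X) :: real) \<le> 1 - ?J X"
        using Np(3) by eventually_elim (auto dest: indepD)
      then have "(\<integral>X. of_bool (e \<in> X) \<partial>N) \<le> (\<integral>X. 1 - ?J X \<partial>N)"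
        by (intro integral_mono_AE m_int[OF Np(1,2)] Bochner_Integration.integrable_diff cyc(3)) simp_all
      also have "\<dots> = 1 - integral\<^sup>L N ?J" using cyc(3) by (simp add: N.prob_space)
      also have "\<dots> \<le> 1 - integral\<^sup>L M ?J" using cyc(1) by simp
      also have "\<dots> = (\<integral>X. 1 - ?J X \<partial>M)" using cyc(2) by (simp add: M.prob_space)
      also have "\<dots> \<le> (\<integral>X. of_bool (e \<in> X) \<partial>M)"
      proof (intro integral_mono_AE m_int[OF Mp(1,2)] Bochner_Integration.integrable_diff cyc(2))
        \<comment> \<open>Connectedness: if \<open>e\<close> is missing from the wired forest, other
          edges join its ends.\<close>
        show "AE X in M. 1 - ?J X \<le> of_bool (e \<in> X)"
          using con
        proof eventually_elim
          case (elim X)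
          have "(fst (en e), snd (en e)) \<in> linked F" using True by simp
          then have "(fst (en e), snd (en e)) \<in> linked X" using elim ends_in[OF e] by blast
          then show ?case by (cases "e \<in> X") auto
        qed
      qed simp
      finally show ?thesis .
    next
      case False
      have "AE X in N. (of_bool (e \<in> X) :: real) = 0"
        using free_law_within[OF N]
      proof eventually_elim
        case (elim X)
        then have "e \<notin> X" using False unfolding edges_in_def by blast
        then show ?case by simp
      qed
      then have "(\<integral>X. of_bool (e \<in> X) \<partial>N) = (0::real)" by (rule integral_eq_zero_AE)
      also have "\<dots> \<le> (\<integral>X. of_bool (e \<in> X) \<partial>M)" by (rule integral_nonneg_AE) simp
      finally show ?thesis .
    qed
  qed
qed

context
  fixes \<mu> assumes \<mu>: "wired_law (linked (edges G)) \<mu>"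
begin

lemma resample_kernel: "resample_WSF \<in> measurable \<mu> (subprob_algebra S)" "resample_FSF \<in> measurable \<mu> (subprob_algebra S)"
  using resample_measurable wired_law_props(2)[OF \<mu>] by (simp_all cong: measurable_cong_sets)

lemma space_law: "space \<mu> = Pow (edges G)"
  using sets_eq_imp_space_eq[OF wired_law_props(2)[OF \<mu>]] by simp

lemma resample_props:
  "prob_space (\<mu> \<bind> resample_WSF)" "sets (\<mu> \<bind> resample_WSF) = sets S"
proof -
  interpret prob_space \<mu> by (rule wired_law_props(1)[OF \<mu>])
  show "prob_space (\<mu> \<bind> resample_WSF)"
  proof (rule prob_space_bind[OF _ resample_kernel(1)])
    show "AE F in \<mu>. prob_space (resample_WSF F)"
    proof (rule AE_I2)
      fix F assume "F \<in> space \<mu>"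
      then have "F \<subseteq> edges G" using space_law by simp
      then show "prob_space (resample_WSF F)" by (rule wired_law_props(1)[OF resample_WSF_law])
    qed
  qed
  show "sets (\<mu> \<bind> resample_WSF) = sets S"
    using sets_kernel[OF resample_kernel(1)] not_empty by (intro sets_bind) auto
qed

text \<open>The original forest is the dominating, one-ended one. For the resampled forest infinite
  components are enough, and they are inherited from the infinite components on which it is
  sampled.\<close>

lemma resample_WSF_one_ended:
  assumes one: "AE F in \<mu>. all_components_one_ended (spanning_subgraph G F)"
  shows "\<mu> \<bind> resample_WSF = \<mu>"
proof (rule one_ended_marginals[OF resample_WSF_dominated[OF \<mu>] resample_props wired_law_props(1,2)[OF \<mu>]])
  show inf: "AE F in \<mu>. \<forall>x\<in>verts G. unbounded F x"
    using one AE_space by eventually_elim (auto simp: space_law intro: one_ended_unbounded)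
  show "AE F in \<mu>. \<forall>e\<in>F. \<not> (unbounded (F - {e}) (fst (en e)) \<and> unbounded (F - {e}) (snd (en e)))"
    using one wired_law_props(3)[OF \<mu>] AE_space
  proof eventually_elim
    case (elim F)
    then have "F \<subseteq> edges G" using space_law by simp
    then show ?case using one_ended_split elim by blast
  qed
  have "AE X in (\<mu> \<bind> resample_WSF). unbounded X x" if x: "x \<in> verts G" for x
    unfolding AE_bind[OF resample_kernel(1) pred_unbounded[OF x]]
    using inf AE_space
  proof eventually_elim
    case (elim F)
    then have F: "F \<subseteq> edges G" using space_law by simp
    have "AE X in resample_WSF F. \<forall>x\<in>verts G. unbounded X x"
      by (rule wired_law_unbounded[OF resample_WSF_law[OF F] F]) (use elim in blast)
    then show ?case by eventually_elim (use x in blast)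
  qed
  then show "AE X in (\<mu> \<bind> resample_WSF). \<forall>x\<in>verts G. unbounded X x"
    by (intro AE_ball_countable[THEN iffD2] countable_verts) auto
qed

text \<open>Resampling can only refine the partition into components; being stationary, it does not
  change it.\<close>

lemma resample_connected:
  assumes stat: "\<mu> \<bind> resample_WSF = \<mu>"
  shows "AE F in \<mu>. AE X in resample_WSF F. \<forall>x\<in>verts G. \<forall>y\<in>verts G. (x, y) \<in> linked F \<longrightarrow> (x, y) \<in> linked X"
proof -
  interpret prob_space \<mu> by (rule wired_law_props(1)[OF \<mu>])
  have pair: "AE F in \<mu>. AE X in resample_WSF F. (x, y) \<in> linked F \<longrightarrow> (x, y) \<in> linked X" for x y
  proof -
    let ?A = "{X\<in>space S. (x, y) \<in> linked X}"
    \<comment> \<open>The conditional probability, given \<open>F\<close>, that resampling joins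
      \<open>x\<close> and \<open>y\<close>. It is at most the indicator that \<open>F\<close> joins
      them, and stationarity gives both the same mean, so they agree almost surely.\<close>
    let ?k = "\<lambda>F. measure (resample_WSF F) ?A"
    have A: "?A \<in> sets S" using pred_linked by (simp add: pred_def)
    have A': "?A \<in> sets \<mu>" using A wired_law_props(2)[OF \<mu>] by simp
    have k_meas: "?k \<in> borel_measurable \<mu>"
      by (rule measurable_compose[OF resample_kernel(1) measurable_measure_subprob_algebra[OF A]])
    have in_space: "F \<subseteq> edges G" if "F \<in> space \<mu>" for F using that space_law by simp
    have k_bd: "?k F \<le> indicator ?A F" "0 \<le> ?k F" "?k F \<le> 1" if F: "F \<in> space \<mu>" for F
    proof -
      note law = resample_WSF_law[OF in_space[OF F]]
      interpret K: prob_space "resample_WSF F" by (rule wired_law_props(1)[OF law])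
      show "0 \<le> ?k F" "?k F \<le> 1" by simp_all
      show "?k F \<le> indicator ?A F"
      proof (cases "F \<in> ?A")
        case False
        then have nl: "(x, y) \<notin> linked F" using F space_law by simp
        have "AE X in resample_WSF F. X \<notin> ?A"
          using wired_law_within[OF law]
        proof eventually_elim
          case (elim X)
          then show ?case using linked_edges_in_subset[OF elim] nl by blast
        qed
        then have "?k F = 0" using A wired_law_props(2)[OF law] by (subst K.prob_eq_0) auto
        then show ?thesis using False by simp
      qed simp
    qed
    have k_int: "integrable \<mu> ?k"
      by (rule integrable_const_bound[where B = 1]) (use k_meas k_bd in \<open>auto intro!: AE_I2\<close>)
    have i_int: "integrable \<mu> (indicator ?A :: _ \<Rightarrow> real)" using A' by (simp add: emeasure_eq_measure)
    have "measure \<mu> ?A = (\<integral>F. ?k F \<partial>\<mu>)"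
    proof -
      have "measure (\<mu> \<bind> resample_WSF) ?A = (\<integral>F. ?k F \<partial>\<mu>)"
        by (rule measure_bind[OF resample_kernel(1) A])
      then show ?thesis using stat by simp
    qed
    then have "(\<integral>F. indicator ?A F - ?k F \<partial>\<mu>) = 0"
      using k_int i_int A' sets.sets_into_space[OF A'] by (simp add: Int_absorb2)
    then have "AE F in \<mu>. indicator ?A F - ?k F = 0"
      using k_int i_int k_bd by (subst (asm) integral_nonneg_eq_0_iff_AE) (auto intro!: AE_I2)
    with AE_space show ?thesis
    proof eventually_elim
      case (elim F)
      note law = resample_WSF_law[OF in_space[OF elim(1)]]
      interpret K: prob_space "resample_WSF F" by (rule wired_law_props(1)[OF law])
      show ?case
      proof (cases "(x, y) \<in> linked F")
        case True
        then have "F \<in> ?A" using elim(1) space_law by simp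
        then have "?k F = 1" using elim(2) by simp
        then have "AE X in resample_WSF F. X \<in> ?A" by (rule K.AE_prob_1)
        then show ?thesis by eventually_elim simp
      qed simp
    qed
  qed
  then have "AE F in \<mu>. \<forall>p\<in>verts G \<times> verts G. AE X in resample_WSF F. p \<in> linked F \<longrightarrow> p \<in> linked X"
    by (intro AE_ball_countable[THEN iffD2] countable_SIGMA countable_verts) auto
  then show ?thesis
  proof eventually_elim
    case (elim F)
    then have "AE X in resample_WSF F. \<forall>p\<in>verts G \<times> verts G. p \<in> linked F \<longrightarrow> p \<in> linked X"
      by (intro AE_ball_countable[THEN iffD2] countable_SIGMA countable_verts) auto
    then show ?case by eventually_elim blast
  qed
qed

text \<open>For almost every \<open>F\<close> the resampled wired forest connects each component, so
  the two kernels agree there.\<close>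

lemma resample_FSF_eq:
  assumes stat: "\<mu> \<bind> resample_WSF = \<mu>"
  shows "\<mu> \<bind> resample_FSF = \<mu>"
proof -
  have "AE F in \<mu>. resample_FSF F = resample_WSF F"
    using resample_connected[OF stat] AE_space
  proof eventually_elim
    case (elim F)
    then have F: "F \<subseteq> edges G" using space_law by simp
    show ?case
      using wired_eq_free_if_connected[OF F resample_WSF_law[OF F] resample_FSF_law[OF F] elim(1)] ..
  qed
  then have "\<mu> \<bind> resample_FSF = \<mu> \<bind> resample_WSF"
    by (intro bind_cong_AE[OF refl resample_kernel(2,1)])
  then show ?thesis using stat by simp
qed

end

text \<open>Moves the component graph from the law into the kernel, so that the forest itself is the
  variable conditioned on.\<close>

lemma random_forest_eq:
  "WSF_random G (distr (WSF G) S (induced_component_graph G)) = WSF G \<bind> resample_WSF"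
  "FSF_random G (distr (WSF G) S (induced_component_graph G)) = WSF G \<bind> resample_FSF"
proof -
  note W = wired_law_props[OF WSF_law]
  have m: "induced_component_graph G \<in> measurable (WSF G) S"
    using induced_component_graph_measurable W(2) by (simp cong: measurable_cong_sets)
  have ne: "space (WSF G) \<noteq> {}" using prob_space.not_empty[OF W(1)] .
  show "WSF_random G (distr (WSF G) S (induced_component_graph G)) = WSF G \<bind> resample_WSF"
    unfolding WSF_random_def resample_WSF_def[abs_def] by (rule bind_distr[OF m sample_WSF_measurable ne])
  show "FSF_random G (distr (WSF G) S (induced_component_graph G)) = WSF G \<bind> resample_FSF"
    unfolding FSF_random_def resample_FSF_def[abs_def] by (rule bind_distr[OF m sample_FSF_measurable ne])
qed

text \<open>The comparison of marginals with the wired forest below and the free forest above; the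
  wired forest has infinite components because \<open>G\<close> is infinite and connected.\<close>

lemma FSF_one_ended_eq_WSF:
  assumes inf: "infinite (verts G)" and one: "AE F in FSF G. all_components_one_ended (spanning_subgraph G F)"
  shows "WSF G = FSF G"
proof -
  note W = wired_law_props[OF WSF_law] and FS = free_law_props[OF FSF_law]
  have sp: "space (FSF G) = Pow (edges G)" using sets_eq_imp_space_eq[OF FS(2)] by simp
  show ?thesis
  proof (rule one_ended_marginals[OF wired_dominated_free[OF WSF_law FSF_law] W(1,2) FS(1,2)])
    show "AE F in WSF G. \<forall>x\<in>verts G. unbounded F x"
    proof (rule wired_law_unbounded[OF WSF_law order_refl])
      fix x assume "x \<in> verts G"
      then have "verts G \<subseteq> {v. (x, v) \<in> linked (edges G)}" using linked_all by blast
      then show "unbounded (edges G) x" unfolding unbounded_def using inf finite_subset by blast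
    qed
    show "AE F in FSF G. \<forall>x\<in>verts G. unbounded F x"
      using one AE_space by eventually_elim (auto simp: sp intro: one_ended_unbounded)
    show "AE F in FSF G. \<forall>e\<in>F. \<not> (unbounded (F - {e}) (fst (en e)) \<and> unbounded (F - {e}) (snd (en e)))"
      using one FS(3) AE_space
    proof eventually_elim
      case (elim F)
      then have "F \<subseteq> edges G" using sp by simp
      then show ?case using one_ended_split elim by blast
    qed
  qed
qed

end

lemma orientation_exists:
  assumes "wf_graph G"
  obtains en where "\<And>e. e \<in> edges G \<Longrightarrow> endpoints G e = {fst (en e), snd (en e)}"
proof -
  have "\<exists>p. endpoints G e = {fst p, snd p}" if "e \<in> edges G" for e
  proof -
    have "card (endpoints G e) = 1 \<or> card (endpoints G e) = 2"
      using assms that by (auto simp: wf_graph_def)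
    then obtain u v where "endpoints G e = {u, v}"
      by (metis card_1_singletonE card_2_iff insert_absorb2)
    then show ?thesis by (intro exI[of _ "(u, v)"]) simp
  qed
  then show thesis using that by metis
qed

theorem corollary1p7:
  fixes G :: "('v, 'e) multigraph"
  assumes "wf_graph G"
    and "locally_finite_graph G"
    and "infinite (verts G)"
    and "connected_graph G"
  shows "((AE F in WSF G. all_components_one_ended (spanning_subgraph G F)) \<longrightarrow>
      WSF_random G (distr (WSF G) (subgraph_space G) (induced_component_graph G)) = WSF G)
    \<and> ((AE F in FSF G. all_components_one_ended (spanning_subgraph G F)) \<longrightarrow>
      FSF_random G (distr (WSF G) (subgraph_space G) (induced_component_graph G)) = FSF G)"
proof -
  obtain en where en: "\<And>e. e \<in> edges G \<Longrightarrow> endpoints G e = {fst (en e), snd (en e)}"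
    using orientation_exists[OF assms(1)] by metis
  interpret lf_graph en G
  proof
    fix e assume e: "e \<in> edges G"
    show "endpoints G e = {fst (en e), snd (en e)}" by (rule en[OF e])
    show "fst (en e) \<in> verts G \<and> snd (en e) \<in> verts G"
      using assms(1) e en[OF e] by (auto simp: wf_graph_def)
  qed (rule assms)+
  have stat: "WSF G \<bind> resample_WSF = WSF G"
    if "AE F in WSF G. all_components_one_ended (spanning_subgraph G F)"
    by (rule resample_WSF_one_ended[OF WSF_law that])
  show ?thesis
  proof (intro conjI impI)
    assume "AE F in WSF G. all_components_one_ended (spanning_subgraph G F)"
    then show "WSF_random G (distr (WSF G) (subgraph_space G) (induced_component_graph G)) = WSF G"
      unfolding random_forest_eq by (rule stat)
  next
    assume one: "AE F in FSF G. all_components_one_ended (spanning_subgraph G F)"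
    \<comment> \<open>The hypothesis concerns the free forest, stationarity the wired one; equality
      of the laws carries the hypothesis across.\<close>
    have eq: "WSF G = FSF G" by (rule FSF_one_ended_eq_WSF[OF assms(3) one])
    have "WSF G \<bind> resample_FSF = WSF G"
      using one unfolding eq[symmetric] by (intro resample_FSF_eq[OF WSF_law stat])
    then show "FSF_random G (distr (WSF G) (subgraph_space G) (induced_component_graph G)) = FSF G"
      unfolding random_forest_eq using eq by simp
  qed
qed

end
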